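(* Let $\alpha\in(0,2)$ and assume the setting described in the context ($\xi$ integer-valued, in the domain of attraction of an $\alpha$-stable law $\mathcal S_\alpha$, with normalising and centering sequences $(a_n),(b_n)$), with $p>0$ and $$\mathbb P(\xi=x)\sim p\,\alpha\,L(x)\,x^{-(1+\alpha)}\qquad\text{as }x\to\infty,\ x\in\mathbb N .$$ Let $(x_n)$ be a sequence of integers such that $\mathbb P(S_n-\lfloor b_n\rfloor=x_n)>0$ for all $n$ large. Then the condition $\lim_{n\to\infty}\frac{x_n}{a_n}=\infty$ is necessary and sufficient for $$\lim_{n\to\infty}d_{\mathrm{TV}}\Big(\mathscr L\big(R(\xi_1,\dots,\xi_n)\,\big|\,S_n-\lfloor b_n\rfloor=x_n\big),\ \mathscr L(\xi)^{\otimes(n-1)}\Big)=0 .$$ In particular, if $\lim_{n\to\infty}\frac{x_n}{a_n}=\infty$, then $$\mathscr L\Big(\frac{x_n-M_n}{a_n}\ \Big|\ S_n-\lfloor b_n\rfloor=x_n\Big)\xrightarrow[n\to\infty]{w}\mathscr L(\mathcal S_\alpha),$$ where $\xrightarrow{w}$ denotes weak convergence.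
   Context: $\xi$ is an integer-valued random variable, $\xi_1,\xi_2,\dots$ are i.i.d. copies, $F(x)=\mathbb P(\xi\le x)$, $\overline F=1-F$, $S_n=\sum_{i=1}^n\xi_i$, $M_n=\max\{\xi_1,\dots,\xi_n\}$. There is a slowly varying function $L$ and $p,q\ge0$ with $p+q=1$ such that $\overline F(x)\sim pL(x)x^{-\alpha}$ and $F(-x)\sim qL(x)x^{-\alpha}$ as $x\to\infty$ (if $q=0$ the second relation is read as $o(L(x)x^{-\alpha})$). $(a_n)$ is a positive sequence, $a_n\to\infty$, with $L(a_n)a_n^{-\alpha}\sim n^{-1}$, and $b_n=0$ if $\alpha\in(0,1)$, $b_n=n\mathbb E[\xi\mathbf 1_{\{|\xi|\le a_n\}}]$ if $\alpha=1$, $b_n=n\mathbb E[\xi]$ if $\alpha\in(1,2)$. Then $(S_n-b_n)/a_n$ converges in distribution to an $\alpha$-stable random variable, denoted $\mathcal S_\alpha$. For $y=(y_1,\dots,y_n)\in\mathbb R^n$, $R(y)\in\mathbb R^{n-1}$ is obtained from $y$ by deleting the coordinate $y_i$ with $i=\min\{i:\ y_i=\max_{1\le j\le n}y_j\}$ (keeping the order of the others). $\mathscr L(X\mid A)$ is the law of $X$ conditioned on the event $A$; $d_{\mathrm{TV}}(P,Q)=\sup_A|P(A)-Q(A)|$. *)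

theory Defs
  imports "HOL-Probability.Probability" "HOL-Library.Landau_Symbols"
begin

definition slowly_varying :: "(real \<Rightarrow> real) \<Rightarrow> bool" where
  "slowly_varying L \<longleftrightarrow>
     (\<exists>X>0. (\<forall>x\<ge>X. L x > 0) \<and> set_borel_measurable borel {X..} L) \<and>
     (\<forall>c>0. ((\<lambda>x. L (c * x) / L x) \<longlongrightarrow> 1) at_top)"

text \<open>A non-degenerate law is \<open>\<alpha>\<close>-stable (not necessarily strictly) if, for independent
  copies \<open>Y\<close>, \<open>Z\<close> and all \<open>s, t > 0\<close>, the variable \<open>s Y + t Z\<close> has the law of
  \<open>(s^\<alpha> + t^\<alpha>)^(1/\<alpha>) Y + d\<close> for some real \<open>d\<close>.\<close>

definition stable_law :: "real \<Rightarrow> real measure \<Rightarrow> bool" where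
  "stable_law \<alpha> \<sigma> \<longleftrightarrow>
     real_distribution \<sigma> \<and> (\<forall>c. \<sigma> \<noteq> return borel c) \<and>
     (\<forall>s>0. \<forall>t>0. \<exists>d.
        distr (\<sigma> \<Otimes>\<^sub>M \<sigma>) borel (\<lambda>(y, z). s * y + t * z) =
        distr \<sigma> borel (\<lambda>y. (s powr \<alpha> + t powr \<alpha>) powr (1 / \<alpha>) * y + d))"

text \<open>Vectors of length \<open>n\<close> are functions on \<open>{1..n}\<close>. In \<open>delete_max n y\<close> the first coordinate
  attaining the maximum is deleted, and the later coordinates move down by one.\<close>

definition first_argmax :: "nat \<Rightarrow> (nat \<Rightarrow> 'a::linorder) \<Rightarrow> nat" where
  "first_argmax n y = (LEAST i. i \<in> {1..n} \<and> y i = Max (y ` {1..n}))"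

definition delete_max :: "nat \<Rightarrow> (nat \<Rightarrow> 'a::linorder) \<Rightarrow> nat \<Rightarrow> 'a" where
  "delete_max n y = (\<lambda>j\<in>{1..n - 1}. if j < first_argmax n y then y j else y (Suc j))"

text \<open>Meant for probability measures \<open>P\<close>, \<open>Q\<close> on the same \<open>\<sigma>\<close>-algebra.\<close>

definition tv_dist :: "'a measure \<Rightarrow> 'a measure \<Rightarrow> real" where
  "tv_dist P Q = (SUP A\<in>sets P. \<bar>measure P A - measure Q A\<bar>)"

definition cond_law :: "'a measure \<Rightarrow> 'b measure \<Rightarrow> ('a \<Rightarrow> 'b) \<Rightarrow> 'a set \<Rightarrow> 'b measure" where
  "cond_law M N Y A = distr (uniform_measure M A) N Y"

definition dist_fun :: "'a measure \<Rightarrow> ('a \<Rightarrow> int) \<Rightarrow> real \<Rightarrow> real" where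
  "dist_fun M \<xi> = cdf (distr M borel (\<lambda>\<omega>. real_of_int (\<xi> \<omega>)))"

end

theory Submission
  imports Defs
begin

text \<open>
  If \<open>x\<^sub>n / a\<^sub>n \<longrightarrow> \<infinity>\<close>, the event \<open>S\<^sub>n - \<lfloor>b\<^sub>n\<rfloor> = x\<^sub>n\<close> is produced by a single jump near \<open>x\<^sub>n\<close>. For a typical
  vector \<open>g\<close> of the other \<open>n - 1\<close> steps the missing jump is \<open>x\<^sub>n + \<lfloor>b\<^sub>n\<rfloor> - \<Sum>g = x\<^sub>n + O(a\<^sub>n)\<close>, it is the
  strict maximum, and it can sit in \<open>n\<close> places; so the conditional law of the remaining vector is
  at least about \<open>n P(\<xi> = x\<^sub>n) / P(S\<^sub>n - \<lfloor>b\<^sub>n\<rfloor> = x\<^sub>n)\<close> times the product law on typical sets. Applied to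
  a set and to its complement, this gives convergence in total variation once
  \<open>P(S\<^sub>n - \<lfloor>b\<^sub>n\<rfloor> = x\<^sub>n) \<le> (1 + o(1)) n P(\<xi> = x\<^sub>n)\<close> is known. The contribution to that probability of
  vectors with a jump of size at least a fixed small multiple of \<open>x\<^sub>n\<close> is immediate. On the other vectors
  one conditions on all steps but the largest: the mass function at the largest step yields the local
  factor \<open>1 / a\<^sub>n\<close>, because negative moments of \<open>max / a\<^sub>n\<close> are bounded, and an exponential Chebyshev bound
  yields an arbitrarily high power of \<open>a\<^sub>n / x\<^sub>n\<close>. No local limit theorem is needed.

  Conversely, on the conditioning event the remaining vector \<open>g\<close> satisfies
  \<open>max g + \<Sum>g \<le> x\<^sub>n + \<lfloor>b\<^sub>n\<rfloor>\<close>. If \<open>x\<^sub>n \<le> K a\<^sub>n\<close> along a subsequence, this is a constraint that the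
  product law violates with probability bounded below, through one jump larger than a multiple of \<open>a\<^sub>n\<close>.
  The weak limit follows from \<open>x\<^sub>n - M\<^sub>n = \<Sum>g - \<lfloor>b\<^sub>n\<rfloor>\<close>.

  The slowly varying function enters only through the right tail \<open>G\<close>: the hypotheses amount to
  regular variation of \<open>G\<close>, \<open>P(|\<xi>| > t) = O(G t)\<close>, \<open>P(\<xi> = k) \<sim> \<alpha> G k / k\<close> and \<open>n G a\<^sub>n \<longrightarrow> p\<close>.
\<close>

section \<open>Potter bounds\<close>

text \<open>The ratio r = x n / a n may tend to infinity arbitrarily slowly, so every error has to
  be small relative to n P(\<xi> = x n), not merely small for large n. Potter's bound with exponent
  \<alpha> + 1 keeps this target above a constant times r powr -(\<alpha> + 2) / a n; vectors
  without a large jump must beat that power. The largest step is the one integrated out because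
  choosing its position costs a factor n, and n P(\<xi> = z) is of order 1 / a n for z of order a n.
  For smaller z the mass may be larger, but then all steps are small, which is very unlikely. This
  bound and the rare event of a large sum depend on the same remaining vector. A weighted quadratic
  inequality separates them at the price of half the exponent, hence the power 2 (\<alpha> + 3) in
  the exponential bound. That bound is centred by the mean truncated at a n, whose distance from b n
  / n is O(a n / n) for \<alpha> below, at and above 1, so the three centerings are treated alike
  afterwards.\<close>

lemma doubling_bracket:
  fixes r :: real
  assumes "r \<ge> 1"
  obtains j :: nat where "2 ^ j \<le> r" "r < 2 ^ Suc j"
proof -
  define j where "j = nat \<lfloor>log 2 r\<rfloor>"
  have l: "log 2 r \<ge> 0" using assms by simp
  have j1: "real j \<le> log 2 r" and j2: "log 2 r < real j + 1"
    using l unfolding j_def by linarith+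
  have "2 ^ j = 2 powr real j" by (simp add: powr_realpow)
  also have "\<dots> \<le> 2 powr (log 2 r)" using j1 by simp
  finally have a: "2 ^ j \<le> r" using assms by simp
  have "r = 2 powr (log 2 r)" using assms by simp
  also have "\<dots> < 2 powr (real (Suc j))" using j2 by (intro powr_less_mono) auto
  also have "\<dots> = 2 ^ Suc j" by (rule powr_realpow) simp
  finally show ?thesis using a that by blast
qed

text \<open>Monotonicity interpolates between dyadic points, so the limit for the single ratio 2
  suffices for both power bounds.\<close>

locale potter =
  fixes G :: "real \<Rightarrow> real" and \<alpha> :: real
  assumes G_pos: "\<And>t. 0 < G t" and G_le_1: "\<And>t. G t \<le> 1"
    and G_antimono: "\<And>s t. s \<le> t \<Longrightarrow> G t \<le> G s"
    and G_double: "((\<lambda>t. G (2 * t) / G t) \<longlongrightarrow> 2 powr (-\<alpha>)) at_top"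
    and alpha_pos: "0 < \<alpha>"
begin

text \<open>Beyond some X each doubling lowers \<open>G\<close> by at most the factor 2 powr
  -\<rho>, because \<rho> > \<alpha>. Below X the bound \<open>G \<le> 1\<close> is enough once the
  constant is divided by \<open>G X\<close>, so all z > 0 are covered.\<close>

lemma potter_upper:
  assumes "\<rho> > \<alpha>"
  obtains C where "C > 0" "\<And>z y. 0 < z \<Longrightarrow> z \<le> y \<Longrightarrow> G z \<le> C * (y / z) powr \<rho> * G y"
proof -
  have rho: "\<rho> > 0" using assms alpha_pos by simp
  have "2 powr (-\<rho>) < 2 powr (-\<alpha>)" using assms by simp
  from order_tendstoD(1)[OF G_double this]
  obtain X0 where X0: "\<And>t. t \<ge> X0 \<Longrightarrow> 2 powr (-\<rho>) < G (2 * t) / G t"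
    by (auto simp: eventually_at_top_linorder)
  define X where "X = max X0 1"
  have X1: "X \<ge> 1" by (simp add: X_def)
  have step: "G t \<le> 2 powr \<rho> * G (2 * t)" if "t \<ge> X" for t
  proof -
    have "2 powr (-\<rho>) < G (2 * t) / G t" using X0 that by (auto simp: X_def)
    then have "2 powr (-\<rho>) * G t < G (2 * t)" using G_pos[of t] by (simp add: pos_less_divide_eq)
    then show ?thesis using G_pos[of t] by (simp add: powr_minus field_simps)
  qed
  have iter: "G t \<le> (2 powr \<rho>) ^ j * G (2 ^ j * t)" if "t \<ge> X" for t j
  proof (induction j)
    case (Suc j)
    have "1 * t \<le> 2 ^ j * t" using that X1 by (intro mult_right_mono) auto
    then have "2 ^ j * t \<ge> X" using that by simp
    from step[OF this] have "(2 powr \<rho>) ^ j * G (2 ^ j * t) \<le> (2 powr \<rho>) ^ j * (2 powr \<rho> * G (2 * (2 ^ j * t)))"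
      by (intro mult_left_mono) auto
    from order.trans[OF Suc this] show ?case by (simp add: ac_simps)
  qed simp
  have main: "G z \<le> 2 powr \<rho> * (y / z) powr \<rho> * G y" if "X \<le> z" "z \<le> y" for z y
  proof -
    have z0: "z > 0" using that X1 by simp
    have "y / z \<ge> 1" using that z0 by simp
    then obtain j where j: "2 ^ j \<le> y / z" "y / z < 2 ^ Suc j" by (rule doubling_bracket)
    have "y \<le> 2 ^ Suc j * z" using j(2) z0 by (simp add: field_simps)
    then have "G (2 ^ Suc j * z) \<le> G y" by (rule G_antimono)
    then have "G z \<le> (2 powr \<rho>) ^ Suc j * G y"
      using iter[OF that(1), of "Suc j"] by (smt (verit) mult_left_mono zero_le_power powr_ge_zero)
    also have "(2 powr \<rho>) ^ Suc j = 2 powr \<rho> * (2 ^ j) powr \<rho>"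
      by (simp add: powr_powr powr_realpow[symmetric] ac_simps)
    also have "\<dots> * G y \<le> 2 powr \<rho> * (y / z) powr \<rho> * G y"
      using j rho G_pos[of y] by (intro mult_right_mono mult_left_mono powr_mono2) auto
    finally show ?thesis .
  qed
  have GX: "G X > 0" "G X \<le> 1" using G_pos G_le_1 by auto
  have two: "2 powr \<rho> \<ge> 1" using rho by (simp add: ge_one_powr_ge_zero)
  show ?thesis
  proof (rule that[of "2 powr \<rho> / G X"])
    fix z y :: real assume zy: "0 < z" "z \<le> y"
    have nn: "(y / z) powr \<rho> * G y \<ge> 0" using G_pos[of y] by simp
    have yz1: "(y / z) powr \<rho> \<ge> 1" using zy rho by (intro ge_one_powr_ge_zero) auto
    consider "X \<le> z" | "z < X" "X \<le> y" | "z < X" "y < X" by linarith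
    then show "G z \<le> 2 powr \<rho> / G X * (y / z) powr \<rho> * G y"
    proof cases
      case 1
      have "2 powr \<rho> * ((y / z) powr \<rho> * G y) \<le> 2 powr \<rho> / G X * ((y / z) powr \<rho> * G y)"
        using GX nn by (intro mult_right_mono) (auto simp: field_simps)
      then show ?thesis using main[OF 1 zy(2)] by (simp add: ac_simps)
    next
      case 2
      have "G X \<le> 2 powr \<rho> * (y / X) powr \<rho> * G y" using main[of X y] 2 by simp
      also have "\<dots> \<le> 2 powr \<rho> * (y / z) powr \<rho> * G y"
        using 2 zy rho G_pos[of y] X1
        by (intro mult_right_mono mult_left_mono powr_mono2 divide_left_mono) auto
      finally have "1 \<le> 2 powr \<rho> / G X * (y / z) powr \<rho> * G y" using GX by (simp add: field_simps)
      then show ?thesis using G_le_1[of z] by linarith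
    next
      case 3
      have "G X \<le> 1 * (1 * G y)" using G_antimono[of y X] 3 by simp
      also have "\<dots> \<le> 2 powr \<rho> * ((y / z) powr \<rho> * G y)"
        using two yz1 G_pos[of y] by (intro mult_mono) auto
      finally have "1 \<le> 2 powr \<rho> / G X * (y / z) powr \<rho> * G y" using GX by (simp add: field_simps)
      then show ?thesis using G_le_1[of z] by linarith
    qed
  qed (use GX in simp)
qed

text \<open>Each doubling beyond X gains at least 2 powr -\<rho>. The range from 1 to X costs the
  factor X powr \<rho>. For \<rho> > 0 the right side tends to 0 with z, hence the restriction to z
  at least 1.\<close>

lemma potter_lower:
  assumes "0 \<le> \<rho>" "\<rho> < \<alpha>"
  obtains C where "C > 0" "\<And>z y. 1 \<le> z \<Longrightarrow> z \<le> y \<Longrightarrow> G y \<le> C * (y / z) powr (-\<rho>) * G z"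
proof -
  have "2 powr (-\<alpha>) < 2 powr (-\<rho>)" using assms by simp
  from order_tendstoD(2)[OF G_double this]
  obtain X0 where X0: "\<And>t. t \<ge> X0 \<Longrightarrow> G (2 * t) / G t < 2 powr (-\<rho>)"
    by (auto simp: eventually_at_top_linorder)
  define X where "X = max X0 1"
  have X1: "X \<ge> 1" by (simp add: X_def)
  have step: "G (2 * t) \<le> 2 powr (-\<rho>) * G t" if "t \<ge> X" for t
  proof -
    have "G (2 * t) / G t < 2 powr (-\<rho>)" using X0 that by (auto simp: X_def)
    then show ?thesis using G_pos[of t] by (simp add: pos_divide_less_eq)
  qed
  have iter: "G (2 ^ j * t) \<le> (2 powr (-\<rho>)) ^ j * G t" if "t \<ge> X" for t j
  proof (induction j)
    case (Suc j)
    have "1 * t \<le> 2 ^ j * t" using that X1 by (intro mult_right_mono) auto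
    then have "2 ^ j * t \<ge> X" using that by simp
    from step[OF this] have "G (2 * (2 ^ j * t)) \<le> 2 powr (-\<rho>) * ((2 powr (-\<rho>)) ^ j * G t)"
      using Suc by (smt (verit) mult_left_mono powr_ge_zero)
    then show ?case by (simp add: ac_simps)
  qed simp
  have main: "G y \<le> 2 powr \<rho> * (y / z) powr (-\<rho>) * G z" if "X \<le> z" "z \<le> y" for z y
  proof -
    have z0: "z > 0" using that X1 by simp
    have "y / z \<ge> 1" using that z0 by simp
    then obtain j where j: "2 ^ j \<le> y / z" "y / z < 2 ^ Suc j" by (rule doubling_bracket)
    have "2 ^ j * z \<le> y" using j(1) z0 by (simp add: field_simps)
    then have "G y \<le> (2 powr (-\<rho>)) ^ j * G z" using iter[OF that(1), of j] G_antimono order_trans by blast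
    also have "(2 powr (-\<rho>)) ^ j = 2 powr \<rho> * (2 ^ Suc j) powr (-\<rho>)"
      by (simp add: powr_powr powr_realpow[symmetric] powr_mult powr_minus field_simps)
    also have "\<dots> * G z \<le> 2 powr \<rho> * (y / z) powr (-\<rho>) * G z"
      using j assms G_pos[of z] z0 that by (intro mult_right_mono mult_left_mono powr_mono2') auto
    finally show ?thesis .
  qed
  have two: "2 powr \<rho> \<ge> 1" using assms by (simp add: ge_one_powr_ge_zero)
  have Xp: "X powr \<rho> \<ge> 1" using assms X1 by (simp add: ge_one_powr_ge_zero)
  show ?thesis
  proof (rule that[of "2 powr \<rho> * X powr \<rho>"])
    fix z y :: real assume zy: "1 \<le> z" "z \<le> y"
    have nn: "(y / z) powr (-\<rho>) * G z \<ge> 0" using G_pos[of z] by simp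
    consider "X \<le> z" | "z < X" "X \<le> y" | "z < X" "y < X" by linarith
    then show "G y \<le> 2 powr \<rho> * X powr \<rho> * (y / z) powr (-\<rho>) * G z"
    proof cases
      case 1
      have "2 powr \<rho> * 1 * ((y / z) powr (-\<rho>) * G z) \<le> 2 powr \<rho> * X powr \<rho> * ((y / z) powr (-\<rho>) * G z)"
        using Xp nn by (intro mult_right_mono mult_left_mono) auto
      then show ?thesis using main[OF 1 zy(2)] by (simp add: ac_simps)
    next
      case 2
      have "G y \<le> 2 powr \<rho> * (y / X) powr (-\<rho>) * G X" using main[of X y] 2 by simp
      also have "(y / X) powr (-\<rho>) = X powr \<rho> * y powr (-\<rho>)"
        using X1 2 by (simp add: powr_divide powr_minus field_simps)
      also have "2 powr \<rho> * (X powr \<rho> * y powr (-\<rho>)) * G X \<le> 2 powr \<rho> * (X powr \<rho> * (y / z) powr (-\<rho>)) * G z"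
        using 2 zy assms G_pos[of z] G_pos[of X] X1 G_antimono[of z X]
        by (intro mult_mono mult_left_mono powr_mono2') (auto simp: field_simps)
      finally show ?thesis by (simp add: ac_simps)
    next
      case 3
      have "y / z \<le> X" using 3 zy by (simp add: field_simps) (smt (verit) mult_left_le mult_left_mono mult_le_cancel_left1 X1)
      then have "X powr (-\<rho>) \<le> (y / z) powr (-\<rho>)"
        using zy assms X1 by (intro powr_mono2') auto
      then have "1 \<le> X powr \<rho> * (y / z) powr (-\<rho>)" using X1 by (simp add: powr_minus field_simps)
      then have "1 * 1 * G z \<le> 2 powr \<rho> * (X powr \<rho> * (y / z) powr (-\<rho>)) * G z"
        using two G_pos[of z] by (intro mult_mono) auto
      then show ?thesis using G_antimono[OF zy(2)] by (simp add: ac_simps)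
    qed
  qed (use X1 in auto)
qed

end

section \<open>Independent vectors with one coordinate removed\<close>

text \<open>Off the index range the vectors take the value \<open>undefined\<close>, as extensional
  functions do, so \<open>restrict\<close> fixes every vector in the support and the comparison with
  product measures is direct.\<close>

definition iid :: "int pmf \<Rightarrow> nat \<Rightarrow> (nat \<Rightarrow> int) pmf" where
  "iid D n = Pi_pmf {1..n} undefined (\<lambda>_. D)"

abbreviation iid_prob :: "int pmf \<Rightarrow> nat \<Rightarrow> (nat \<Rightarrow> int) set \<Rightarrow> real" where
  "iid_prob D n \<equiv> measure_pmf.prob (iid D n)"

text \<open>
  \<open>insert_at i z g\<close> puts \<open>z\<close> at position \<open>i\<close> and moves the later coordinates of \<open>g\<close> up by one. The junk
  value \<open>skip i i = 0\<close> lies outside the index ranges \<open>{1..m}\<close>.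
\<close>

definition skip :: "nat \<Rightarrow> nat \<Rightarrow> nat" where
  "skip i j = (if j < i then j else if j = i then 0 else j - 1)"

definition insert_at :: "nat \<Rightarrow> int \<Rightarrow> (nat \<Rightarrow> int) \<Rightarrow> nat \<Rightarrow> int" where
  "insert_at i z g = (g \<circ> skip i)(i := z)"

lemma bij_betw_skip:
  assumes "i \<in> {1..Suc m}"
  shows "bij_betw (skip i) ({1..Suc m} - {i}) {1..m}"
  using assms
  by (intro bij_betwI[where g = "\<lambda>j. if j < i then j else Suc j"]) (auto simp: skip_def split: if_splits)

lemma iid_Suc:
  assumes "i \<in> {1..Suc m}"
  shows "iid D (Suc m) = map_pmf (\<lambda>(z, g). insert_at i z g) (pair_pmf D (iid D m))"
proof -
  have "iid D (Suc m) = Pi_pmf (insert i ({1..Suc m} - {i})) undefined (\<lambda>_. D)"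
    unfolding iid_def using assms by (simp add: insert_absorb)
  also have "\<dots> = map_pmf (\<lambda>(z, f). f(i := z)) (pair_pmf D (Pi_pmf ({1..Suc m} - {i}) undefined (\<lambda>_. D)))"
    by (rule Pi_pmf_insert) auto
  also have "Pi_pmf ({1..Suc m} - {i}) undefined (\<lambda>_. D) = map_pmf (\<lambda>g. g \<circ> skip i) (iid D m)"
    unfolding iid_def
  proof (rule Pi_pmf_bij_betw)
    show "bij_betw (skip i) ({1..Suc m} - {i}) {1..m}" by (rule bij_betw_skip[OF assms])
    fix j assume "j \<notin> {1..Suc m} - {i}"
    then have "j = i \<or> j = 0 \<or> j > Suc m" by auto
    then show "skip i j \<notin> {1..m}" using assms by (elim disjE; simp add: skip_def; arith)
  qed simp
  also have "pair_pmf D (map_pmf (\<lambda>g. g \<circ> skip i) (iid D m)) =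
      map_pmf (apsnd (\<lambda>g. g \<circ> skip i)) (pair_pmf D (iid D m))"
    by (rule pair_map_pmf2)
  finally show ?thesis
    by (simp add: pmf.map_comp o_def case_prod_unfold insert_at_def fun_upd_def cong: if_cong)
qed

lemma sum_insert_at:
  assumes "i \<in> {1..Suc m}"
  shows "(\<Sum>j=1..Suc m. insert_at i z g j) = z + (\<Sum>j=1..m. g j)"
proof -
  have "(\<Sum>j=1..Suc m. insert_at i z g j) = insert_at i z g i + (\<Sum>j\<in>{1..Suc m} - {i}. insert_at i z g j)"
    using assms by (intro sum.remove) auto
  also have "(\<Sum>j\<in>{1..Suc m} - {i}. insert_at i z g j) = (\<Sum>j\<in>{1..Suc m} - {i}. g (skip i j))"
    by (intro sum.cong) (auto simp: insert_at_def)
  also have "\<dots> = (\<Sum>j=1..m. g j)"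
    by (rule sum.reindex_bij_betw[OF bij_betw_skip[OF assms]])
  finally show ?thesis by (simp add: insert_at_def)
qed

lemma insert_at_same [simp]: "insert_at i z g i = z"
  by (simp add: insert_at_def)

lemma ball_insert_at:
  assumes "i \<in> {1..Suc m}"
  shows "(\<forall>j\<in>{1..Suc m} - {i}. P (insert_at i z g j)) \<longleftrightarrow> (\<forall>j\<in>{1..m}. P (g j))"
proof -
  have "(\<forall>j\<in>{1..Suc m} - {i}. P (insert_at i z g j)) \<longleftrightarrow> (\<forall>j\<in>{1..Suc m} - {i}. P (g (skip i j)))"
    by (auto simp: insert_at_def)
  also have "\<dots> \<longleftrightarrow> (\<forall>j\<in>skip i ` ({1..Suc m} - {i}). P (g j))"
    by blast
  also have "skip i ` ({1..Suc m} - {i}) = {1..m}"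
    using bij_betw_skip[OF assms] by (simp add: bij_betw_def)
  finally show ?thesis .
qed

text \<open>Given the other steps, the constraint on the sum determines the removed one; integrating
  it out leaves its point mass. This is how the mass function enters every local estimate.\<close>

lemma prob_iid_sum_eq:
  assumes i: "i \<in> {1..Suc m}"
  shows "iid_prob D (Suc m) {y. (\<Sum>j=1..Suc m. y j) = k \<and> \<Phi> y} =
    measure_pmf.expectation (iid D m) (\<lambda>g. pmf D (k - (\<Sum>j=1..m. g j)) *
      indicator {g. \<Phi> (insert_at i (k - (\<Sum>j=1..m. g j)) g)} g)"
proof -
  let ?s = "\<lambda>g::nat \<Rightarrow> int. \<Sum>j=1..m. g j"
  let ?B = "{g. \<Phi> (insert_at i (k - ?s g) g)}"
  have "emeasure (iid D (Suc m)) {y. (\<Sum>j=1..Suc m. y j) = k \<and> \<Phi> y} =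
      emeasure (pair_pmf D (iid D m)) {(z, g). z = k - ?s g \<and> \<Phi> (insert_at i (k - ?s g) g)}"
  proof -
    have "(\<lambda>(z, g). insert_at i z g) -` {y. (\<Sum>j=1..Suc m. y j) = k \<and> \<Phi> y} =
        {(z, g). z = k - ?s g \<and> \<Phi> (insert_at i (k - ?s g) g)}"
      unfolding vimage_def case_prod_unfold mem_Collect_eq sum_insert_at[OF i] by force
    then show ?thesis unfolding iid_Suc[OF i] by simp
  qed
  also have "\<dots> = (\<integral>\<^sup>+ x. indicator {(z, g). z = k - ?s g \<and> \<Phi> (insert_at i (k - ?s g) g)} x \<partial>pair_pmf D (iid D m))"
    by simp
  also have "\<dots> = (\<integral>\<^sup>+ g. \<integral>\<^sup>+ z. indicator {(z, g). z = k - ?s g \<and> \<Phi> (insert_at i (k - ?s g) g)} (z, g) \<partial>D \<partial>iid D m)"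
    by (subst pair_commute_pmf) (simp add: nn_integral_pair_pmf' case_prod_unfold)
  also have "\<dots> = (\<integral>\<^sup>+ g. ennreal (pmf D (k - ?s g) * indicator ?B g) \<partial>iid D m)"
  proof (intro nn_integral_cong)
    fix g
    have "(\<integral>\<^sup>+ z. indicator {(z, g). z = k - ?s g \<and> \<Phi> (insert_at i (k - ?s g) g)} (z, g) \<partial>D) =
       (\<integral>\<^sup>+ z. indicator {k - ?s g} z * indicator ?B g \<partial>D)"
      by (intro nn_integral_cong) (auto split: split_indicator)
    also have "\<dots> = ennreal (pmf D (k - ?s g) * indicator ?B g)"
      by (simp add: nn_integral_multc emeasure_pmf_single ennreal_mult ennreal_indicator split: split_indicator)
    finally show "(\<integral>\<^sup>+ z. indicator {(z, g). z = k - ?s g \<and> \<Phi> (insert_at i (k - ?s g) g)} (z, g) \<partial>D) =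
        ennreal (pmf D (k - ?s g) * indicator ?B g)" .
  qed
  also have "\<dots> = ennreal (measure_pmf.expectation (iid D m) (\<lambda>g. pmf D (k - ?s g) * indicator ?B g))"
    by (intro nn_integral_eq_integral measure_pmf.integrable_const_bound[where B = 1])
       (auto simp: pmf_le_1 split: split_indicator)
  finally show ?thesis
    by (simp add: measure_pmf.emeasure_eq_measure Bochner_Integration.integral_nonneg)
qed

text \<open>Union bound over the position of the distinguished step. \<open>\<Psi>\<close> is free
  of the position, so all summands have the same bound.\<close>

lemma prob_iid_sum_eq_le:
  assumes "\<And>i z g. i \<in> {1..Suc m} \<Longrightarrow> \<Phi> i (insert_at i z g) \<Longrightarrow> \<Psi> z g"
  shows "iid_prob D (Suc m) {y. (\<Sum>j=1..Suc m. y j) = k \<and> (\<exists>i\<in>{1..Suc m}. \<Phi> i y)} \<le>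
    real (Suc m) * measure_pmf.expectation (iid D m) (\<lambda>g. pmf D (k - (\<Sum>j=1..m. g j)) *
      indicator {g. \<Psi> (k - (\<Sum>j=1..m. g j)) g} g)"
proof -
  let ?s = "\<lambda>g::nat \<Rightarrow> int. \<Sum>j=1..m. g j"
  let ?I = "measure_pmf.expectation (iid D m) (\<lambda>g. pmf D (k - ?s g) * indicator {g. \<Psi> (k - ?s g) g} g)"
  have "{y. (\<Sum>j=1..Suc m. y j) = k \<and> (\<exists>i\<in>{1..Suc m}. \<Phi> i y)} =
      (\<Union>i\<in>{1..Suc m}. {y. (\<Sum>j=1..Suc m. y j) = k \<and> \<Phi> i y})" by auto
  then have "iid_prob D (Suc m) {y. (\<Sum>j=1..Suc m. y j) = k \<and> (\<exists>i\<in>{1..Suc m}. \<Phi> i y)} \<le>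
      (\<Sum>i\<in>{1..Suc m}. iid_prob D (Suc m) {y. (\<Sum>j=1..Suc m. y j) = k \<and> \<Phi> i y})"
    using measure_pmf.finite_measure_subadditive_finite[of "{1..Suc m}"
        "\<lambda>i. {y. (\<Sum>j=1..Suc m. y j) = k \<and> \<Phi> i y}" "iid D (Suc m)"] by simp
  also have "\<dots> \<le> (\<Sum>i\<in>{1..Suc m}. ?I)"
  proof (intro sum_mono)
    fix i assume i: "i \<in> {1..Suc m}"
    show "iid_prob D (Suc m) {y. (\<Sum>j=1..Suc m. y j) = k \<and> \<Phi> i y} \<le> ?I"
      unfolding prob_iid_sum_eq[OF i]
      by (intro integral_mono measure_pmf.integrable_const_bound[where B = 1])
         (use assms[OF i] in \<open>auto simp: pmf_le_1 split: split_indicator\<close>)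
  qed
  finally show ?thesis by simp
qed

lemma first_argmax_eqI:
  assumes "i \<in> {1..n}" "\<And>j. j \<in> {1..n} - {i} \<Longrightarrow> y j < y i"
  shows "first_argmax n y = i"
proof -
  have le: "y j \<le> y i" if "j \<in> {1..n}" for j
    using assms(2)[of j] that by (cases "j = i") auto
  have M: "Max (y ` {1..n}) = y i"
    using assms(1) le by (intro Max_eqI) auto
  show ?thesis
    unfolding first_argmax_def
  proof (rule Least_equality)
    fix j assume "j \<in> {1..n} \<and> y j = Max (y ` {1..n})"
    then have "j = i" using assms(2)[of j] M by (metis DiffI less_irrefl singletonD)
    then show "i \<le> j" by simp
  qed (use assms(1) M in simp)
qed

text \<open>Strictness excludes an earlier tie, so the first position of the maximum is the inserted
  one.\<close>

lemma delete_max_insert_at: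
  assumes i: "i \<in> {1..Suc m}" and g: "\<forall>j\<in>{1..m}. g j < z"
  shows "delete_max (Suc m) (insert_at i z g) = restrict g {1..m}"
proof -
  have "\<forall>j\<in>{1..Suc m} - {i}. insert_at i z g j < z"
    using ball_insert_at[OF i, of "\<lambda>v. v < z"] g by blast
  then have "first_argmax (Suc m) (insert_at i z g) = i"
    using i by (intro first_argmax_eqI) (simp_all only: insert_at_same)
  then show ?thesis
    unfolding delete_max_def by (auto simp: restrict_def insert_at_def skip_def fun_eq_iff)
qed

lemma set_pmf_iid: "g \<in> set_pmf (iid D m) \<Longrightarrow> restrict g {1..m} = g"
  using set_Pi_pmf_subset[of "{1..m}" undefined "\<lambda>_. D"]
  by (auto simp: iid_def restrict_def fun_eq_iff)

text \<open>A strict maximum has only one position, so the events for different positions are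
  disjoint and their probabilities add. The lower bound thus carries the same factor
  \<open>Suc m\<close> as the union bound above it.\<close>

lemma prob_iid_delete_max_ge:
  "iid_prob D (Suc m) {y. (\<Sum>j=1..Suc m. y j) = k \<and> delete_max (Suc m) y \<in> A} \<ge>
    real (Suc m) * measure_pmf.expectation (iid D m) (\<lambda>g. pmf D (k - (\<Sum>j=1..m. g j)) *
      indicator {g. g \<in> A \<and> (\<forall>j\<in>{1..m}. g j < k - (\<Sum>j=1..m. g j))} g)"
proof -
  let ?s = "\<lambda>g::nat \<Rightarrow> int. \<Sum>j=1..m. g j"
  let ?I = "measure_pmf.expectation (iid D m) (\<lambda>g. pmf D (k - ?s g) *
     indicator {g. g \<in> A \<and> (\<forall>j\<in>{1..m}. g j < k - ?s g)} g)"
  let ?P = "iid_prob D (Suc m)"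
  let ?E = "\<lambda>i. {y. (\<Sum>j=1..Suc m. y j) = k \<and>
     ((\<forall>j\<in>{1..Suc m} - {i}. y j < y i) \<and> delete_max (Suc m) y \<in> A)}"
  have "?P (?E i) = ?I" if i: "i \<in> {1..Suc m}" for i
  proof -
    have *: "(\<forall>j\<in>{1..Suc m} - {i}. insert_at i z g j < z) \<longleftrightarrow> (\<forall>j\<in>{1..m}. g j < z)" for g z
      by (rule ball_insert_at[OF i])
    show ?thesis
      unfolding prob_iid_sum_eq[OF i] insert_at_same *
    \<comment> \<open>Equality holds only on the support: \<open>delete_max\<close> returns
      \<open>restrict g {1..m}\<close>, which need not be \<open>g\<close> elsewhere.\<close>
    proof (intro integral_cong_AE AE_pmfI)
      fix g assume "g \<in> set_pmf (iid D m)"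
      then have r: "restrict g {1..m} = g" by (rule set_pmf_iid)
      have "(\<forall>j\<in>{1..m}. g j < z) \<and> delete_max (Suc m) (insert_at i z g) \<in> A \<longleftrightarrow>
          g \<in> A \<and> (\<forall>j\<in>{1..m}. g j < z)" for z
        using delete_max_insert_at[OF i, of g z] r by metis
      then show "pmf D (k - ?s g) * indicator {g. (\<forall>j\<in>{1..m}. g j < k - ?s g) \<and>
            delete_max (Suc m) (insert_at i (k - ?s g) g) \<in> A} g =
          pmf D (k - ?s g) * indicator {g. g \<in> A \<and> (\<forall>j\<in>{1..m}. g j < k - ?s g)} g"
        unfolding indicator_def mem_Collect_eq by presburger
    qed simp_all
  qed
  then have "(\<Sum>i\<in>{1..Suc m}. ?P (?E i)) = real (Suc m) * ?I"
    by simp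
  moreover have "(\<Sum>i\<in>{1..Suc m}. ?P (?E i)) = ?P (\<Union>i\<in>{1..Suc m}. ?E i)"
  proof (rule measure_pmf.finite_measure_finite_Union[symmetric])
    show "disjoint_family_on ?E {1..Suc m}"
      unfolding disjoint_family_on_def
    proof safe
      fix i j y assume "i \<in> {1..Suc m}" "j \<in> {1..Suc m}" "i \<noteq> j"
        and "\<forall>l\<in>{1..Suc m} - {i}. y l < y i" "\<forall>l\<in>{1..Suc m} - {j}. y l < (y j :: int)"
      then have "y i < y j" "y j < y i" by auto
      then show "y \<in> {}" by simp
    qed
  qed auto
  moreover have "\<dots> \<le> ?P {y. (\<Sum>j=1..Suc m. y j) = k \<and> delete_max (Suc m) y \<in> A}"
    by (intro measure_pmf.finite_measure_mono) auto
  ultimately show ?thesis by linarith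
qed

lemma prob_iid_all: "iid_prob D m {y. \<forall>j\<in>{1..m}. y j \<in> B} = measure_pmf.prob D B ^ m"
proof -
  have "{y. \<forall>j\<in>{1..m}. y j \<in> B} = Pi {1..m} (\<lambda>_. B)" by auto
  then show ?thesis unfolding iid_def by (simp add: measure_Pi_pmf_Pi)
qed

lemma map_iid_component: "j \<in> {1..m} \<Longrightarrow> map_pmf (\<lambda>y. y j) (iid D m) = D"
  unfolding iid_def by (subst Pi_pmf_component) auto

lemma prob_iid_ex_le: "iid_prob D m {y. \<exists>j\<in>{1..m}. y j \<in> B} \<le> real m * measure_pmf.prob D B"
proof -
  have "iid_prob D m {y. \<exists>j\<in>{1..m}. y j \<in> B} =
      iid_prob D m (\<Union>j\<in>{1..m}. {y. y j \<in> B})"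
    by (intro arg_cong[where f = "measure _"]) auto
  also have "\<dots> \<le> (\<Sum>j\<in>{1..m}. iid_prob D m {y. y j \<in> B})"
    by (intro measure_pmf.finite_measure_subadditive_finite) auto
  also have "\<dots> = (\<Sum>j\<in>{1..m}. measure_pmf.prob D B)"
  proof (intro sum.cong refl)
    fix j assume "j \<in> {1..m}"
    from map_iid_component[OF this, of D]
    show "iid_prob D m {y. y j \<in> B} = measure_pmf.prob D B"
      using measure_map_pmf[of "\<lambda>y. y j" "iid D m" B] by (simp add: vimage_def)
  qed
  finally show ?thesis by simp
qed

text \<open>Transfers events about the sum from m + 1 steps, where the normalisation is given, to
  the m steps left after the deletion. \<open>R\<close> collects the exceptional values of the
  additional step.\<close>

lemma prob_iid_Suc_sum:
  "iid_prob D m {g. P (\<Sum>j=1..m. g j)} \<le>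
     iid_prob D (Suc m) {y. Q (\<Sum>j=1..Suc m. y j)} + measure_pmf.prob D {z. R z}"
  if "\<And>s z. P s \<Longrightarrow> Q (z + s) \<or> R z"
proof -
  have i: "Suc m \<in> {1..Suc m}" by simp
  let ?N = "pair_pmf D (iid D m)"
  have "iid_prob D m {g. P (\<Sum>j=1..m. g j)} = measure_pmf.prob (map_pmf snd ?N) {g. P (\<Sum>j=1..m. g j)}"
    by (simp add: map_snd_pair_pmf)
  also have "\<dots> = measure_pmf.prob ?N {x. P (\<Sum>j=1..m. snd x j)}"
    by (simp add: measure_map_pmf vimage_def)
  also have "\<dots> \<le> measure_pmf.prob ?N ({x. Q (fst x + (\<Sum>j=1..m. snd x j))} \<union> {x. R (fst x)})"
    using that by (intro measure_pmf.finite_measure_mono) auto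
  also have "\<dots> \<le> measure_pmf.prob ?N {x. Q (fst x + (\<Sum>j=1..m. snd x j))} + measure_pmf.prob ?N {x. R (fst x)}"
    by (intro measure_Un_le) auto
  also have "measure_pmf.prob ?N {x. R (fst x)} = measure_pmf.prob (map_pmf fst ?N) {z. R z}"
    by (simp add: measure_map_pmf vimage_def)
  also have "measure_pmf.prob ?N {x. Q (fst x + (\<Sum>j=1..m. snd x j))} =
      iid_prob D (Suc m) {y. Q (\<Sum>j=1..Suc m. y j)}"
    unfolding iid_Suc[OF i] measure_map_pmf vimage_def case_prod_unfold mem_Collect_eq sum_insert_at[OF i] ..
  finally show ?thesis by (simp add: map_fst_pair_pmf)
qed

section \<open>Truncated moments\<close>

text \<open>The bracket is strict on the left because the tail events of \<open>large_moment\<close>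
  are strict inequalities.\<close>

lemma doubling_bracket_left:
  fixes r :: real
  assumes "r > 1"
  obtains j :: nat where "2 ^ j < r" "r \<le> 2 ^ Suc j"
proof -
  obtain j where j: "2 ^ j \<le> r" "r < 2 ^ Suc j" using doubling_bracket[of r] assms by auto
  show ?thesis
  proof (cases "2 ^ j = r")
    case True
    with assms obtain i where "j = Suc i" by (cases j) auto
    then show ?thesis using that[of i] True by auto
  next
    case False
    then show ?thesis using that[of j] j by auto
  qed
qed

lemma exp_le_quadratic:
  fixes u :: real
  assumes "\<bar>u\<bar> \<le> 1"
  shows "exp u \<le> 1 + u + u\<^sup>2"
proof (cases "u \<ge> 0")
  case True
  then show ?thesis using exp_bound assms by auto
next
  case False
  define v where "v = - u"
  have v: "v > 0" using False by (simp add: v_def)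
  have "exp u = 1 / exp v" by (simp add: v_def exp_minus field_simps)
  also have "\<dots> \<le> 1 / (1 + v)" using exp_ge_add_one_self[of v] v by (intro divide_left_mono) auto
  also have "\<dots> \<le> 1 - v + v\<^sup>2"
  proof -
    have "(1 - v + v\<^sup>2) * (1 + v) = 1 + v ^ 3" by (simp add: algebra_simps power2_eq_square power3_eq_cube)
    then have "1 \<le> (1 - v + v\<^sup>2) * (1 + v)" using v by simp
    moreover have "0 < 1 + v" using v by simp
    ultimately show ?thesis by (simp only: pos_divide_le_eq)
  qed
  finally show ?thesis by (simp add: v_def)
qed

text \<open>The function is dominated by the sum of \<open>c j\<close> times the indicator of
  \<open>B j\<close>; the layers may overlap. Working with nonnegative integrals yields
  integrability along with the bound.\<close>

lemma expectation_layer_bound: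
  fixes f :: "'a \<Rightarrow> real" and Q :: "'a pmf"
  assumes f: "\<And>x. 0 \<le> f x" and B: "\<And>x. f x \<noteq> 0 \<Longrightarrow> \<exists>j::nat. x \<in> B j \<and> f x \<le> c j"
    and c: "\<And>j. 0 \<le> c j" and e: "\<And>j. c j * measure_pmf.prob Q (B j) \<le> e j" and "summable e"
  shows "integrable Q f" "measure_pmf.expectation Q f \<le> suminf e"
proof -
  have e0: "0 \<le> e j" for j using e[of j] c[of j] by (meson mult_nonneg_nonneg measure_nonneg order_trans)
  have "(\<integral>\<^sup>+ x. ennreal (f x) \<partial>Q) \<le> (\<integral>\<^sup>+ x. (\<Sum>j. ennreal (c j) * indicator (B j) x) \<partial>Q)"
  proof (intro nn_integral_mono)
    fix x
    show "ennreal (f x) \<le> (\<Sum>j. ennreal (c j) * indicator (B j) x)"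
    proof (cases "f x = 0")
      case False
      from B[OF this] obtain j where j: "x \<in> B j" "f x \<le> c j" by blast
      have "ennreal (f x) \<le> ennreal (c j) * indicator (B j) x" using j by (simp add: ennreal_leI)
      also have "\<dots> \<le> (\<Sum>j. ennreal (c j) * indicator (B j) x)"
      proof -
        have "h j \<le> suminf h" for h :: "nat \<Rightarrow> ennreal" using sum_le_suminf[of h "{j}"] by simp
        then show ?thesis .
      qed
      finally show ?thesis .
    qed simp
  qed
  also have "\<dots> = (\<Sum>j. \<integral>\<^sup>+ x. ennreal (c j) * indicator (B j) x \<partial>Q)"
    by (intro nn_integral_suminf) simp
  also have "\<dots> = (\<Sum>j. ennreal (c j * measure_pmf.prob Q (B j)))"
    by (intro suminf_cong) (simp add: nn_integral_cmult measure_pmf.emeasure_eq_measure ennreal_mult c)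
  also have "\<dots> \<le> (\<Sum>j. ennreal (e j))"
    by (intro suminf_le summableI ennreal_leI e)
  also have "\<dots> = ennreal (suminf e)"
    by (intro suminf_ennreal2 e0 assms)
  finally have *: "(\<integral>\<^sup>+ x. ennreal (f x) \<partial>Q) \<le> ennreal (suminf e)" .
  then show int: "integrable Q f"
    by (intro integrableI_bounded) (auto simp: f intro: le_less_trans)
  have "ennreal (measure_pmf.expectation Q f) \<le> ennreal (suminf e)"
    using * by (subst nn_integral_eq_integral[symmetric]) (auto simp: int f)
  then show "measure_pmf.expectation Q f \<le> suminf e"
    using suminf_nonneg[OF assms(5) e0] by (simp add: ennreal_le_iff)
qed

definition upper_tail :: "int pmf \<Rightarrow> real \<Rightarrow> real" where
  "upper_tail D t = measure_pmf.prob D {z. t < real_of_int z}"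

locale tail_law =
  fixes D :: "int pmf" and \<alpha> :: real
  assumes alpha: "0 < \<alpha>" "\<alpha> < 2"
    and tail_pos: "\<And>t. 0 < upper_tail D t"
    and tail_scale: "\<And>c. c > 0 \<Longrightarrow> ((\<lambda>t. upper_tail D (c * t) / upper_tail D t) \<longlongrightarrow> c powr (-\<alpha>)) at_top"
    and abs_tail: "\<exists>C. \<forall>t\<ge>0. measure_pmf.prob D {z. t < \<bar>real_of_int z\<bar>} \<le> C * upper_tail D t"
    and pmf_tail: "(\<lambda>k::nat. real k * pmf D (int k) / upper_tail D (real k)) \<longlonglongrightarrow> \<alpha>"
begin

abbreviation G :: "real \<Rightarrow> real" where "G \<equiv> upper_tail D"

sublocale potter "upper_tail D" \<alpha>
proof
  show "((\<lambda>t. G (2 * t) / G t) \<longlongrightarrow> 2 powr (-\<alpha>)) at_top" by (rule tail_scale) simp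
  show "s \<le> t \<Longrightarrow> G t \<le> G s" for s t
    unfolding upper_tail_def by (intro measure_pmf.finite_measure_mono) auto
qed (auto simp: tail_pos alpha, simp add: upper_tail_def)

lemma abs_tail_bound:
  obtains C where "C > 0" "\<And>t. t \<ge> 0 \<Longrightarrow> measure_pmf.prob D {z. t < \<bar>real_of_int z\<bar>} \<le> C * G t"
proof -
  obtain C where C: "\<And>t. t \<ge> 0 \<Longrightarrow> measure_pmf.prob D {z. t < \<bar>real_of_int z\<bar>} \<le> C * G t"
    using abs_tail by blast
  show ?thesis
  proof (rule that[of "max C 1"])
    fix t :: real assume "t \<ge> 0"
    from C[OF this] show "measure_pmf.prob D {z. t < \<bar>real_of_int z\<bar>} \<le> max C 1 * G t"
      using G_pos[of t] by (smt (verit) mult_right_mono)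
  qed simp
qed

lemma pmf_le_tail:
  obtains C where "C > 0" "\<And>z::int. z \<ge> 1 \<Longrightarrow> pmf D z \<le> C * G (real_of_int z) / real_of_int z"
proof -
  have "Bseq (\<lambda>k::nat. real k * pmf D (int k) / G (real k))"
    using pmf_tail by (intro convergent_imp_Bseq convergentI)
  then obtain C where C: "C > 0" "\<And>k::nat. norm (real k * pmf D (int k) / G (real k)) \<le> C"
    unfolding Bseq_def by blast
  show ?thesis
  proof (rule that[OF C(1)])
    fix z :: int assume z: "z \<ge> 1"
    then obtain k where k: "z = int k" "k \<ge> 1"
      by (metis nat_le_iff int_nat_eq nat_eq_iff2 zero_le_one order_trans of_nat_1 of_nat_le_iff)
    show "pmf D z \<le> C * G (real_of_int z) / real_of_int z"
      using C(2)[of k] k G_pos[of "real k"] by (simp add: field_simps abs_mult)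
  qed
qed

text \<open>On the dyadic layer of size about y / 2^j the integrand is at most 2 powr (-j \<beta>),
  while the probability is at most a constant times 2 powr (j \<rho>) times \<open>G y\<close>. Any
  \<rho> strictly between \<alpha> and \<beta> makes the series geometric.\<close>

lemma small_moment:
  assumes "\<beta> > \<alpha>"
  obtains C where "C > 0" "\<And>y. y > 0 \<Longrightarrow>
    measure_pmf.expectation D (\<lambda>z. (\<bar>real_of_int z\<bar> / y) powr \<beta> * indicator {z. \<bar>real_of_int z\<bar> \<le> y} z) \<le> C * G y"
proof -
  define \<rho> where "\<rho> = (\<alpha> + \<beta>) / 2"
  have rho: "\<alpha> < \<rho>" "\<rho> < \<beta>" using assms by (auto simp: \<rho>_def)
  obtain C1 where C1: "C1 > 0" "\<And>t. t \<ge> 0 \<Longrightarrow> measure_pmf.prob D {z. t < \<bar>real_of_int z\<bar>} \<le> C1 * G t"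
    using abs_tail_bound by blast
  obtain C2 where C2: "C2 > 0" "\<And>z y. 0 < z \<Longrightarrow> z \<le> y \<Longrightarrow> G z \<le> C2 * (y / z) powr \<rho> * G y"
    using potter_upper[OF rho(1)] by blast
  define q where "q = (2::real) powr (\<rho> - \<beta>)"
  have q: "0 < q" "q < 1" using rho by (auto simp: q_def powr_less_one)
  define K where "K = C1 * C2 * 2 powr \<rho>"
  show ?thesis
  proof (rule that[of "K * (1 / (1 - q))"])
    show "K * (1 / (1 - q)) > 0" using q C1 C2 by (simp add: K_def)
    fix y :: real assume y: "y > 0"
    let ?f = "\<lambda>z. (\<bar>real_of_int z\<bar> / y) powr \<beta> * indicator {z. \<bar>real_of_int z\<bar> \<le> y} z"
    let ?B = "\<lambda>j::nat. {z::int. y / 2 ^ Suc j < \<bar>real_of_int z\<bar>}"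
    have sm: "summable (\<lambda>j. K * G y * q ^ j)" using q by (intro summable_mult summable_geometric) simp
    have "measure_pmf.expectation D ?f \<le> suminf (\<lambda>j. K * G y * q ^ j)"
    proof (rule expectation_layer_bound(2)[where c = "\<lambda>j. (1 / 2 ^ j) powr \<beta>" and B = ?B])
      fix z assume "?f z \<noteq> 0"
      then have z: "z \<noteq> 0" "\<bar>real_of_int z\<bar> \<le> y" by (auto split: split_indicator_asm)
      then have "y / \<bar>real_of_int z\<bar> \<ge> 1" by simp
      then obtain j where j: "2 ^ j \<le> y / \<bar>real_of_int z\<bar>" "y / \<bar>real_of_int z\<bar> < 2 ^ Suc j"
        by (rule doubling_bracket)
      have "z \<in> ?B j" using j(2) z by (simp add: field_simps)
      moreover have "\<bar>real_of_int z\<bar> / y \<le> 1 / 2 ^ j" using j(1) z y by (simp add: field_simps)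
      then have "?f z \<le> (1 / 2 ^ j) powr \<beta>"
        using z y assms alpha by (auto intro!: powr_mono2)
      ultimately show "\<exists>j. z \<in> ?B j \<and> ?f z \<le> (1 / 2 ^ j) powr \<beta>" by blast
    next
      fix j :: nat
      have "measure_pmf.prob D (?B j) \<le> C1 * G (y / 2 ^ Suc j)" using y by (intro C1) simp
      also have "\<dots> \<le> C1 * (C2 * (y / (y / 2 ^ Suc j)) powr \<rho> * G y)"
      proof (intro mult_left_mono C2)
        have "y / 2 ^ Suc j \<le> y / 1" using y one_le_power[of "2::real" "Suc j"] by (intro divide_left_mono) auto
        then show "y / 2 ^ Suc j \<le> y" by simp
      qed (use C1 y in auto)
      also have "\<dots> = K * G y * (2 powr \<rho>) ^ j"
        using y by (simp add: K_def powr_mult powr_power powr_realpow[symmetric] powr_powr mult.commute)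
      finally have "(1 / 2 ^ j) powr \<beta> * measure_pmf.prob D (?B j) \<le>
          (1 / 2 ^ j) powr \<beta> * (K * G y * (2 powr \<rho>) ^ j)"
        by (intro mult_left_mono) auto
      also have "(1 / 2 ^ j) powr \<beta> * (K * G y * (2 powr \<rho>) ^ j) = K * G y * q ^ j"
      proof -
        have "(1 / 2 ^ j :: real) powr \<beta> = (1 / 2 powr \<beta>) ^ j"
          by (simp add: powr_divide powr_power powr_realpow[symmetric] powr_powr field_simps)
        then show ?thesis by (simp add: q_def powr_diff power_divide)
      qed
      finally show "(1 / 2 ^ j) powr \<beta> * measure_pmf.prob D (?B j) \<le> K * G y * q ^ j" .
    qed (use sm in auto)
    also have "\<dots> = K * (1 / (1 - q)) * G y"
      using q by (subst suminf_mult) (auto simp: suminf_geometric summable_geometric)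
    finally show "measure_pmf.expectation D ?f \<le> K * (1 / (1 - q)) * G y" .
  qed
qed

text \<open>The mirror image of \<open>small_moment\<close>: on the layer of size about y 2^j the
  tail decays faster than the integrand grows if \<rho> lies between \<beta> and \<alpha>.
  Integrability belongs to the conclusion because here the integrand can be unbounded.\<close>

lemma large_moment:
  assumes "0 \<le> \<beta>" "\<beta> < \<alpha>"
  obtains C where "C > 0" "\<And>y. y \<ge> 1 \<Longrightarrow>
    integrable D (\<lambda>z. (\<bar>real_of_int z\<bar> / y) powr \<beta> * indicator {z. y < \<bar>real_of_int z\<bar>} z)"
    "\<And>y. y \<ge> 1 \<Longrightarrow>
    measure_pmf.expectation D (\<lambda>z. (\<bar>real_of_int z\<bar> / y) powr \<beta> * indicator {z. y < \<bar>real_of_int z\<bar>} z) \<le> C * G y"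
proof -
  define \<rho> where "\<rho> = (\<alpha> + \<beta>) / 2"
  have rho: "\<rho> < \<alpha>" "\<beta> < \<rho>" "0 \<le> \<rho>" using assms by (auto simp: \<rho>_def)
  obtain C1 where C1: "C1 > 0" "\<And>t. t \<ge> 0 \<Longrightarrow> measure_pmf.prob D {z. t < \<bar>real_of_int z\<bar>} \<le> C1 * G t"
    using abs_tail_bound by blast
  obtain C2 where C2: "C2 > 0" "\<And>z y. 1 \<le> z \<Longrightarrow> z \<le> y \<Longrightarrow> G y \<le> C2 * (y / z) powr (-\<rho>) * G z"
    using potter_lower[OF rho(3,1)] by blast
  define q where "q = (2::real) powr (\<beta> - \<rho>)"
  have q: "0 < q" "q < 1" using rho by (auto simp: q_def powr_less_one)
  define K where "K = C1 * C2 * 2 powr \<beta>"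
  have *: "integrable D (\<lambda>z. (\<bar>real_of_int z\<bar> / y) powr \<beta> * indicator {z. y < \<bar>real_of_int z\<bar>} z) \<and>
     measure_pmf.expectation D (\<lambda>z. (\<bar>real_of_int z\<bar> / y) powr \<beta> * indicator {z. y < \<bar>real_of_int z\<bar>} z)
       \<le> K * (1 / (1 - q)) * G y" if y: "y \<ge> 1" for y
  proof -
    let ?f = "\<lambda>z. (\<bar>real_of_int z\<bar> / y) powr \<beta> * indicator {z. y < \<bar>real_of_int z\<bar>} z"
    let ?B = "\<lambda>j::nat. {z::int. y * 2 ^ j < \<bar>real_of_int z\<bar>}"
    have sm: "summable (\<lambda>j. K * G y * q ^ j)" using q by (intro summable_mult summable_geometric) simp
    have B: "\<exists>j. z \<in> ?B j \<and> ?f z \<le> (2 ^ Suc j) powr \<beta>" if "?f z \<noteq> 0" for z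
    proof -
      have z: "y < \<bar>real_of_int z\<bar>" using that by (auto split: split_indicator_asm)
      then have "\<bar>real_of_int z\<bar> / y > 1" using y by simp
      then obtain j where j: "2 ^ j < \<bar>real_of_int z\<bar> / y" "\<bar>real_of_int z\<bar> / y \<le> 2 ^ Suc j"
        by (rule doubling_bracket_left)
      have "z \<in> ?B j" using j(1) y by (simp add: field_simps)
      moreover have "?f z \<le> (2 ^ Suc j) powr \<beta>"
        using z y assms j(2) by (auto intro!: powr_mono2)
      ultimately show ?thesis by blast
    qed
    have e: "(2 ^ Suc j) powr \<beta> * measure_pmf.prob D (?B j) \<le> K * G y * q ^ j" for j :: nat
    proof -
      have "measure_pmf.prob D (?B j) \<le> C1 * G (y * 2 ^ j)" using y by (intro C1) simp
      also have "\<dots> \<le> C1 * (C2 * (y * 2 ^ j / y) powr (-\<rho>) * G y)"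
        using C1 y by (intro mult_left_mono C2) (auto simp: field_simps)
      finally have "(2 ^ Suc j) powr \<beta> * measure_pmf.prob D (?B j) \<le>
          (2 ^ Suc j) powr \<beta> * (C1 * (C2 * (y * 2 ^ j / y) powr (-\<rho>) * G y))"
        by (intro mult_left_mono) auto
      also have "\<dots> = K * G y * q ^ j"
      proof -
        have "(2 ^ Suc j :: real) powr \<beta> = 2 powr \<beta> * (2 powr \<beta>) ^ j"
          by (simp add: powr_mult powr_power powr_realpow[symmetric] powr_powr mult.commute)
        moreover have "(y * 2 ^ j / y) powr (-\<rho>) = (1 / 2 powr \<rho>) ^ j"
          using y by (simp add: powr_power powr_realpow[symmetric] powr_powr mult.commute powr_minus power_divide field_simps)
        ultimately show ?thesis by (simp add: q_def K_def powr_diff power_divide)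
      qed
      finally show ?thesis .
    qed
    have s: "suminf (\<lambda>j. K * G y * q ^ j) = K * (1 / (1 - q)) * G y"
      using q by (subst suminf_mult) (auto simp: suminf_geometric summable_geometric)
    show ?thesis
      using expectation_layer_bound[OF _ B _ e sm] s by auto
  qed
  show ?thesis
    by (rule that[of "K * (1 / (1 - q))"]) (use q C1 C2 * in \<open>auto simp: K_def\<close>)
qed

end

section \<open>Local tails, maxima and exponential moments\<close>

text \<open>Including 1 keeps the maximum positive, so that negative powers of it make sense even
  when all steps are nonpositive.\<close>

definition pos_max :: "nat \<Rightarrow> (nat \<Rightarrow> int) \<Rightarrow> real" where
  "pos_max m g = real_of_int (Max (insert 1 (g ` {1..m})))"

lemma pos_max_ge_1: "1 \<le> pos_max m g"
  by (simp add: pos_max_def)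

lemma pos_max_le_iff: "pos_max m g \<le> t \<longleftrightarrow> 1 \<le> t \<and> (\<forall>j\<in>{1..m}. real_of_int (g j) \<le> t)"
proof -
  have "pos_max m g \<le> t \<longleftrightarrow> Max (insert 1 (g ` {1..m})) \<le> \<lfloor>t\<rfloor>"
    by (simp add: pos_max_def le_floor_iff)
  also have "\<dots> \<longleftrightarrow> 1 \<le> \<lfloor>t\<rfloor> \<and> (\<forall>j\<in>{1..m}. g j \<le> \<lfloor>t\<rfloor>)"
    by (subst Max_le_iff) auto
  finally show ?thesis by (simp add: le_floor_iff)
qed

context tail_law
begin

text \<open>In the window around t, monotonicity squeezes \<open>G z\<close> between
  \<open>G\<close> at the two endpoints, so the pointwise asymptotics become uniform. The error
  \<epsilon> is split into \<epsilon> / 4 for the mass function and \<epsilon> / 2 for the factor (1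
  - \<eta>) or (1 + \<eta>) to the power -\<alpha> - 1. The bound \<eta> < 1 / 4 later makes \<eta>
  x smaller than (1 - \<eta>) x, so that the missing jump is the strict maximum.\<close>

lemma pmf_near:
  assumes eps: "0 < \<epsilon>" "\<epsilon> \<le> 1"
  obtains \<eta> where "0 < \<eta>" "\<eta> < 1 / 4"
    "\<forall>\<^sub>F t in at_top. \<forall>z::int. \<bar>real_of_int z - t\<bar> \<le> \<eta> * t \<longrightarrow>
       (1 - \<epsilon>) * (\<alpha> * G t / t) \<le> pmf D z \<and> pmf D z \<le> (1 + \<epsilon>) * (\<alpha> * G t / t)"
proof -
  have "((\<lambda>\<eta>. (1 - \<eta>) powr (-\<alpha> - 1)) \<longlongrightarrow> (1 - 0) powr (-\<alpha> - 1)) (at_right 0)"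
    by (intro tendsto_intros) auto
  then have 1: "\<forall>\<^sub>F \<eta> in at_right 0. (1 - \<eta>) powr (-\<alpha> - 1) < 1 + \<epsilon> / 2"
    by (rule order_tendstoD) (use eps in simp)
  have "((\<lambda>\<eta>. (1 + \<eta>) powr (-\<alpha> - 1)) \<longlongrightarrow> (1 + 0) powr (-\<alpha> - 1)) (at_right 0)"
    by (intro tendsto_intros) auto
  then have 2: "\<forall>\<^sub>F \<eta> in at_right 0. 1 - \<epsilon> / 2 < (1 + \<eta>) powr (-\<alpha> - 1)"
    by (rule order_tendstoD) (use eps in simp)
  have 3: "\<forall>\<^sub>F \<eta> in at_right 0. 0 < \<eta> \<and> \<eta> < (1 / 4 :: real)"
    by (auto simp: eventually_at_right_field intro!: exI[of _ "1/4"])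
  have "\<forall>\<^sub>F \<eta> in at_right 0. (1 - \<eta>) powr (-\<alpha> - 1) < 1 + \<epsilon> / 2 \<and>
      1 - \<epsilon> / 2 < (1 + \<eta>) powr (-\<alpha> - 1) \<and> 0 < \<eta> \<and> \<eta> < 1 / 4"
    using 1 2 3 by eventually_elim auto
  then obtain \<eta> where eta: "(1 - \<eta>) powr (-\<alpha> - 1) < 1 + \<epsilon> / 2"
      "1 - \<epsilon> / 2 < (1 + \<eta>) powr (-\<alpha> - 1)" "0 < \<eta>" "\<eta> < 1 / 4"
    using eventually_happens'[OF trivial_limit_at_right_real] by blast
  define u v where "u = 1 - \<eta>" and "v = 1 + \<eta>"
  have uv: "0 < u" "u < 1" "1 < v" using eta by (auto simp: u_def v_def)
  have "((\<lambda>t. \<alpha> * (1 + \<epsilon> / 4) / u * (G (u * t) / G t)) \<longlongrightarrow> \<alpha> * (1 + \<epsilon> / 4) / u * u powr (-\<alpha>)) at_top"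
    using uv by (intro tendsto_mult tendsto_const tail_scale) auto
  moreover have "\<alpha> * (1 + \<epsilon> / 4) / u * u powr (-\<alpha>) < \<alpha> * (1 + \<epsilon>)"
  proof -
    have "\<alpha> * (1 + \<epsilon> / 4) / u * u powr (-\<alpha>) = \<alpha> * (1 + \<epsilon> / 4) * u powr (-\<alpha> - 1)"
      using uv by (simp add: powr_diff)
    also have "\<dots> < \<alpha> * (1 + \<epsilon> / 4) * (1 + \<epsilon> / 2)"
      using eta(1) eps alpha by (intro mult_strict_left_mono) (auto simp: u_def)
    also have "\<dots> \<le> \<alpha> * (1 + \<epsilon>)"
    proof -
      have "\<epsilon> * \<epsilon> \<le> \<epsilon> * 1" using eps by (intro mult_left_mono) auto
      moreover have "(1 + \<epsilon> / 4) * (1 + \<epsilon> / 2) = 1 + 3 * \<epsilon> / 4 + \<epsilon> * \<epsilon> / 8"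
        by (simp add: algebra_simps)
      ultimately have "(1 + \<epsilon> / 4) * (1 + \<epsilon> / 2) \<le> 1 + \<epsilon>" using eps by linarith
      then show ?thesis using alpha by (simp add: mult.assoc)
    qed
    finally show ?thesis .
  qed
  ultimately have U: "\<forall>\<^sub>F t in at_top. \<alpha> * (1 + \<epsilon> / 4) / u * (G (u * t) / G t) < \<alpha> * (1 + \<epsilon>)"
    by (rule order_tendstoD)
  have "((\<lambda>t. \<alpha> * (1 - \<epsilon> / 4) / v * (G (v * t) / G t)) \<longlongrightarrow> \<alpha> * (1 - \<epsilon> / 4) / v * v powr (-\<alpha>)) at_top"
    using uv by (intro tendsto_mult tendsto_const tail_scale) auto
  moreover have "\<alpha> * (1 - \<epsilon>) < \<alpha> * (1 - \<epsilon> / 4) / v * v powr (-\<alpha>)"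
  proof -
    have "\<alpha> * (1 - \<epsilon>) \<le> \<alpha> * (1 - \<epsilon> / 4) * (1 - \<epsilon> / 2)"
    proof -
      have "1 - \<epsilon> \<le> (1 - \<epsilon> / 4) * (1 - \<epsilon> / 2)" using eps by (simp add: algebra_simps)
      then show ?thesis using alpha by (simp add: mult.assoc)
    qed
    also have "\<dots> < \<alpha> * (1 - \<epsilon> / 4) * v powr (-\<alpha> - 1)"
      using eta(2) eps alpha by (intro mult_strict_left_mono) (auto simp: v_def)
    also have "\<dots> = \<alpha> * (1 - \<epsilon> / 4) / v * v powr (-\<alpha>)"
      using uv by (simp add: powr_diff)
    finally show ?thesis .
  qed
  ultimately have V: "\<forall>\<^sub>F t in at_top. \<alpha> * (1 - \<epsilon>) < \<alpha> * (1 - \<epsilon> / 4) / v * (G (v * t) / G t)"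
    by (rule order_tendstoD)
  have "\<forall>\<^sub>F k in sequentially. real k * pmf D (int k) / G (real k) < \<alpha> * (1 + \<epsilon> / 4)"
    using alpha eps by (intro order_tendstoD[OF pmf_tail]) auto
  moreover have "\<forall>\<^sub>F k in sequentially. \<alpha> * (1 - \<epsilon> / 4) < real k * pmf D (int k) / G (real k)"
    using alpha eps by (intro order_tendstoD[OF pmf_tail]) auto
  ultimately have "\<forall>\<^sub>F k in sequentially. real k * pmf D (int k) / G (real k) < \<alpha> * (1 + \<epsilon> / 4) \<and>
      \<alpha> * (1 - \<epsilon> / 4) < real k * pmf D (int k) / G (real k)"
    by eventually_elim auto
  then obtain K where K: "\<And>k. k \<ge> K \<Longrightarrow> real k * pmf D (int k) / G (real k) < \<alpha> * (1 + \<epsilon> / 4)"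
    "\<And>k. k \<ge> K \<Longrightarrow> \<alpha> * (1 - \<epsilon> / 4) < real k * pmf D (int k) / G (real k)"
    by (auto simp: eventually_sequentially)
  have main: "\<forall>\<^sub>F t in at_top. \<forall>z::int. \<bar>real_of_int z - t\<bar> \<le> \<eta> * t \<longrightarrow>
       (1 - \<epsilon>) * (\<alpha> * G t / t) \<le> pmf D z \<and> pmf D z \<le> (1 + \<epsilon>) * (\<alpha> * G t / t)"
    using U V eventually_ge_at_top[of "max 1 ((real K + 1) / u)"]
  proof eventually_elim
    case (elim t)
    have "t \<ge> 1" "(real K + 1) / u \<le> t" using elim(3) by simp_all
    then have t: "t \<ge> 1" "real K + 1 \<le> u * t" using uv by (auto simp: pos_divide_le_eq mult.commute)
    show ?case
    proof (intro allI impI)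
      fix z :: int assume z: "\<bar>real_of_int z - t\<bar> \<le> \<eta> * t"
      then have zu: "u * t \<le> real_of_int z" and zv: "real_of_int z \<le> v * t"
        by (auto simp: u_def v_def algebra_simps abs_le_iff)
      define k where "k = nat z"
      have k: "z = int k" "real_of_int z = real k" "k \<ge> K" "k > 0"
        using zu t unfolding k_def by (auto simp: nat_less_iff le_nat_iff)
      have kp: "real k > 0" using k by simp
      have "pmf D z \<le> \<alpha> * (1 + \<epsilon> / 4) * (G (real k) / real k)"
        using K(1)[OF k(3)] kp G_pos[of "real k"] by (simp add: k(1) field_simps)
      also have "\<dots> \<le> \<alpha> * (1 + \<epsilon> / 4) * (G (u * t) / (u * t))"
        using zu k t uv alpha eps G_pos[of "u * t"] G_pos[of "real k"]
        by (intro mult_left_mono frac_le G_antimono) auto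
      also have "\<dots> = (\<alpha> * (1 + \<epsilon> / 4) / u * (G (u * t) / G t)) * (G t / t)"
        using G_pos[of t] by simp
      also have "\<dots> \<le> (\<alpha> * (1 + \<epsilon>)) * (G t / t)"
        using elim(1) G_pos[of t] t by (intro mult_right_mono) auto
      finally have upper: "pmf D z \<le> (1 + \<epsilon>) * (\<alpha> * G t / t)" by (simp add: ac_simps)
      have "(1 - \<epsilon>) * (\<alpha> * G t / t) = (\<alpha> * (1 - \<epsilon>)) * (G t / t)" by simp
      also have "\<dots> \<le> (\<alpha> * (1 - \<epsilon> / 4) / v * (G (v * t) / G t)) * (G t / t)"
        using elim(2) G_pos[of t] t by (intro mult_right_mono) auto
      also have "\<dots> = \<alpha> * (1 - \<epsilon> / 4) * (G (v * t) / (v * t))"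
        using G_pos[of t] by simp
      also have "\<dots> \<le> \<alpha> * (1 - \<epsilon> / 4) * (G (real k) / real k)"
        using zv k kp t uv alpha eps G_pos[of "v * t"] G_pos[of "real k"]
        by (intro mult_left_mono frac_le G_antimono) auto
      also have "\<dots> \<le> pmf D z"
        using K(2)[OF k(3)] kp G_pos[of "real k"] by (simp add: k(1) field_simps)
      finally show "(1 - \<epsilon>) * (\<alpha> * G t / t) \<le> pmf D z \<and> pmf D z \<le> (1 + \<epsilon>) * (\<alpha> * G t / t)"
        using upper by simp
    qed
  qed
  show ?thesis using that[OF eta(3,4) main] .
qed

lemma prob_le_eq: "measure_pmf.prob D {z. real_of_int z \<le> t} = 1 - G t"
proof -
  have "{z. real_of_int z \<le> t} = UNIV - {z. t < real_of_int z}" by auto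
  then show ?thesis
    using measure_pmf.prob_compl[of "{z. t < real_of_int z}" D] by (simp add: upper_tail_def)
qed

text \<open>All m steps are at most y / 2^j with probability at most exp (-m G (y / 2^j)). By
  Potter's bound the exponent grows at least like 2 powr (j \<alpha> / 2), so this beats the growth
  2 powr (j s) of the integrand for every s.\<close>

lemma max_moment:
  assumes s: "s \<ge> 0" and "\<kappa> > 0"
  obtains K where "\<And>m y. y \<ge> 1 \<Longrightarrow> \<kappa> \<le> real m * G y \<Longrightarrow>
    measure_pmf.expectation (iid D m) (\<lambda>g. (y / pos_max m g) powr s * indicator {g. pos_max m g \<le> y} g) \<le> K"
proof -
  obtain C where C: "C > 0" "\<And>z y. 1 \<le> z \<Longrightarrow> z \<le> y \<Longrightarrow> G y \<le> C * (y / z) powr (-(\<alpha> / 2)) * G z"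
    using potter_lower[of "\<alpha> / 2"] alpha by auto
  define q where "q = (2::real) powr (\<alpha> / 2)"
  have q: "q > 1" using alpha by (simp add: q_def)
  define e where "e = (\<lambda>j. (2 ^ Suc j) powr s * exp (- (\<kappa> / C) * q ^ j))"
  define d where "d = \<kappa> / C * (q - 1)"
  have d: "d > 0" using q C assms by (simp add: d_def)
  \<comment> \<open>The consecutive quotient tends to 0, which is what the ratio test needs.\<close>
  have ratio: "e (Suc j) = 2 powr s * exp (- d * q ^ j) * e j" for j
    using C by (simp add: e_def d_def powr_mult exp_add[symmetric] field_simps)
  have "filterlim (\<lambda>j. q ^ j) at_infinity sequentially"
    using q by (intro filterlim_realpow_sequentially_gt1) auto
  then have "filterlim (\<lambda>j. q ^ j) at_top sequentially"
    using q by (intro filterlim_at_infinity_imp_filterlim_at_top) auto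
  then have "((\<lambda>j. 2 powr s * exp (- d * q ^ j)) \<longlongrightarrow> 2 powr s * 0) sequentially"
    using d by (intro tendsto_mult tendsto_const filterlim_compose[OF exp_at_bot]
        filterlim_tendsto_neg_mult_at_bot[OF tendsto_const]) auto
  then have "\<forall>\<^sub>F j in sequentially. 2 powr s * exp (- d * q ^ j) < 1 / 2"
    by (rule order_tendstoD) simp
  then obtain N where N: "\<And>j. j \<ge> N \<Longrightarrow> 2 powr s * exp (- d * q ^ j) < 1 / 2"
    by (auto simp: eventually_sequentially)
  have e0: "e j \<ge> 0" for j by (simp add: e_def)
  have sm: "summable e"
  proof (rule summable_ratio_test[of "1 / 2" N])
    fix j assume "j \<ge> N"
    from N[OF this] have "2 powr s * exp (- d * q ^ j) * e j \<le> 1 / 2 * e j"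
      using e0 by (intro mult_right_mono) auto
    then show "norm (e (Suc j)) \<le> 1 / 2 * norm (e j)" using e0 ratio by simp
  qed simp
  show ?thesis
  proof (rule that[of "suminf e"])
    fix m :: nat and y :: real assume y: "y \<ge> 1" "\<kappa> \<le> real m * G y"
    let ?f = "\<lambda>g. (y / pos_max m g) powr s * indicator {g. pos_max m g \<le> y} g"
    let ?B = "\<lambda>j::nat. {g. pos_max m g \<le> y / 2 ^ j}"
    show "measure_pmf.expectation (iid D m) ?f \<le> suminf e"
    proof (rule expectation_layer_bound(2)[where c = "\<lambda>j. (2 ^ Suc j) powr s" and B = ?B])
      fix g assume "?f g \<noteq> 0"
      then have "pos_max m g \<le> y" by (auto split: split_indicator_asm)
      then have "y / pos_max m g \<ge> 1" using pos_max_ge_1[of m g] by simp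
      then obtain j where j: "2 ^ j \<le> y / pos_max m g" "y / pos_max m g < 2 ^ Suc j"
        by (rule doubling_bracket)
      have "g \<in> ?B j" using j(1) pos_max_ge_1[of m g] y by (simp add: field_simps)
      moreover have "(y / pos_max m g) powr s \<le> (2 ^ Suc j) powr s"
        using j(2) s y pos_max_ge_1[of m g] by (intro powr_mono2) auto
      then have "?f g \<le> (2 ^ Suc j) powr s" by (auto split: split_indicator)
      ultimately show "\<exists>j. g \<in> ?B j \<and> ?f g \<le> (2 ^ Suc j) powr s" by blast
    next
      fix j :: nat
      show "(2 ^ Suc j) powr s * iid_prob D m (?B j) \<le> e j"
      proof (cases "1 \<le> y / 2 ^ j")
        case True
        define t where "t = y / 2 ^ j"
        have "t \<le> y / 1" unfolding t_def using y one_le_power[of "2::real" j] by (intro divide_left_mono) auto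
        then have ty: "t \<le> y" by simp
        have "?B j = {g. \<forall>i\<in>{1..m}. g i \<in> {z. real_of_int z \<le> t}}"
          using True by (auto simp: pos_max_le_iff t_def)
        then have "iid_prob D m (?B j) = (1 - G t) ^ m"
          by (simp only: prob_iid_all prob_le_eq)
        also have "\<dots> \<le> exp (- G t) ^ m"
          using exp_ge_add_one_self[of "- G t"] G_le_1[of t] by (intro power_mono) auto
        also have "\<dots> = exp (- (real m * G t))" by (simp add: exp_of_nat_mult[symmetric])
        also have "\<dots> \<le> exp (- (\<kappa> / C) * q ^ j)"
        proof -
          have "y / t = 2 ^ j" using y by (simp add: t_def)
          then have yt: "(y / t) powr (-(\<alpha> / 2)) = 1 / q ^ j"
            by (simp add: q_def powr_minus powr_power powr_realpow[symmetric] powr_powr field_simps)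
          have "G y \<le> C * (y / t) powr (-(\<alpha> / 2)) * G t" using True ty by (intro C(2)) (auto simp: t_def)
          then have "G y * q ^ j \<le> C * G t" using yt q by (simp add: field_simps)
          then have "real m * (G y * q ^ j) \<le> real m * (C * G t)" by (intro mult_left_mono) auto
          moreover have "\<kappa> * q ^ j \<le> real m * G y * q ^ j" using y q by (intro mult_right_mono) auto
          ultimately have "\<kappa> * q ^ j \<le> C * (real m * G t)" by (simp add: ac_simps)
          then show ?thesis using C by (simp add: field_simps)
        qed
        finally show ?thesis unfolding e_def by (intro mult_left_mono) auto
      next
        case False
        \<comment> \<open>At levels below 1 the layer is empty because \<open>pos_max\<close> is at
          least 1.\<close>
        then have "?B j = {}" using pos_max_ge_1[of m] by (auto simp: pos_max_le_iff)
        then show ?thesis using e0 by simp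
      qed
    qed (use sm in auto)
  qed
qed

text \<open>
  Here \<open>z\<close> is the largest step. For \<open>y = a\<^sub>n\<close> the bound is \<open>1 / a\<^sub>n\<close> times a variable with bounded moments,
  which replaces a local limit theorem.
\<close>

lemma pmf_le_peak:
  assumes "B > 0"
  obtains C where "C > 0" "\<And>n m y g z. y \<ge> 1 \<Longrightarrow> real n * G y \<le> B \<Longrightarrow> (\<And>j. j \<in> {1..m} \<Longrightarrow> g j \<le> z) \<Longrightarrow>
    real n * pmf D z \<le> C / y * (1 + (y / pos_max m g) powr (\<alpha> + 2) * indicator {g. pos_max m g \<le> y} g)"
proof -
  obtain C1 where C1: "C1 > 0" "\<And>z::int. z \<ge> 1 \<Longrightarrow> pmf D z \<le> C1 * G (real_of_int z) / real_of_int z"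
    using pmf_le_tail by blast
  obtain C2 where C2: "C2 > 0" "\<And>z y. 0 < z \<Longrightarrow> z \<le> y \<Longrightarrow> G z \<le> C2 * (y / z) powr (\<alpha> + 1) * G y"
    using potter_upper[of "\<alpha> + 1"] by auto
  define C where "C = C1 * B + C1 * C2 * B + B * C2 / G 1"
  have parts: "C1 * B > 0" "C1 * C2 * B > 0" "B * C2 / G 1 > 0" using C1 C2 assms G_pos[of 1] by auto
  show ?thesis
  proof (rule that[of C])
    show "C > 0" using parts by (simp add: C_def)
    fix n m :: nat and y :: real and g :: "nat \<Rightarrow> int" and z :: int
    assume y: "y \<ge> 1" "real n * G y \<le> B" and g: "\<And>j. j \<in> {1..m} \<Longrightarrow> g j \<le> z"
    define M where "M = pos_max m g"
    have M1: "M \<ge> 1" by (simp add: M_def pos_max_ge_1)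
    \<comment> \<open>Replacing the division by \<open>M\<close> with a division by \<open>y\<close>
      costs one more power of \<open>y / M\<close>; this is how \<alpha> + 1 becomes \<alpha> +
      2.\<close>
    have pw: "(y / M) powr (\<alpha> + 1) / M = 1 / y * (y / M) powr (\<alpha> + 2)"
    proof -
      have "(y / M) powr (\<alpha> + 2) = (y / M) powr ((\<alpha> + 1) + 1)" by (simp add: algebra_simps)
      also have "\<dots> = (y / M) powr (\<alpha> + 1) * (y / M)" using y M1 by (subst powr_add) simp
      finally show ?thesis using y by simp
    qed
    consider "z \<ge> 1" "y < M" | "z \<ge> 1" "M \<le> y" | "z < 1" by linarith
    then show "real n * pmf D z \<le> C / y * (1 + (y / pos_max m g) powr (\<alpha> + 2) * indicator {g. pos_max m g \<le> y} g)"
    proof cases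
      \<comment> \<open>If the largest step is nonpositive, then \<open>M = 1\<close> and the power
        of \<open>y / M\<close> is so large that the trivial mass bound 1 suffices: n is at most
        \<open>B / G y\<close>, which is polynomial in y.\<close>
      case 3
      have "M = 1" using g 3 by (intro antisym M1) (force simp: M_def pos_max_le_iff)
      have "real n * pmf D z \<le> real n * 1" by (intro mult_left_mono) (auto simp: pmf_le_1)
      also have "\<dots> \<le> B / G y" using y G_pos[of y] by (simp add: field_simps)
      also have "\<dots> = B / G 1 * (G 1 / G y)" using G_pos[of 1] by simp
      also have "\<dots> \<le> B / G 1 * (C2 * y powr (\<alpha> + 1))"
        using C2(2)[of 1 y] y G_pos[of y] G_pos[of 1] assms by (intro mult_left_mono) (auto simp: field_simps)
      also have "\<dots> = B * C2 / G 1 / y * (y / M) powr (\<alpha> + 2)"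
      proof -
        have e: "y powr (\<alpha> + 1) = 1 / y * y powr (\<alpha> + 2)" using pw \<open>M = 1\<close> by simp
        show ?thesis unfolding e \<open>M = 1\<close> by simp
      qed
      also have "\<dots> \<le> C / y * (1 + (y / M) powr (\<alpha> + 2))"
        using parts y by (intro mult_mono divide_right_mono) (auto simp: C_def)
      finally show ?thesis using \<open>M = 1\<close> y by (simp add: M_def)
    next
      case 1
      have zM: "M \<le> real_of_int z" using g 1(1) by (auto simp: M_def pos_max_le_iff)
      have "real n * pmf D z \<le> real n * (C1 * G (real_of_int z) / real_of_int z)"
        using C1(2)[OF 1(1)] by (intro mult_left_mono) auto
      also have "\<dots> \<le> real n * (C1 * G y / y)"
        using C1 zM 1 y G_pos[of y] G_antimono[of y "real_of_int z"]
        by (intro mult_left_mono frac_le) auto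
      also have "\<dots> = C1 / y * (real n * G y)" by simp
      also have "\<dots> \<le> C1 / y * B" using y C1 by (intro mult_left_mono) auto
      also have "\<dots> \<le> C / y" using parts y by (simp add: C_def divide_right_mono)
      finally show ?thesis using 1 by (simp add: M_def)
    next
      case 2
      have zM: "M \<le> real_of_int z" using g 2(1) by (auto simp: M_def pos_max_le_iff)
      have "real n * pmf D z \<le> real n * (C1 * G (real_of_int z) / real_of_int z)"
        using C1(2)[OF 2(1)] by (intro mult_left_mono) auto
      also have "\<dots> \<le> real n * (C1 * (C2 * (y / M) powr (\<alpha> + 1) * G y) / M)"
        using C1(1) C2(1) G_pos[of y] zM 2 y M1 C2(2)[of M y] G_antimono[OF zM]
        by (intro mult_left_mono frac_le mult_mono) auto
      also have "\<dots> = C1 * C2 * ((y / M) powr (\<alpha> + 1) / M) * (real n * G y)" by simp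
      also have "\<dots> \<le> C1 * C2 * ((y / M) powr (\<alpha> + 1) / M) * B"
        using y C1 C2 M1 by (intro mult_left_mono) auto
      also have "\<dots> = C1 * C2 * B / y * (y / M) powr (\<alpha> + 2)"
        unfolding pw by simp
      also have "\<dots> \<le> C / y * (1 + (y / M) powr (\<alpha> + 2))"
        using parts y by (intro mult_mono divide_right_mono) (auto simp: C_def)
      finally show ?thesis using 2 by (simp add: M_def)
    qed
  qed
qed

section \<open>Truncated means and the centering\<close>

definition trunc_mean :: "real \<Rightarrow> real" where
  "trunc_mean y = measure_pmf.expectation D (\<lambda>z. real_of_int z * indicator {z. \<bar>real_of_int z\<bar> \<le> y} z)"

definition center :: "real \<Rightarrow> real" where
  "center y = (if \<alpha> < 1 then 0 else if \<alpha> = 1 then trunc_mean y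
     else measure_pmf.expectation D real_of_int)"

lemma integrable_trunc: "integrable D (\<lambda>z. f z * indicator {z. \<bar>real_of_int z\<bar> \<le> y} z)" if "\<And>z. \<bar>f z\<bar> \<le> K * \<bar>real_of_int z\<bar> ^ k" "K \<ge> 0" for f :: "int \<Rightarrow> real"
proof (rule measure_pmf.integrable_const_bound[where B = "K * \<bar>y\<bar> ^ k"])
  show "AE z in measure_pmf D. norm (f z * indicator {z. \<bar>real_of_int z\<bar> \<le> y} z) \<le> K * \<bar>y\<bar> ^ k"
  proof (intro AE_I2)
    fix z
    have "K * \<bar>real_of_int z\<bar> ^ k \<le> K * \<bar>y\<bar> ^ k" if "\<bar>real_of_int z\<bar> \<le> y"
      using that \<open>K \<ge> 0\<close> by (intro mult_left_mono power_mono) auto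
    then show "norm (f z * indicator {z. \<bar>real_of_int z\<bar> \<le> y} z) \<le> K * \<bar>y\<bar> ^ k"
      using that(1)[of z] \<open>K \<ge> 0\<close> by (auto split: split_indicator intro: order_trans)
  qed
qed simp

lemma trunc_mean_bound: "y \<ge> 0 \<Longrightarrow> \<bar>trunc_mean y\<bar> \<le> y"
proof -
  assume y: "y \<ge> 0"
  have "\<bar>trunc_mean y\<bar> \<le> measure_pmf.expectation D (\<lambda>z. \<bar>real_of_int z * indicator {z. \<bar>real_of_int z\<bar> \<le> y} z\<bar>)"
    unfolding trunc_mean_def by (rule integral_abs_bound)
  also have "\<dots> \<le> measure_pmf.expectation D (\<lambda>z. y)"
    using integrable_trunc[of "real_of_int" 1 1 y] y
    by (intro integral_mono integrable_abs) (auto split: split_indicator)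
  finally show ?thesis by simp
qed

text \<open>For \<alpha> < 1 the truncated first moment is itself small, by
  \<open>small_moment\<close> with exponent 1. For \<alpha> = 1 the two sides agree. For \<alpha> >
  1 the difference is the mean beyond y, controlled by \<open>large_moment\<close> with exponent 1.
  Multiplied by n at y = a n, the error is O(a n).\<close>

lemma center_bound:
  obtains C where "C > 0" "\<And>y. y \<ge> 1 \<Longrightarrow> \<bar>trunc_mean y - center y\<bar> \<le> C * y * G y"
proof -
  consider "\<alpha> < 1" | "\<alpha> = 1" | "\<alpha> > 1" by linarith
  then show ?thesis
  proof cases
    case 1
    obtain C where C: "C > 0" "\<And>y. y > 0 \<Longrightarrow>
      measure_pmf.expectation D (\<lambda>z. (\<bar>real_of_int z\<bar> / y) powr 1 * indicator {z. \<bar>real_of_int z\<bar> \<le> y} z) \<le> C * G y"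
      using small_moment[OF 1] by blast
    show ?thesis
    proof (rule that[OF C(1)])
      fix y :: real assume y: "y \<ge> 1"
      have "\<bar>trunc_mean y\<bar> \<le> measure_pmf.expectation D (\<lambda>z. \<bar>real_of_int z * indicator {z. \<bar>real_of_int z\<bar> \<le> y} z\<bar>)"
        unfolding trunc_mean_def by (rule integral_abs_bound)
      also have "\<dots> = measure_pmf.expectation D (\<lambda>z. y * ((\<bar>real_of_int z\<bar> / y) powr 1 * indicator {z. \<bar>real_of_int z\<bar> \<le> y} z))"
        using y by (intro Bochner_Integration.integral_cong) (auto split: split_indicator)
      also have "\<dots> = y * measure_pmf.expectation D (\<lambda>z. (\<bar>real_of_int z\<bar> / y) powr 1 * indicator {z. \<bar>real_of_int z\<bar> \<le> y} z)"
        by (rule integral_mult_right_zero)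
      also have "\<dots> \<le> y * (C * G y)" using C(2)[of y] y by (intro mult_left_mono) auto
      finally show "\<bar>trunc_mean y - center y\<bar> \<le> C * y * G y" using 1 by (simp add: center_def ac_simps)
    qed
  next
    case 2
    show ?thesis 
    proof (rule that[of 1])
      fix y :: real assume "y \<ge> 1"
      then show "\<bar>trunc_mean y - center y\<bar> \<le> 1 * y * G y"
        unfolding center_def using 2 G_pos[of y] by simp
    qed simp
  next
    case 3
    obtain C where C: "C > 0" "\<And>y. y \<ge> 1 \<Longrightarrow>
        integrable D (\<lambda>z. (\<bar>real_of_int z\<bar> / y) powr 1 * indicator {z. y < \<bar>real_of_int z\<bar>} z)"
      "\<And>y. y \<ge> 1 \<Longrightarrow>
      measure_pmf.expectation D (\<lambda>z. (\<bar>real_of_int z\<bar> / y) powr 1 * indicator {z. y < \<bar>real_of_int z\<bar>} z) \<le> C * G y"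
      using large_moment[of 1] 3 by auto
    show ?thesis
    proof (rule that[OF C(1)])
      fix y :: real assume y: "y \<ge> 1"
      let ?h = "\<lambda>z. (\<bar>real_of_int z\<bar> / y) powr 1 * indicator {z. y < \<bar>real_of_int z\<bar>} z"
      let ?t = "\<lambda>z. real_of_int z * indicator {z. y < \<bar>real_of_int z\<bar>} z"
      have abs: "\<bar>?t z\<bar> = y * ?h z" for z using y by (auto split: split_indicator)
      have ih: "integrable D (\<lambda>z. y * ?h z)" using C(2)[OF y] by (rule integrable_mult_right)
      have it: "integrable D ?t"
      proof (rule Bochner_Integration.integrable_bound[OF ih])
        show "AE z in D. norm (?t z) \<le> norm (y * ?h z)"
          by (intro AE_I2) (metis abs abs_ge_self real_norm_def)
      qed simp
      have isum: "integrable D (\<lambda>z. real_of_int z * indicator {z. \<bar>real_of_int z\<bar> \<le> y} z)"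
        using integrable_trunc[of "real_of_int" 1 1 y] by simp
      have "measure_pmf.expectation D real_of_int = measure_pmf.expectation D
          (\<lambda>z. real_of_int z * indicator {z. \<bar>real_of_int z\<bar> \<le> y} z + ?t z)"
        by (intro Bochner_Integration.integral_cong) (auto split: split_indicator)
      also have "\<dots> = trunc_mean y + measure_pmf.expectation D ?t"
        unfolding trunc_mean_def by (rule Bochner_Integration.integral_add[OF isum it])
      finally have "\<bar>trunc_mean y - center y\<bar> = \<bar>measure_pmf.expectation D ?t\<bar>"
        using 3 by (simp add: center_def)
      also have "\<dots> \<le> measure_pmf.expectation D (\<lambda>z. \<bar>?t z\<bar>)" by (rule integral_abs_bound)
      also have "\<dots> = y * measure_pmf.expectation D ?h" unfolding abs by (rule integral_mult_right_zero)
      also have "\<dots> \<le> y * (C * G y)" using C(3)[of y] y by (intro mult_left_mono) auto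
      finally show "\<bar>trunc_mean y - center y\<bar> \<le> C * y * G y" by (simp add: ac_simps)
    qed
  qed
qed

text \<open>
  The exponent is chosen such that \<open>exp (rate y w * w) = (w / y) powr (\<alpha> / 2)\<close>, a power for which the
  truncated moment at scale \<open>y\<close> is still bounded.
\<close>

definition rate :: "real \<Rightarrow> real \<Rightarrow> real" where
  "rate y w = \<alpha> / 2 * ln (w / y) / w"

text \<open>The second bound admits \<open>exp_le_quadratic\<close> for steps of size at most y, and
  later turns a centering error O(y) into a constant in the exponent.\<close>

lemma rate_bounds:
  assumes "1 \<le> y" "y \<le> w"
  shows "0 \<le> rate y w" "rate y w * y \<le> 1"
proof -
  show "0 \<le> rate y w" using assms alpha by (simp add: rate_def)
  have "ln (w / y) \<le> w / y" using assms ln_le_minus_one[of "w / y"] by auto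
  then have "\<alpha> / 2 * ln (w / y) \<le> 1 * (w / y)" using assms alpha by (intro mult_mono) auto
  then show "rate y w * y \<le> 1" using assms by (simp add: rate_def field_simps)
qed

text \<open>Split ln (w / y) into ln (s / y) + ln (w / s). After multiplication by s / w the second
  part is at most 1 - s / w, and the first at most ln (s / y). Hence the tilt at an intermediate
  step s is no worse than the power \<alpha> / 2 of s / y.\<close>

lemma exp_rate_le:
  assumes "1 \<le> y" "y \<le> s" "s \<le> w"
  shows "exp (rate y w * s) \<le> exp (\<alpha> / 2) * (s / y) powr (\<alpha> / 2)"
proof -
  have pos: "0 < s" "0 < w" using assms by auto
  have l0: "ln (s / y) \<ge> 0" using assms by simp
  have "ln (w / y) = ln (s / y) + ln (w / s)" using assms pos by (simp add: ln_div)
  also have "\<dots> \<le> ln (s / y) + (w / s - 1)" using ln_le_minus_one[of "w / s"] pos by simp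
  finally have "s / w * ln (w / y) \<le> s / w * (ln (s / y) + (w / s - 1))"
    using pos by (intro mult_left_mono) auto
  also have "\<dots> = s / w * ln (s / y) + (1 - s / w)" using pos by (simp add: field_simps)
  also have "\<dots> \<le> 1 * ln (s / y) + 1"
    using pos assms l0 by (intro add_mono mult_right_mono) auto
  finally have "\<alpha> / 2 * (s / w * ln (w / y)) \<le> \<alpha> / 2 * (ln (s / y) + 1)"
    using alpha by (intro mult_left_mono) auto
  then have "rate y w * s \<le> \<alpha> / 2 + \<alpha> / 2 * ln (s / y)"
    by (simp add: rate_def algebra_simps)
  then have "exp (rate y w * s) \<le> exp (\<alpha> / 2 + \<alpha> / 2 * ln (s / y))" by simp
  also have "\<dots> = exp (\<alpha> / 2) * (s / y) powr (\<alpha> / 2)"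
    using assms pos by (simp add: exp_add powr_def)
  finally show ?thesis .
qed

lemma integrable_exp_trunc:
  assumes "0 \<le> \<theta>"
  shows "integrable D (\<lambda>z. exp (\<theta> * real_of_int z) * indicator {z. real_of_int z \<le> w} z)"
  using assms by (intro measure_pmf.integrable_const_bound[where B = "exp (\<theta> * w)"])
    (auto split: split_indicator intro: mult_left_mono)

text \<open>The exponential is bounded quadratically for steps of size at most y, by 1 below -y, and
  by the power \<alpha> / 2 between y and w. The linear term survives exactly as
  \<open>trunc_mean y\<close>; the second and the \<alpha> / 2 moments are O(G y), since 2 >
  \<alpha> and \<alpha> / 2 < \<alpha>.\<close>

lemma exp_moment:
  obtains C where "C > 0" "\<And>y w. 1 \<le> y \<Longrightarrow> y \<le> w \<Longrightarrow>
    measure_pmf.expectation D (\<lambda>z. exp (rate y w * real_of_int z) * indicator {z. real_of_int z \<le> w} z)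
      \<le> exp (rate y w * trunc_mean y + C * G y)"
proof -
  obtain C1 where C1: "C1 > 0" "\<And>y. y > 0 \<Longrightarrow>
      measure_pmf.expectation D (\<lambda>z. (\<bar>real_of_int z\<bar> / y) powr 2 * indicator {z. \<bar>real_of_int z\<bar> \<le> y} z) \<le> C1 * G y"
    using small_moment[of 2] alpha by blast
  obtain C2 where C2: "C2 > 0" "\<And>y. y \<ge> 1 \<Longrightarrow>
      integrable D (\<lambda>z. (\<bar>real_of_int z\<bar> / y) powr (\<alpha> / 2) * indicator {z. y < \<bar>real_of_int z\<bar>} z)"
    "\<And>y. y \<ge> 1 \<Longrightarrow>
      measure_pmf.expectation D (\<lambda>z. (\<bar>real_of_int z\<bar> / y) powr (\<alpha> / 2) * indicator {z. y < \<bar>real_of_int z\<bar>} z) \<le> C2 * G y"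
    using large_moment[of "\<alpha> / 2"] alpha by auto
  define C where "C = C1 + exp (\<alpha> / 2) * C2"
  show ?thesis
  proof (rule that[of C])
    show "C > 0" using C1 C2 by (simp add: C_def add_pos_pos)
    fix y w :: real assume yw: "1 \<le> y" "y \<le> w"
    define \<theta> where "\<theta> = rate y w"
    have lam: "0 \<le> \<theta>" "\<theta> * y \<le> 1" using rate_bounds[OF yw] by (auto simp: \<theta>_def)
    let ?a = "\<lambda>z. real_of_int z * indicator {z. \<bar>real_of_int z\<bar> \<le> y} z"
    let ?b = "\<lambda>z. (\<bar>real_of_int z\<bar> / y) powr 2 * indicator {z. \<bar>real_of_int z\<bar> \<le> y} z"
    let ?c = "\<lambda>z. (\<bar>real_of_int z\<bar> / y) powr (\<alpha> / 2) * indicator {z. y < \<bar>real_of_int z\<bar>} z"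
    have ia: "integrable D ?a" using integrable_trunc[of "real_of_int" 1 1 y] by simp
    have ib: "integrable D ?b"
      using integrable_trunc[of "\<lambda>z. (\<bar>real_of_int z\<bar> / y) powr 2" "1 / y\<^sup>2" 2 y] yw
      by (simp add: power_divide)
    have ic: "integrable D ?c" by (rule C2(2)[OF yw(1)])
    have pt: "exp (\<theta> * real_of_int z) * indicator {z. real_of_int z \<le> w} z \<le>
        1 + \<theta> * ?a z + ?b z + exp (\<alpha> / 2) * ?c z" for z :: int
    proof -
      consider "\<bar>real_of_int z\<bar> \<le> y" | "real_of_int z < - y" | "y < real_of_int z" "real_of_int z \<le> w" | "w < real_of_int z"
        using yw by linarith
      then show ?thesis
      proof cases
        case 1
        have "\<bar>\<theta> * real_of_int z\<bar> = \<theta> * \<bar>real_of_int z\<bar>" using lam by (simp add: abs_mult)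
        also have "\<dots> \<le> \<theta> * y" using 1 lam by (intro mult_left_mono) auto
        finally have "\<bar>\<theta> * real_of_int z\<bar> \<le> 1" using lam by simp
        from exp_le_quadratic[OF this]
        have "exp (\<theta> * real_of_int z) \<le> 1 + \<theta> * real_of_int z + (\<theta> * real_of_int z)\<^sup>2" .
        also have "(\<theta> * real_of_int z)\<^sup>2 \<le> (\<bar>real_of_int z\<bar> / y)\<^sup>2"
        proof -
          have "\<theta> \<le> 1 / y" using lam yw by (simp add: field_simps)
          then have "\<theta> * \<bar>real_of_int z\<bar> \<le> 1 / y * \<bar>real_of_int z\<bar>" by (intro mult_right_mono) auto
          then show ?thesis using lam yw by (simp add: abs_le_square_iff[symmetric] abs_mult)
        qed
        finally show ?thesis using 1 yw by (auto split: split_indicator)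
      next
        case 2
        have "exp (\<theta> * real_of_int z) \<le> 1" using 2 lam yw by (auto intro: mult_nonneg_nonpos)
        then show ?thesis using 2 yw by (auto split: split_indicator intro: order_trans add_increasing2)
      next
        case 3
        then show ?thesis using exp_rate_le[of y "real_of_int z" w] yw
          by (auto simp: \<theta>_def split: split_indicator)
      next
        case 4
        then show ?thesis using yw by (auto split: split_indicator)
      qed
    qed
    have "measure_pmf.expectation D (\<lambda>z. exp (\<theta> * real_of_int z) * indicator {z. real_of_int z \<le> w} z)
        \<le> measure_pmf.expectation D (\<lambda>z. 1 + \<theta> * ?a z + ?b z + exp (\<alpha> / 2) * ?c z)"
      using ia ib ic lam pt
      by (intro integral_mono integrable_exp_trunc Bochner_Integration.integrable_add integrable_mult_right) auto
    also have "\<dots> = 1 + \<theta> * trunc_mean y + measure_pmf.expectation D ?b + exp (\<alpha> / 2) * measure_pmf.expectation D ?c"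
      unfolding trunc_mean_def using ia ib ic by simp
    also have "\<dots> \<le> 1 + \<theta> * trunc_mean y + C1 * G y + exp (\<alpha> / 2) * (C2 * G y)"
    proof -
      have "y > 0" "exp (\<alpha> / 2) \<ge> 0" using yw by auto
      then show ?thesis
        using C1(2)[of y] mult_left_mono[OF C2(3)[OF yw(1)], of "exp (\<alpha> / 2)"] by linarith
    qed
    also have "\<dots> = 1 + (\<theta> * trunc_mean y + C * G y)" by (simp add: C_def algebra_simps)
    also have "\<dots> \<le> exp (\<theta> * trunc_mean y + C * G y)" by (rule exp_ge_add_one_self)
    finally show "measure_pmf.expectation D (\<lambda>z. exp (rate y w * real_of_int z) * indicator {z. real_of_int z \<le> w} z)
      \<le> exp (rate y w * trunc_mean y + C * G y)" by (simp only: \<theta>_def)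
  qed
qed

text \<open>Exponential Chebyshev inequality. The constraints \<open>g j \<le> w\<close> are
  absorbed into the product as indicators, so independence is applied to factors that are integrable
  although the exponential of a single step need not be.\<close>

lemma fuk_nagaev:
  obtains C where "C > 0" "\<And>m y w t. 1 \<le> y \<Longrightarrow> y \<le> w \<Longrightarrow>
    iid_prob D m {g. t \<le> real_of_int (\<Sum>j=1..m. g j) \<and> (\<forall>j\<in>{1..m}. real_of_int (g j) \<le> w)}
      \<le> exp (- rate y w * t + real m * (rate y w * trunc_mean y + C * G y))"
proof -
  obtain C where C: "C > 0" "\<And>y w. 1 \<le> y \<Longrightarrow> y \<le> w \<Longrightarrow>
    measure_pmf.expectation D (\<lambda>z. exp (rate y w * real_of_int z) * indicator {z. real_of_int z \<le> w} z)
      \<le> exp (rate y w * trunc_mean y + C * G y)"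
    using exp_moment by blast
  show ?thesis
  proof (rule that[OF C(1)])
    fix m :: nat and y w t :: real assume yw: "1 \<le> y" "y \<le> w"
    define \<theta> where "\<theta> = rate y w"
    have lam: "0 \<le> \<theta>" using rate_bounds[OF yw] by (auto simp: \<theta>_def)
    let ?f = "\<lambda>z. exp (\<theta> * real_of_int z) * indicator {z. real_of_int z \<le> w} z"
    let ?A = "{g. t \<le> real_of_int (\<Sum>j=1..m. g j) \<and> (\<forall>j\<in>{1..m}. real_of_int (g j) \<le> w)}"
    have int: "integrable D ?f" by (rule integrable_exp_trunc[OF lam])
    have ip: "integrable (iid D m) (\<lambda>g. \<Prod>j\<in>{1..m}. ?f (g j))"
      unfolding iid_def by (rule integrable_prod_Pi_pmf) (auto intro: int)
    have "iid_prob D m ?A = measure_pmf.expectation (iid D m) (indicator ?A)" by simp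
    also have "\<dots> \<le> measure_pmf.expectation (iid D m) (\<lambda>g. exp (- \<theta> * t) * (\<Prod>j\<in>{1..m}. ?f (g j)))"
    proof (intro integral_mono integrable_mult_right ip)
      show "integrable (iid D m) (indicator ?A :: _ \<Rightarrow> real)"
        by (intro measure_pmf.integrable_const_bound[where B = 1]) (auto split: split_indicator)
      fix g
      show "indicator ?A g \<le> exp (- \<theta> * t) * (\<Prod>j\<in>{1..m}. ?f (g j))"
      proof (cases "g \<in> ?A")
        case True
        have "1 \<le> exp (\<theta> * (real_of_int (\<Sum>j=1..m. g j) - t))" using True lam by auto
        also have "\<dots> = exp (- \<theta> * t) * exp (\<theta> * (\<Sum>j=1..m. real_of_int (g j)))"
          by (simp add: exp_add[symmetric] algebra_simps)
        also have "exp (\<theta> * (\<Sum>j=1..m. real_of_int (g j))) = (\<Prod>j\<in>{1..m}. exp (\<theta> * real_of_int (g j)))"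
          by (simp add: sum_distrib_left exp_sum)
        also have "\<dots> = (\<Prod>j\<in>{1..m}. ?f (g j))"
          using True by (intro prod.cong) auto
        finally show ?thesis using True by simp
      qed (auto intro!: mult_nonneg_nonneg prod_nonneg)
    qed
    also have "\<dots> = exp (- \<theta> * t) * measure_pmf.expectation (iid D m) (\<lambda>g. \<Prod>j\<in>{1..m}. ?f (g j))"
      by (rule integral_mult_right_zero)
    also have "measure_pmf.expectation (iid D m) (\<lambda>g. \<Prod>j\<in>{1..m}. ?f (g j)) = (\<Prod>j\<in>{1..m}. measure_pmf.expectation D ?f)"
      unfolding iid_def by (rule expectation_prod_Pi_pmf) (auto intro: int)
    also have "\<dots> = measure_pmf.expectation D ?f ^ m" by simp
    also have "\<dots> \<le> exp (\<theta> * trunc_mean y + C * G y) ^ m"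
      using C(2)[OF yw] by (intro power_mono Bochner_Integration.integral_nonneg) (auto simp: \<theta>_def)
    also have "\<dots> = exp (real m * (\<theta> * trunc_mean y + C * G y))" by (simp add: exp_of_nat_mult)
    also have "exp (- \<theta> * t) * \<dots> = exp (- \<theta> * t + real m * (\<theta> * trunc_mean y + C * G y))"
      by (rule exp_add[symmetric])
    finally show "iid_prob D m ?A \<le> exp (- rate y w * t + real m * (rate y w * trunc_mean y + C * G y))"
      by (simp add: \<theta>_def)
  qed
qed

end

section \<open>Sums without a dominating jump\<close>

text \<open>For the local estimates, convergence in law is kept in the form of tightness; the limit
  law itself returns in \<open>weak_limit_pred\<close>.\<close>

locale stable_domain = tail_law +
  fixes a b :: "nat \<Rightarrow> real" and p :: real
  assumes p_pos: "p > 0"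
    and a_top: "filterlim a at_top sequentially"
    and a_tail: "(\<lambda>n. real n * G (a n)) \<longlonglongrightarrow> p"
    and b_eq: "\<And>n. n \<ge> 1 \<Longrightarrow> b n = real n * center (a n)"
    and tight: "\<And>\<epsilon>. \<epsilon> > 0 \<Longrightarrow> \<exists>T>0. \<forall>\<^sub>F n in sequentially.
      iid_prob D n {y. T * a n < \<bar>real_of_int (\<Sum>j=1..n. y j) - b n\<bar>} \<le> \<epsilon>"
begin

text \<open>\<open>m\<close> counts the steps that remain after the deletion, so \<open>n = Suc m\<close>.\<close>

abbreviation A :: "nat \<Rightarrow> real" where "A m \<equiv> a (Suc m)"
abbreviation B :: "nat \<Rightarrow> real" where "B m \<equiv> b (Suc m)"

lemma A_top: "filterlim A at_top sequentially"
  using filterlim_compose[OF a_top filterlim_Suc] by simp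

lemma A_ge: "\<forall>\<^sub>F m in sequentially. c \<le> A m"
  using A_top by (simp add: filterlim_at_top)

lemma A_tail: "(\<lambda>m. real (Suc m) * G (A m)) \<longlonglongrightarrow> p"
  using LIMSEQ_Suc[OF a_tail] by simp

lemma G_A_0: "(\<lambda>m. G (A m)) \<longlonglongrightarrow> 0"
proof -
  have "(\<lambda>m. real (Suc m) * G (A m) * inverse (real (Suc m))) \<longlonglongrightarrow> p * 0"
    by (intro tendsto_mult A_tail LIMSEQ_inverse_real_of_nat)
  moreover have "real (Suc m) * G (A m) * inverse (real (Suc m)) = G (A m)" for m
    by (simp del: of_nat_Suc)
  ultimately show ?thesis by (simp only: mult_zero_right)
qed

lemma A_tail': "(\<lambda>m. real m * G (A m)) \<longlonglongrightarrow> p"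
proof -
  have "(\<lambda>m. real (Suc m) * G (A m) - G (A m)) \<longlonglongrightarrow> p - 0"
    by (intro tendsto_diff A_tail G_A_0)
  then show ?thesis by (simp add: algebra_simps)
qed

lemma A_regular:
  "\<forall>\<^sub>F m in sequentially. 1 \<le> A m \<and> p / 2 \<le> real m * G (A m) \<and> real (Suc m) * G (A m) \<le> 2 * p"
proof -
  have "\<forall>\<^sub>F m in sequentially. p / 2 < real m * G (A m)"
    using p_pos by (intro order_tendstoD[OF A_tail']) auto
  moreover have "\<forall>\<^sub>F m in sequentially. real (Suc m) * G (A m) < 2 * p"
    using p_pos by (intro order_tendstoD[OF A_tail]) auto
  ultimately show ?thesis using A_ge[of 1] by eventually_elim auto
qed

text \<open>
  Jumps below \<open>gap * x\<close> count as small. The value makes the exponential bound a power of order \<open>2 (\<alpha> + 3)\<close>;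
  half of the exponent survives in the local bound, where more than \<open>\<alpha> + 2\<close> is needed.
\<close>

definition gap :: real where "gap = \<alpha> / (8 * (\<alpha> + 3))"

lemma gap: "0 < gap" "gap \<le> 1 / 8" "\<alpha> / (4 * gap) = 2 * (\<alpha> + 3)"
  using alpha by (auto simp: gap_def field_simps)

text \<open>\<open>fuk_nagaev\<close> with y = a n, w = \<open>gap * x\<close> and t half of x
  beyond the centering. Since the rate times a n is at most 1, centering errors of order a n only
  contribute the constant E. What remains is minus the rate times x / 2, that is a power of
  \<open>gap * x / A m\<close>.\<close>

lemma prob_small_jumps_sum_large:
  obtains K where "K > 0" "\<forall>\<^sub>F m in sequentially. \<forall>x. A m \<le> gap * x \<longrightarrow>
    iid_prob D m {g. B m + x / 2 \<le> real_of_int (\<Sum>j=1..m. g j) \<and>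
        (\<forall>j\<in>{1..m}. real_of_int (g j) \<le> gap * x)}
      \<le> K * (gap * x / A m) powr (- 2 * (\<alpha> + 3))"
proof -
  obtain C1 where C1: "C1 > 0" "\<And>m y w t. 1 \<le> y \<Longrightarrow> y \<le> w \<Longrightarrow>
    iid_prob D m {g. t \<le> real_of_int (\<Sum>j=1..m. g j) \<and> (\<forall>j\<in>{1..m}. real_of_int (g j) \<le> w)}
      \<le> exp (- rate y w * t + real m * (rate y w * trunc_mean y + C1 * G y))"
    using fuk_nagaev by blast
  obtain C2 where C2: "C2 > 0" "\<And>y. y \<ge> 1 \<Longrightarrow> \<bar>trunc_mean y - center y\<bar> \<le> C2 * y * G y"
    using center_bound by blast
  define E where "E = C2 * (2 * p) + 1 + C1 * (2 * p)"
  have "\<forall>\<^sub>F m in sequentially. \<forall>x. A m \<le> gap * x \<longrightarrow>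
    iid_prob D m {g. B m + x / 2 \<le> real_of_int (\<Sum>j=1..m. g j) \<and>
        (\<forall>j\<in>{1..m}. real_of_int (g j) \<le> gap * x)}
      \<le> exp E * (gap * x / A m) powr (- 2 * (\<alpha> + 3))"
    using A_regular
  proof eventually_elim
    case (elim m)
    show ?case
    proof (intro allI impI)
      fix x assume x: "A m \<le> gap * x"
      define \<theta> where "\<theta> = rate (A m) (gap * x)"
      define c where "c = center (A m)"
      define \<tau> where "\<tau> = trunc_mean (A m)"
      define N where "N = real (Suc m)"
      have A1: "1 \<le> A m" and NG: "N * G (A m) \<le> 2 * p" using elim by (auto simp: N_def)
      have th: "0 \<le> \<theta>" "\<theta> * A m \<le> 1" using rate_bounds[OF A1 x] by (auto simp: \<theta>_def)
      have xp: "x > 0" using x A1 gap(1) by (smt (verit) mult_nonneg_nonpos)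
      have "N * (\<tau> - c) \<le> N * (C2 * A m * G (A m))"
        using C2(2)[OF A1] by (intro mult_left_mono) (auto simp: \<tau>_def c_def N_def)
      also have "\<dots> = C2 * A m * (N * G (A m))" by simp
      also have "\<dots> \<le> C2 * A m * (2 * p)" using NG C2 A1 by (intro mult_left_mono) auto
      \<comment> \<open>There are \<open>N - 1\<close> steps but the centering is that of
        \<open>N\<close> steps; the mismatch is one \<open>\<tau>\<close>, of size at most
        \<open>A m\<close>.\<close>
      finally have "N * (\<tau> - c) - \<tau> \<le> (C2 * (2 * p) + 1) * A m"
        using trunc_mean_bound[of "A m"] A1 by (simp add: \<tau>_def algebra_simps abs_le_iff)
      then have "\<theta> * (N * (\<tau> - c) - \<tau>) \<le> \<theta> * ((C2 * (2 * p) + 1) * A m)"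
        using th by (intro mult_left_mono) auto
      also have "\<dots> = (C2 * (2 * p) + 1) * (\<theta> * A m)" by simp
      also have "\<dots> \<le> (C2 * (2 * p) + 1) * 1"
        using C2 p_pos th by (intro mult_left_mono) auto
      finally have e1: "\<theta> * (N * (\<tau> - c) - \<tau>) \<le> C2 * (2 * p) + 1" by simp
      have "real m * G (A m) \<le> 2 * p" using NG G_pos[of "A m"] by (simp add: N_def algebra_simps)
      then have e2: "C1 * (real m * G (A m)) \<le> C1 * (2 * p)" using C1 by (intro mult_left_mono) auto
      have Bm: "B m = N * c" using b_eq[of "Suc m"] by (simp add: N_def c_def)
      have "- \<theta> * (B m + x / 2) + real m * (\<theta> * \<tau> + C1 * G (A m)) =
          - (\<theta> * x / 2) + \<theta> * (N * (\<tau> - c) - \<tau>) + C1 * (real m * G (A m))"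
        unfolding Bm by (simp add: N_def algebra_simps)
      also have "\<dots> \<le> - (\<theta> * x / 2) + E" using e1 e2 by (simp add: E_def)
      also have "\<theta> * x / 2 = \<alpha> / (4 * gap) * ln (gap * x / A m)"
        using xp gap(1) by (simp add: \<theta>_def rate_def field_simps)
      also have "\<alpha> / (4 * gap) = 2 * (\<alpha> + 3)" by (rule gap(3))
      finally have ex: "- \<theta> * (B m + x / 2) + real m * (\<theta> * \<tau> + C1 * G (A m)) \<le>
          - (2 * (\<alpha> + 3) * ln (gap * x / A m)) + E" .
      have "iid_prob D m {g. B m + x / 2 \<le> real_of_int (\<Sum>j=1..m. g j) \<and>
        (\<forall>j\<in>{1..m}. real_of_int (g j) \<le> gap * x)} \<le>
        exp (- \<theta> * (B m + x / 2) + real m * (\<theta> * \<tau> + C1 * G (A m)))"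
        unfolding \<theta>_def \<tau>_def by (rule C1(2)[OF A1 x])
      also have "\<dots> \<le> exp (- (2 * (\<alpha> + 3) * ln (gap * x / A m)) + E)" using ex by simp
      also have "\<dots> = exp E * (gap * x / A m) powr (- 2 * (\<alpha> + 3))"
        using xp A1 gap(1) by (simp add: exp_add[symmetric] powr_def algebra_simps)
      finally show "iid_prob D m {g. B m + x / 2 \<le> real_of_int (\<Sum>j=1..m. g j) \<and>
        (\<forall>j\<in>{1..m}. real_of_int (g j) \<le> gap * x)} \<le> exp E * (gap * x / A m) powr (- 2 * (\<alpha> + 3))" .
    qed
  qed
  then show ?thesis using that[of "exp E"] by simp
qed

text \<open>If even the largest step is below \<open>gap * x\<close>, the remaining steps have to
  reach the centering plus x / 2 without a large jump. That event supplies the power, and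
  \<open>pmf_le_peak\<close> applied to the largest step supplies the factor
  \<open>1 / A m\<close>.\<close>

lemma local_small_jumps:
  obtains K where "K > 0" "\<forall>\<^sub>F m in sequentially. \<forall>x::int. A m \<le> gap * real_of_int x \<longrightarrow>
    real (Suc m) * measure_pmf.expectation (iid D m) (\<lambda>g. pmf D (x + \<lfloor>B m\<rfloor> - (\<Sum>j=1..m. g j)) *
      indicator {g. (\<forall>j\<in>{1..m}. g j \<le> x + \<lfloor>B m\<rfloor> - (\<Sum>j=1..m. g j)) \<and>
         real_of_int (x + \<lfloor>B m\<rfloor> - (\<Sum>j=1..m. g j)) < gap * real_of_int x} g)
      \<le> K / A m * (gap * real_of_int x / A m) powr (- (\<alpha> + 3))"
proof -
  obtain K1 where K1: "K1 > 0" "\<forall>\<^sub>F m in sequentially. \<forall>x. A m \<le> gap * x \<longrightarrow>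
    iid_prob D m {g. B m + x / 2 \<le> real_of_int (\<Sum>j=1..m. g j) \<and>
        (\<forall>j\<in>{1..m}. real_of_int (g j) \<le> gap * x)}
      \<le> K1 * (gap * x / A m) powr (- 2 * (\<alpha> + 3))"
    using prob_small_jumps_sum_large by blast
  obtain C where C: "C > 0" "\<And>n m y g z. y \<ge> 1 \<Longrightarrow> real n * G y \<le> 2 * p \<Longrightarrow> (\<And>j. j \<in> {1..m} \<Longrightarrow> g j \<le> z) \<Longrightarrow>
    real n * pmf D z \<le> C / y * (1 + (y / pos_max m g) powr (\<alpha> + 2) * indicator {g. pos_max m g \<le> y} g)"
    using pmf_le_peak[of "2 * p"] p_pos by auto
  obtain K2 where K2: "\<And>m y. y \<ge> 1 \<Longrightarrow> p / 2 \<le> real m * G y \<Longrightarrow>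
    measure_pmf.expectation (iid D m) (\<lambda>g. (y / pos_max m g) powr (2 * (\<alpha> + 2)) * indicator {g. pos_max m g \<le> y} g) \<le> K2"
    using max_moment[of "2 * (\<alpha> + 2)" "p / 2"] alpha p_pos by auto
  define K where "K = C * (1 + \<bar>K2\<bar> + K1)"
  have "\<forall>\<^sub>F m in sequentially. \<forall>x::int. A m \<le> gap * real_of_int x \<longrightarrow>
    real (Suc m) * measure_pmf.expectation (iid D m) (\<lambda>g. pmf D (x + \<lfloor>B m\<rfloor> - (\<Sum>j=1..m. g j)) *
      indicator {g. (\<forall>j\<in>{1..m}. g j \<le> x + \<lfloor>B m\<rfloor> - (\<Sum>j=1..m. g j)) \<and>
         real_of_int (x + \<lfloor>B m\<rfloor> - (\<Sum>j=1..m. g j)) < gap * real_of_int x} g)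
      \<le> K / A m * (gap * real_of_int x / A m) powr (- (\<alpha> + 3))"
    using A_regular K1(2)
  proof eventually_elim
    case (elim m)
    show ?case
    proof (intro allI impI)
      fix x :: int assume x: "A m \<le> gap * real_of_int x"
      have A1: "1 \<le> A m" using elim by simp
      define k where "k = x + \<lfloor>B m\<rfloor>"
      let ?s = "\<lambda>g::nat \<Rightarrow> int. \<Sum>j=1..m. g j"
      let ?Z = "{g. (\<forall>j\<in>{1..m}. g j \<le> k - ?s g) \<and> real_of_int (k - ?s g) < gap * real_of_int x}"
      let ?W = "{g. B m + real_of_int x / 2 \<le> real_of_int (?s g) \<and> (\<forall>j\<in>{1..m}. real_of_int (g j) \<le> gap * real_of_int x)}"
      define h where "h = (\<lambda>g. (A m / pos_max m g) powr (\<alpha> + 2) * indicator {g. pos_max m g \<le> A m} g)"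
      \<comment> \<open>Up to the constant \<open>K1\<close>, the square root of the bound on the
        probability of \<open>?W\<close>; this is the weight that balances the two terms.\<close>
      define v where "v = (gap * real_of_int x / A m) powr (- (\<alpha> + 3))"
      have xpos: "gap * real_of_int x > 0" using x A1 by linarith
      have "gap * real_of_int x / A m > 0" using xpos A1 by (intro divide_pos_pos) auto
      then have v: "v > 0" unfolding v_def by (subst powr_gt_zero) linarith
      \<comment> \<open>A lower bound on x absorbs the rounding of the centering: 7 x / 8 - 1 is at
        least x / 2.\<close>
      have x8: "real_of_int x \<ge> 8"
      proof -
        have "1 \<le> gap * real_of_int x" using x A1 by linarith
        also have "\<dots> \<le> 1 / 8 * real_of_int x"
          using xpos gap by (intro mult_right_mono) (auto simp: zero_less_mult_iff)
        finally show ?thesis by simp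
      qed
      have h0: "h g \<ge> 0" for g by (auto simp: h_def)
      have hb: "h g \<le> A m powr (\<alpha> + 2)" for g
      proof -
        have "A m / pos_max m g \<le> A m / 1" using A1 pos_max_ge_1[of m g] by (intro divide_left_mono) auto
        then have "(A m / pos_max m g) powr (\<alpha> + 2) \<le> A m powr (\<alpha> + 2)"
          using A1 pos_max_ge_1[of m g] alpha by (intro powr_mono2) auto
        then show ?thesis by (auto simp: h_def split: split_indicator)
      qed
      have hsq: "(h g)\<^sup>2 = (A m / pos_max m g) powr (2 * (\<alpha> + 2)) * indicator {g. pos_max m g \<le> A m} g" for g
        by (auto simp: h_def powr_powr power2_eq_square powr_add[symmetric] split: split_indicator)
      have ih: "integrable (iid D m) (\<lambda>g. (h g)\<^sup>2)"
        by (intro measure_pmf.integrable_const_bound[where B = "(A m powr (\<alpha> + 2))\<^sup>2"])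
          (auto intro!: AE_I2 power_mono[OF hb h0])
      have iW: "integrable (iid D m) (indicator ?W :: _ \<Rightarrow> real)"
        by (intro measure_pmf.integrable_const_bound[where B = 1]) (auto split: split_indicator)
      have pt: "real (Suc m) * (pmf D (k - ?s g) * indicator ?Z g) \<le>
          C / A m * (v * (1 + (h g)\<^sup>2) + indicator ?W g / v)" for g
      proof (cases "g \<in> ?Z")
        case True
        have "g \<in> ?W"
        proof -
          have "real_of_int (g j) \<le> gap * real_of_int x" if "j \<in> {1..m}" for j
          proof -
            have "g j \<le> k - ?s g" using True that by blast
            then have "real_of_int (g j) \<le> real_of_int (k - ?s g)" by (simp only: of_int_le_iff)
            then show ?thesis using True by (simp del: of_int_diff of_int_sum)
          qed
          moreover have "B m + real_of_int x / 2 \<le> real_of_int (?s g)"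
          proof -
            have "real_of_int (k - ?s g) < gap * real_of_int x" using True by blast
            moreover have "gap * real_of_int x \<le> 1 / 8 * real_of_int x"
              using x8 gap by (intro mult_right_mono) auto
            moreover have "real_of_int (k - ?s g) = real_of_int x + real_of_int \<lfloor>B m\<rfloor> - real_of_int (?s g)"
              by (simp add: k_def)
            moreover have "B m - 1 \<le> real_of_int \<lfloor>B m\<rfloor>" by linarith
            ultimately show ?thesis using x8 by linarith
          qed
          ultimately show ?thesis by blast
        qed
        have "real (Suc m) * pmf D (k - ?s g) \<le> C / A m * (1 + h g)"
          unfolding h_def using elim True by (intro C(2)) auto
        \<comment> \<open>AM-GM separates the bounded second moment of \<open>h\<close> from the small probability of \<open>?W\<close>.\<close>
        also have "\<dots> \<le> C / A m * (v * (1 + (h g)\<^sup>2) + 1 / v)"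
        proof (intro mult_left_mono)
          have "2 * (1 * 1) \<le> v + 1 / v"
          proof -
            have "0 \<le> (v - 1)\<^sup>2" by simp
            then have "2 * v \<le> v * v + 1" by (simp add: power2_eq_square algebra_simps)
            then show ?thesis using v by (simp add: field_simps)
          qed
          moreover have "2 * h g \<le> v * (h g)\<^sup>2 + 1 / v"
          proof -
            have "0 \<le> (v * h g - 1)\<^sup>2" by simp
            then have "2 * (h g * v) \<le> (h g)\<^sup>2 * v * v + 1" by (simp add: power2_eq_square algebra_simps)
            then show ?thesis using v by (simp add: field_simps)
          qed
          ultimately have "2 * (1 + h g) \<le> v * (1 + (h g)\<^sup>2) + 2 * (1 / v)" by (simp add: algebra_simps)
          moreover have "0 \<le> v * (1 + (h g)\<^sup>2)" using v by simp
          moreover have "P \<le> Q + R" if "2 * P \<le> Q + 2 * R" "0 \<le> Q" for P Q R :: real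
            using that by linarith
          ultimately show "1 + h g \<le> v * (1 + (h g)\<^sup>2) + 1 / v" by blast
        qed (use C A1 in auto)
        finally show ?thesis using True \<open>g \<in> ?W\<close> by simp
      next
        case False
        then show ?thesis using C A1 v
          by (auto intro!: mult_nonneg_nonneg add_nonneg_nonneg)
      qed
      have "real (Suc m) * measure_pmf.expectation (iid D m) (\<lambda>g. pmf D (k - ?s g) * indicator ?Z g) =
          measure_pmf.expectation (iid D m) (\<lambda>g. real (Suc m) * (pmf D (k - ?s g) * indicator ?Z g))"
        by (rule integral_mult_right_zero[symmetric])
      also have "\<dots> \<le> measure_pmf.expectation (iid D m) (\<lambda>g. C / A m * (v * (1 + (h g)\<^sup>2) + indicator ?W g / v))"
        using ih iW pt
        by (intro integral_mono integrable_mult_right Bochner_Integration.integrable_add integrable_divide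
             measure_pmf.integrable_const_bound[where f = "\<lambda>g. pmf D (k - ?s g) * indicator ?Z g" and B = 1])
           (auto simp: pmf_le_1 split: split_indicator)
      also have "\<dots> = C / A m * (v * (1 + measure_pmf.expectation (iid D m) (\<lambda>g. (h g)\<^sup>2)) + iid_prob D m ?W / v)"
        using ih iW by simp
      also have "\<dots> \<le> C / A m * (v * (1 + \<bar>K2\<bar>) + K1 * v)"
      proof (intro mult_left_mono add_mono)
        show "measure_pmf.expectation (iid D m) (\<lambda>g. (h g)\<^sup>2) \<le> \<bar>K2\<bar>"
          unfolding hsq using K2[of "A m" m] elim by linarith
        have "iid_prob D m ?W \<le> K1 * (gap * real_of_int x / A m) powr (- 2 * (\<alpha> + 3))"
          using elim x by blast
        also have "(gap * real_of_int x / A m) powr (- 2 * (\<alpha> + 3)) = v * v"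
          by (simp add: v_def powr_add[symmetric])
        finally show "iid_prob D m ?W / v \<le> K1 * v" using v by (simp add: field_simps)
      qed (use C A1 v in auto)
      also have "\<dots> = K / A m * v" by (simp add: K_def algebra_simps add_divide_distrib)
      finally show "real (Suc m) * measure_pmf.expectation (iid D m) (\<lambda>g. pmf D (x + \<lfloor>B m\<rfloor> - (\<Sum>j=1..m. g j)) *
        indicator {g. (\<forall>j\<in>{1..m}. g j \<le> x + \<lfloor>B m\<rfloor> - (\<Sum>j=1..m. g j)) \<and>
         real_of_int (x + \<lfloor>B m\<rfloor> - (\<Sum>j=1..m. g j)) < gap * real_of_int x} g)
        \<le> K / A m * (gap * real_of_int x / A m) powr (- (\<alpha> + 3))"
        unfolding k_def v_def .
    qed
  qed
  moreover have "K > 0" using C K1 by (simp add: K_def add_pos_pos add_nonneg_pos)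
  ultimately show ?thesis using that by blast
qed

end

section \<open>Local large deviations\<close>

lemma tendsto_0_if_eventually_le:
  fixes f :: "'a \<Rightarrow> real"
  assumes "\<And>x. 0 \<le> f x" "\<And>\<epsilon>. 0 < \<epsilon> \<Longrightarrow> \<forall>\<^sub>F x in F. f x \<le> \<epsilon>"
  shows "(f \<longlongrightarrow> 0) F"
proof (rule tendstoI)
  fix e :: real assume "e > 0"
  then have "\<forall>\<^sub>F x in F. f x \<le> e / 2" by (intro assms) simp
  then show "\<forall>\<^sub>F x in F. dist (f x) 0 < e"
    by eventually_elim (use \<open>e > 0\<close> assms(1) in \<open>auto simp: abs_of_nonneg intro: le_less_trans\<close>)
qed

context stable_domain
begin

lemma abs_prob_0: "((\<lambda>t. measure_pmf.prob D {z. t < \<bar>real_of_int z\<bar>}) \<longlongrightarrow> 0) at_top"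
proof (rule tendsto_0_if_eventually_le)
  fix \<epsilon> :: real assume eps: "\<epsilon> > 0"
  obtain C where C: "C > 0" "\<And>t. t \<ge> 0 \<Longrightarrow> measure_pmf.prob D {z. t < \<bar>real_of_int z\<bar>} \<le> C * G t"
    using abs_tail_bound by blast
  have "\<forall>\<^sub>F m in sequentially. G (A m) < \<epsilon> / C"
    using eps C by (intro order_tendstoD[OF G_A_0]) auto
  then obtain m where m: "G (A m) < \<epsilon> / C" using eventually_happens'[OF sequentially_bot] by blast
  show "\<forall>\<^sub>F t in at_top. measure_pmf.prob D {z. t < \<bar>real_of_int z\<bar>} \<le> \<epsilon>"
    using eventually_ge_at_top[of "max 0 (A m)"]
  proof eventually_elim
    case (elim t)
    have "measure_pmf.prob D {z. t < \<bar>real_of_int z\<bar>} \<le> C * G t" using elim by (intro C) simp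
    also have "\<dots> \<le> C * G (A m)" using elim C by (intro mult_left_mono G_antimono) auto
    also have "\<dots> \<le> \<epsilon>" using m C by (simp add: field_simps)
    finally show ?case .
  qed
qed simp

text \<open>The scales \<open>c\<close> and \<open>d\<close> are arbitrary because the lemma is
  applied twice, to reach m steps first on the scale of m + 1 steps and then on that of m + 2.
  Doubling T leaves room for the dropped step.\<close>

lemma tight_pred:
  fixes c d :: "nat \<Rightarrow> real"
  assumes c: "filterlim c at_top sequentially"
    and *: "\<And>\<epsilon>. \<epsilon> > 0 \<Longrightarrow> \<exists>T>0. \<forall>\<^sub>F m in sequentially.
      iid_prob D (Suc m) {y. T * c m < \<bar>real_of_int (\<Sum>j=1..Suc m. y j) - d m\<bar>} \<le> \<epsilon>"
    and "\<epsilon> > 0"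
  shows "\<exists>T>0. \<forall>\<^sub>F m in sequentially.
      iid_prob D m {y. T * c m < \<bar>real_of_int (\<Sum>j=1..m. y j) - d m\<bar>} \<le> \<epsilon>"
proof -
  obtain T where T: "T > 0" "\<forall>\<^sub>F m in sequentially.
      iid_prob D (Suc m) {y. T * c m < \<bar>real_of_int (\<Sum>j=1..Suc m. y j) - d m\<bar>} \<le> \<epsilon> / 2"
    using *[of "\<epsilon> / 2"] \<open>\<epsilon> > 0\<close> by auto
  have "filterlim (\<lambda>m. T * c m) at_top sequentially"
    using T(1) c by (intro filterlim_tendsto_pos_mult_at_top[OF tendsto_const])
  from filterlim_compose[OF abs_prob_0 this]
  have "\<forall>\<^sub>F m in sequentially. measure_pmf.prob D {z. T * c m < \<bar>real_of_int z\<bar>} < \<epsilon> / 2"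
    by (rule order_tendstoD) (use \<open>\<epsilon> > 0\<close> in simp)
  then have "\<forall>\<^sub>F m in sequentially.
      iid_prob D m {y. 2 * T * c m < \<bar>real_of_int (\<Sum>j=1..m. y j) - d m\<bar>} \<le> \<epsilon>"
    using T(2)
  proof eventually_elim
    case (elim m)
    have "iid_prob D m {y. 2 * T * c m < \<bar>real_of_int (\<Sum>j=1..m. y j) - d m\<bar>} \<le>
      iid_prob D (Suc m) {y. T * c m < \<bar>real_of_int (\<Sum>j=1..Suc m. y j) - d m\<bar>} +
      measure_pmf.prob D {z. T * c m < \<bar>real_of_int z\<bar>}"
      by (rule prob_iid_Suc_sum) auto
    then show ?case using elim by linarith
  qed
  then show ?thesis using T(1) by (intro exI[of _ "2 * T"]) simp
qed

lemma tight_Suc: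
  assumes "\<epsilon> > 0"
  shows "\<exists>T>0. \<forall>\<^sub>F m in sequentially.
      iid_prob D (Suc m) {y. T * A m < \<bar>real_of_int (\<Sum>j=1..Suc m. y j) - B m\<bar>} \<le> \<epsilon>"
proof -
  obtain T where T: "T > 0" "\<forall>\<^sub>F n in sequentially.
      iid_prob D n {y. T * a n < \<bar>real_of_int (\<Sum>j=1..n. y j) - b n\<bar>} \<le> \<epsilon>"
    using tight[OF assms] by blast
  from T(2) have "\<forall>\<^sub>F n in sequentially.
      iid_prob D (Suc n) {y. T * a (Suc n) < \<bar>real_of_int (\<Sum>j=1..Suc n. y j) - b (Suc n)\<bar>} \<le> \<epsilon>"
    by (subst (asm) eventually_sequentially_Suc[symmetric])
  then show ?thesis using T(1) by blast
qed

lemma tight_A: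
  assumes "\<epsilon> > 0"
  shows "\<exists>T>0. \<forall>\<^sub>F m in sequentially.
      iid_prob D m {y. T * A m < \<bar>real_of_int (\<Sum>j=1..m. y j) - B m\<bar>} \<le> \<epsilon>"
proof (rule tight_pred)
  show "filterlim A at_top sequentially" by (rule A_top)
  show "0 < \<epsilon>" by (rule assms)
qed (rule tight_Suc)

text \<open>Needed for necessity: there a jump is singled out of a vector from which the maximum has
  already been removed, so m steps are measured on the scale of m + 2.\<close>

lemma tight_A_Suc:
  assumes "\<epsilon> > 0"
  shows "\<exists>T>0. \<forall>\<^sub>F m in sequentially.
      iid_prob D m {y. T * A (Suc m) < \<bar>real_of_int (\<Sum>j=1..m. y j) - B (Suc m)\<bar>} \<le> \<epsilon>"
proof (rule tight_pred)
  show "filterlim (\<lambda>m. A (Suc m)) at_top sequentially"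
    using filterlim_compose[OF A_top filterlim_Suc] by simp
  fix \<epsilon> :: real assume "\<epsilon> > 0"
  from tight_A[OF this] obtain T where T: "T > 0" "\<forall>\<^sub>F m in sequentially.
      iid_prob D m {y. T * A m < \<bar>real_of_int (\<Sum>j=1..m. y j) - B m\<bar>} \<le> \<epsilon>"
    by blast
  from T(2) have "\<forall>\<^sub>F m in sequentially.
      iid_prob D (Suc m) {y. T * A (Suc m) < \<bar>real_of_int (\<Sum>j=1..Suc m. y j) - B (Suc m)\<bar>} \<le> \<epsilon>"
    by (subst (asm) eventually_sequentially_Suc[symmetric])
  then show "\<exists>T>0. \<forall>\<^sub>F m in sequentially.
      iid_prob D (Suc m) {y. T * A (Suc m) < \<bar>real_of_int (\<Sum>j=1..Suc m. y j) - B (Suc m)\<bar>} \<le> \<epsilon>"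
    using T(1) by blast
qed (rule assms)

end

section \<open>The regime of large deviations\<close>

locale large_deviation = stable_domain +
  fixes X :: "nat \<Rightarrow> int"
  assumes X_top: "filterlim (\<lambda>m. real_of_int (X m) / A m) at_top sequentially"
begin

abbreviation x :: "nat \<Rightarrow> real" where "x m \<equiv> real_of_int (X m)"

text \<open>The one-jump prediction for the probability of the conditioning event: n positions times
  the asymptotic mass at \<open>x m\<close>.\<close>

definition profile :: "nat \<Rightarrow> real" where
  "profile m = real (Suc m) * (\<alpha> * G (x m) / x m)"

lemma x_ge: "c > 0 \<Longrightarrow> \<forall>\<^sub>F m in sequentially. A m \<le> c * x m"
proof -
  assume c: "c > 0"
  have "\<forall>\<^sub>F m in sequentially. 1 / c \<le> x m / A m" using X_top by (simp add: filterlim_at_top)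
  then show ?thesis using A_ge[of 1]
  proof eventually_elim
    case (elim m)
    have "1 / c * A m \<le> x m" using elim by (simp add: pos_le_divide_eq)
    then show ?case using c by (simp add: field_simps)
  qed
qed

lemma x_top: "filterlim x at_top sequentially"
proof (rule filterlim_at_top_mono[OF A_top])
  show "\<forall>\<^sub>F m in sequentially. A m \<le> x m"
    using x_ge[OF zero_less_one] by (simp only: mult_1)
qed

lemma sum_deviation_0:
  assumes "\<eta> > 0"
  shows "(\<lambda>m. iid_prob D m {g. \<eta> * x m < \<bar>real_of_int (\<Sum>j=1..m. g j) - B m\<bar>}) \<longlonglongrightarrow> 0"
proof (rule tendsto_0_if_eventually_le)
  fix \<epsilon> :: real assume "\<epsilon> > 0"
  from tight_A[OF this] obtain T where T: "T > 0" "\<forall>\<^sub>F m in sequentially.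
      iid_prob D m {y. T * A m < \<bar>real_of_int (\<Sum>j=1..m. y j) - B m\<bar>} \<le> \<epsilon>"
    by blast
  have "\<forall>\<^sub>F m in sequentially. A m \<le> \<eta> / T * x m" using assms T by (intro x_ge) auto
  then show "\<forall>\<^sub>F m in sequentially.
      iid_prob D m {g. \<eta> * x m < \<bar>real_of_int (\<Sum>j=1..m. g j) - B m\<bar>} \<le> \<epsilon>"
    using T(2)
  proof eventually_elim
    case (elim m)
    have "T * A m \<le> \<eta> * x m" using elim(1) T(1) by (simp add: field_simps)
    then have "iid_prob D m {g. \<eta> * x m < \<bar>real_of_int (\<Sum>j=1..m. g j) - B m\<bar>} \<le>
       iid_prob D m {g. T * A m < \<bar>real_of_int (\<Sum>j=1..m. g j) - B m\<bar>}"
      by (intro measure_pmf.finite_measure_mono) auto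
    then show ?case using elim(2) by simp
  qed
qed simp

text \<open>Used to exclude a second jump of order \<open>x m\<close>. Potter's bound with exponent
  \<alpha> / 2 turns the divergence of \<open>x m / A m\<close> into decay.\<close>

lemma n_tail_0:
  assumes "\<eta> > 0"
  shows "(\<lambda>m. real (Suc m) * G (\<eta> * x m)) \<longlonglongrightarrow> 0"
proof -
  obtain C where C: "C > 0" "\<And>z y. 1 \<le> z \<Longrightarrow> z \<le> y \<Longrightarrow> G y \<le> C * (y / z) powr (-(\<alpha> / 2)) * G z"
    using potter_lower[of "\<alpha> / 2"] alpha by auto
  have "filterlim (\<lambda>m. \<eta> * (x m / A m)) at_top sequentially"
    using assms by (intro filterlim_tendsto_pos_mult_at_top[OF tendsto_const _ X_top])
  then have "(\<lambda>m. (\<eta> * (x m / A m)) powr (-(\<alpha> / 2))) \<longlonglongrightarrow> 0"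
    using alpha by (intro tendsto_neg_powr) auto
  then have lim: "(\<lambda>m. 2 * p * C * (\<eta> * (x m / A m)) powr (-(\<alpha> / 2))) \<longlonglongrightarrow> 2 * p * C * 0"
    by (intro tendsto_mult tendsto_const)
  have "\<forall>\<^sub>F m in sequentially. real (Suc m) * G (\<eta> * x m) \<le> 2 * p * C * (\<eta> * (x m / A m)) powr (-(\<alpha> / 2))"
    using A_regular x_ge[OF assms]
  proof eventually_elim
    case (elim m)
    have "real (Suc m) * G (\<eta> * x m) \<le> real (Suc m) * (C * (\<eta> * x m / A m) powr (-(\<alpha> / 2)) * G (A m))"
      using elim by (intro mult_left_mono C) auto
    also have "\<dots> = C * (\<eta> * (x m / A m)) powr (-(\<alpha> / 2)) * (real (Suc m) * G (A m))" by simp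
    also have "\<dots> \<le> C * (\<eta> * (x m / A m)) powr (-(\<alpha> / 2)) * (2 * p)"
      using elim C by (intro mult_left_mono) auto
    finally show ?case by (simp add: ac_simps)
  qed
  moreover have "\<forall>\<^sub>F m in sequentially. 0 \<le> real (Suc m) * G (\<eta> * x m)"
    by (intro always_eventually allI mult_nonneg_nonneg less_imp_le[OF G_pos]) auto
  ultimately show ?thesis
    using lim tendsto_sandwich[OF _ _ tendsto_const] by (simp only: mult_zero_right)
qed

lemma profile_pos: "\<forall>\<^sub>F m in sequentially. profile m > 0"
proof -
  have "\<forall>\<^sub>F m in sequentially. 1 \<le> x m" using x_top unfolding filterlim_at_top by blast
  then show ?thesis
    by eventually_elim (use alpha in \<open>auto simp: profile_def intro!: divide_pos_pos mult_pos_pos G_pos\<close>)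
qed

text \<open>With r = \<open>x m / A m\<close>, Potter's bound gives that \<open>profile m\<close> is
  at least a constant times r powr -(\<alpha> + 2) / \<open>A m\<close>. The left side has the power
  -(\<alpha> + 3), so a factor 1 / r is left over.\<close>

lemma small_jump_negligible:
  assumes "\<epsilon> > 0" "K > 0"
  shows "\<forall>\<^sub>F m in sequentially. K / A m * (gap * x m / A m) powr (- (\<alpha> + 3)) \<le> \<epsilon> * profile m"
proof -
  obtain C where C: "C > 0" "\<And>z y. 0 < z \<Longrightarrow> z \<le> y \<Longrightarrow> G z \<le> C * (y / z) powr (\<alpha> + 1) * G y"
    using potter_upper[of "\<alpha> + 1"] by auto
  define K' where "K' = K * gap powr (- (\<alpha> + 3))"
  define c where "c = \<alpha> * p / (2 * C)"
  have c: "c > 0" using alpha p_pos C by (simp add: c_def)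
  have K': "K' > 0" using assms gap by (simp add: K'_def)
  have "\<forall>\<^sub>F m in sequentially. K' / (\<epsilon> * c) \<le> x m / A m" using X_top by (simp add: filterlim_at_top)
  then show ?thesis using A_regular x_ge[OF zero_less_one]
  proof eventually_elim
    case (elim m)
    define r where "r = x m / A m"
    have A1: "A m \<ge> 1" and xA: "x m \<ge> A m" using elim by auto
    then have r: "r \<ge> 1" by (simp add: r_def)
    have xr: "x m = r * A m" using A1 by (simp add: r_def)
    have "p / 2 \<le> real (Suc m) * G (A m)" using elim G_pos[of "A m"] by (simp add: algebra_simps)
    also have "\<dots> \<le> real (Suc m) * (C * (x m / A m) powr (\<alpha> + 1) * G (x m))"
      using A1 xA by (intro mult_left_mono C) auto
    finally have "\<alpha> / C * (p / 2) \<le> \<alpha> / C * (real (Suc m) * (C * (x m / A m) powr (\<alpha> + 1) * G (x m)))"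
      using C alpha by (intro mult_left_mono) auto
    then have "c \<le> r powr (\<alpha> + 1) * (\<alpha> * real (Suc m) * G (x m))"
      using C by (simp add: c_def r_def ac_simps del: of_nat_Suc)
    then have "c / r powr (\<alpha> + 1) \<le> \<alpha> * real (Suc m) * G (x m)"
      using r by (simp add: field_simps)
    then have "c / r powr (\<alpha> + 1) / x m \<le> \<alpha> * real (Suc m) * G (x m) / x m"
      using xA A1 by (intro divide_right_mono) auto
    then have prof: "c / r powr (\<alpha> + 1) / (r * A m) \<le> profile m"
      by (simp add: profile_def ac_simps xr)
    have p3: "r powr (\<alpha> + 3) = r powr (\<alpha> + 1) * r * r"
      using r powr_add[of r "\<alpha> + 1" 2] by (simp add: power2_eq_square algebra_simps)
    have "K / A m * (gap * x m / A m) powr (- (\<alpha> + 3)) = K / A m * (gap powr (- (\<alpha> + 3)) * r powr (- (\<alpha> + 3)))"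
    proof -
      have "gap * x m / A m = gap * r" by (simp add: r_def)
      then show ?thesis using r gap(1) by (simp only: powr_mult)
    qed
    also have "\<dots> = K' / A m / (r powr (\<alpha> + 1) * r * r)"
    proof -
      have "r powr (- (\<alpha> + 3)) = 1 / (r powr (\<alpha> + 1) * r * r)"
        by (simp only: powr_minus_divide p3)
      then show ?thesis unfolding K'_def by simp
    qed
    also have "\<dots> = K' / r * (1 / (A m * (r powr (\<alpha> + 1) * r)))"
      by simp
    also have "\<dots> \<le> \<epsilon> * c * (1 / (A m * (r powr (\<alpha> + 1) * r)))"
      using elim(1) A1 r assms(1) c
      by (intro mult_right_mono) (auto simp: r_def[symmetric] field_simps)
    also have "\<dots> = \<epsilon> * (c / r powr (\<alpha> + 1) / (r * A m))" by (simp add: field_simps)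
    also have "\<dots> \<le> \<epsilon> * profile m" using prof assms by (intro mult_left_mono) auto
    finally show ?case .
  qed
qed

text \<open>A crude constant is enough here: in \<open>local_upper\<close> it is multiplied by the
  vanishing probability that the other steps make up for a jump away from
  \<open>x m\<close>.\<close>

lemma pmf_le_far:
  obtains C where "C > 0" "\<forall>\<^sub>F m in sequentially. \<forall>z::int. gap * x m \<le> real_of_int z \<longrightarrow>
    pmf D z \<le> C * (\<alpha> * G (x m) / x m)"
proof -
  obtain C1 where C1: "C1 > 0" "\<And>z::int. z \<ge> 1 \<Longrightarrow> pmf D z \<le> C1 * G (real_of_int z) / real_of_int z"
    using pmf_le_tail by blast
  obtain C2 where C2: "C2 > 0" "\<And>z y. 0 < z \<Longrightarrow> z \<le> y \<Longrightarrow> G z \<le> C2 * (y / z) powr (\<alpha> + 1) * G y"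
    using potter_upper[of "\<alpha> + 1"] by auto
  define C where "C = C1 * C2 * (1 / gap) powr (\<alpha> + 1) / (gap * \<alpha>)"
  have "\<forall>\<^sub>F m in sequentially. \<forall>z::int. gap * x m \<le> real_of_int z \<longrightarrow> pmf D z \<le> C * (\<alpha> * G (x m) / x m)"
    using A_ge[of 1] x_ge[OF gap(1)]
  proof eventually_elim
    case (elim m)
    show ?case
    proof (intro allI impI)
      fix z :: int assume z: "gap * x m \<le> real_of_int z"
      have g1: "1 \<le> gap * x m" using elim by linarith
      then have xp: "0 < x m" using gap(1) by (smt (verit) mult_nonneg_nonpos)
      have "z \<ge> 1" using z g1 by linarith
      then have "pmf D z \<le> C1 * G (real_of_int z) / real_of_int z" by (rule C1)
      also have "\<dots> \<le> C1 * G (gap * x m) / (gap * x m)"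
        using z g1 C1 less_imp_le[OF G_pos] by (intro frac_le mult_left_mono G_antimono) auto
      also have "\<dots> \<le> C1 * (C2 * (x m / (gap * x m)) powr (\<alpha> + 1) * G (x m)) / (gap * x m)"
      proof -
        have "gap * x m \<le> 1 * x m" using gap xp by (intro mult_right_mono) auto
        then show ?thesis using g1 C1 by (intro divide_right_mono mult_left_mono C2) auto
      qed
      also have "\<dots> = C * (\<alpha> * G (x m) / x m)"
        using xp alpha by (simp add: C_def)
      finally show "pmf D z \<le> C * (\<alpha> * G (x m) / x m)" .
    qed
  qed
  then show ?thesis using that[of C] C1 C2 gap alpha by (simp add: C_def)
qed

lemma expectation_pmf_le:
  assumes "0 \<le> c" "\<And>g. g \<in> U \<Longrightarrow> pmf D (f g) \<le> c" "U \<subseteq> V"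
  shows "measure_pmf.expectation Q (\<lambda>g. pmf D (f g) * indicator U g) \<le> c * measure_pmf.prob Q V"
proof -
  have "measure_pmf.expectation Q (\<lambda>g. pmf D (f g) * indicator U g) \<le> measure_pmf.expectation Q (\<lambda>g. c * indicator V g)"
    using assms
    by (intro integral_mono integrable_mult_right measure_pmf.integrable_const_bound[where B = 1])
       (auto simp: pmf_le_1 split: split_indicator)
  then show ?thesis by simp
qed

text \<open>Three cases for the largest step. Close to \<open>x m\<close> it gives the main term. If
  it is at least \<open>gap * x m\<close> but not close, the other steps must deviate by \<eta> x /
  2, which is unlikely. Below \<open>gap * x m\<close> the estimate \<open>local_small_jumps\<close>
  applies. Each case may spend \<epsilon> / 3.\<close>

lemma local_upper:
  assumes "0 < \<epsilon>" "\<epsilon> \<le> 1"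
  shows "\<forall>\<^sub>F m in sequentially.
    iid_prob D (Suc m) {y. (\<Sum>j=1..Suc m. y j) = X m + \<lfloor>B m\<rfloor>} \<le> (1 + \<epsilon>) * profile m"
proof -
  obtain \<eta> where eta: "0 < \<eta>" "\<eta> < 1 / 4"
    "\<forall>\<^sub>F t in at_top. \<forall>z::int. \<bar>real_of_int z - t\<bar> \<le> \<eta> * t \<longrightarrow>
       (1 - \<epsilon> / 3) * (\<alpha> * G t / t) \<le> pmf D z \<and> pmf D z \<le> (1 + \<epsilon> / 3) * (\<alpha> * G t / t)"
    using pmf_near[of "\<epsilon> / 3"] assms by auto
  obtain C where C: "C > 0" "\<forall>\<^sub>F m in sequentially. \<forall>z::int. gap * x m \<le> real_of_int z \<longrightarrow>
    pmf D z \<le> C * (\<alpha> * G (x m) / x m)"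
    using pmf_le_far by blast
  obtain K where K: "K > 0" "\<forall>\<^sub>F m in sequentially. \<forall>x::int. A m \<le> gap * real_of_int x \<longrightarrow>
    real (Suc m) * measure_pmf.expectation (iid D m) (\<lambda>g. pmf D (x + \<lfloor>B m\<rfloor> - (\<Sum>j=1..m. g j)) *
      indicator {g. (\<forall>j\<in>{1..m}. g j \<le> x + \<lfloor>B m\<rfloor> - (\<Sum>j=1..m. g j)) \<and>
         real_of_int (x + \<lfloor>B m\<rfloor> - (\<Sum>j=1..m. g j)) < gap * real_of_int x} g)
      \<le> K / A m * (gap * real_of_int x / A m) powr (- (\<alpha> + 3))"
    using local_small_jumps by blast
  have near: "\<forall>\<^sub>F m in sequentially. \<forall>z::int. \<bar>real_of_int z - x m\<bar> \<le> \<eta> * x m \<longrightarrow>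
       (1 - \<epsilon> / 3) * (\<alpha> * G (x m) / x m) \<le> pmf D z \<and> pmf D z \<le> (1 + \<epsilon> / 3) * (\<alpha> * G (x m) / x m)"
    using x_top eta(3) by (rule eventually_compose_filterlim[rotated])
  \<comment> \<open>The threshold cancels the constant of \<open>pmf_le_far\<close>.\<close>
  have dev: "\<forall>\<^sub>F m in sequentially.
      iid_prob D m {g. \<eta> / 2 * x m < \<bar>real_of_int (\<Sum>j=1..m. g j) - B m\<bar>} < \<epsilon> / (3 * C)"
    by (rule order_tendstoD(2)[OF sum_deviation_0]) (use eta assms C in auto)
  \<comment> \<open>Makes \<eta> x / 2 at least 1, so that half of the window absorbs the rounding
    of the centering.\<close>
  have x1: "\<forall>\<^sub>F m in sequentially. 2 / \<eta> \<le> x m" using x_top by (simp add: filterlim_at_top)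
  have small: "\<forall>\<^sub>F m in sequentially. K / A m * (gap * x m / A m) powr (- (\<alpha> + 3)) \<le> \<epsilon> / 3 * profile m"
    using assms K by (intro small_jump_negligible) auto
  show ?thesis
    using near C(2) K(2) dev x1 small x_ge[OF gap(1)]
  proof eventually_elim
    case (elim m)
    note near = elim(1) and far = elim(2) and sj = elim(3)[rule_format, of "X m", OF elim(7)]
      and dev = elim(4) and small = elim(6)
    define k where "k = X m + \<lfloor>B m\<rfloor>"
    let ?s = "\<lambda>g::nat \<Rightarrow> int. \<Sum>j=1..m. g j"
    let ?P = "iid_prob D (Suc m)"
    let ?u = "\<alpha> * G (x m) / x m"
    have "0 < 2 / \<eta>" using eta(1) by simp
    then have xp: "x m > 0" "1 \<le> \<eta> / 2 * x m" using elim(5) eta(1) by (linarith, simp add: field_simps)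
    have u: "?u > 0" using xp alpha by (intro divide_pos_pos mult_pos_pos G_pos) auto
    let ?B1 = "{z::int. \<bar>real_of_int z - x m\<bar> \<le> \<eta> * x m}"
    let ?B2 = "{z::int. gap * x m \<le> real_of_int z \<and> \<eta> * x m < \<bar>real_of_int z - x m\<bar>}"
    have 1: "?P {y. (\<Sum>j=1..Suc m. y j) = k \<and> (\<exists>i\<in>{1..Suc m}. y i \<in> ?B1)} \<le>
       real (Suc m) * ((1 + \<epsilon> / 3) * ?u)"
    proof (rule order.trans[OF prob_iid_sum_eq_le[where \<Psi> = "\<lambda>z g. z \<in> ?B1"]])
      have "measure_pmf.expectation (iid D m) (\<lambda>g. pmf D (k - ?s g) * indicator {g. k - ?s g \<in> ?B1} g) \<le>
         (1 + \<epsilon> / 3) * ?u * iid_prob D m UNIV"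
      proof (rule expectation_pmf_le)
        show "0 \<le> (1 + \<epsilon> / 3) * ?u" using assms by (intro mult_nonneg_nonneg less_imp_le[OF u]) auto
      qed (use near in auto)
      then show "real (Suc m) * measure_pmf.expectation (iid D m) (\<lambda>g. pmf D (k - ?s g) * indicator {g. k - ?s g \<in> ?B1} g) \<le>
         real (Suc m) * ((1 + \<epsilon> / 3) * ?u)"
        by (intro mult_left_mono) auto
    qed simp
    have 2: "?P {y. (\<Sum>j=1..Suc m. y j) = k \<and> (\<exists>i\<in>{1..Suc m}. y i \<in> ?B2)} \<le>
       real (Suc m) * (\<epsilon> / 3 * ?u)"
    proof (rule order.trans[OF prob_iid_sum_eq_le[where \<Psi> = "\<lambda>z g. z \<in> ?B2"]])
      have "measure_pmf.expectation (iid D m) (\<lambda>g. pmf D (k - ?s g) * indicator {g. k - ?s g \<in> ?B2} g) \<le>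
         C * ?u * iid_prob D m {g. \<eta> / 2 * x m < \<bar>real_of_int (?s g) - B m\<bar>}"
      proof (rule expectation_pmf_le)
        show "0 \<le> C * ?u" using C by (intro mult_nonneg_nonneg less_imp_le[OF u]) auto
        show "{g. k - ?s g \<in> ?B2} \<subseteq> {g. \<eta> / 2 * x m < \<bar>real_of_int (?s g) - B m\<bar>}"
        proof (intro subsetI CollectI)
          fix g assume "g \<in> {g. k - ?s g \<in> ?B2}"
          then have "\<eta> * x m < \<bar>real_of_int (k - ?s g) - x m\<bar>" by simp
          moreover have "real_of_int (k - ?s g) - x m = real_of_int \<lfloor>B m\<rfloor> - real_of_int (?s g)"
            by (simp add: k_def)
          moreover have "B m - 1 \<le> real_of_int \<lfloor>B m\<rfloor>" "real_of_int \<lfloor>B m\<rfloor> \<le> B m" by linarith+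
          moreover have "\<eta> * x m = \<eta> / 2 * x m + \<eta> / 2 * x m" by simp
          ultimately show "\<eta> / 2 * x m < \<bar>real_of_int (?s g) - B m\<bar>" using xp(2) by linarith
        qed
      qed (use far in auto)
      also have "\<dots> \<le> C * ?u * (\<epsilon> / (3 * C))" 
        by (intro mult_left_mono mult_nonneg_nonneg less_imp_le[OF dev] less_imp_le[OF u] less_imp_le[OF C(1)])
      also have "\<dots> = \<epsilon> / 3 * ?u" using C(1) by (simp add: mult.commute)
      finally show "real (Suc m) * measure_pmf.expectation (iid D m) (\<lambda>g. pmf D (k - ?s g) * indicator {g. k - ?s g \<in> ?B2} g) \<le>
         real (Suc m) * (\<epsilon> / 3 * ?u)"
        by (intro mult_left_mono) auto
    qed simp
    \<comment> \<open>Ties for the maximum are allowed, since an upper bound may count a vector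
      several times.\<close>
    have 3: "?P {y. (\<Sum>j=1..Suc m. y j) = k \<and> (\<exists>i\<in>{1..Suc m}. (\<forall>j\<in>{1..Suc m} - {i}. y j \<le> y i) \<and> real_of_int (y i) < gap * x m)} \<le>
       \<epsilon> / 3 * profile m"
    proof (rule order.trans[OF prob_iid_sum_eq_le[where \<Psi> = "\<lambda>z g. (\<forall>j\<in>{1..m}. g j \<le> z) \<and> real_of_int z < gap * x m"]])
      fix i z g
      assume i: "i \<in> {1..Suc m}" and
        "(\<forall>j\<in>{1..Suc m} - {i}. insert_at i z g j \<le> insert_at i z g i) \<and> real_of_int (insert_at i z g i) < gap * x m"
      then show "(\<forall>j\<in>{1..m}. g j \<le> z) \<and> real_of_int z < gap * x m"
        using ball_insert_at[OF i, of "\<lambda>v. v \<le> z" z g] by simp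
    qed (use sj small in \<open>unfold k_def, linarith\<close>)
    have "{y. (\<Sum>j=1..Suc m. y j) = k} \<subseteq> {y. (\<Sum>j=1..Suc m. y j) = k \<and> (\<exists>i\<in>{1..Suc m}. y i \<in> ?B1)} \<union>
        {y. (\<Sum>j=1..Suc m. y j) = k \<and> (\<exists>i\<in>{1..Suc m}. y i \<in> ?B2)} \<union>
        {y. (\<Sum>j=1..Suc m. y j) = k \<and> (\<exists>i\<in>{1..Suc m}. (\<forall>j\<in>{1..Suc m} - {i}. y j \<le> y i) \<and> real_of_int (y i) < gap * x m)}"
      (is "?T \<subseteq> ?E1 \<union> ?E2 \<union> ?E3")
    proof
      fix y assume y: "y \<in> ?T"
      have "Max (y ` {1..Suc m}) \<in> y ` {1..Suc m}" by (intro Max_in) auto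
      then obtain i where i: "i \<in> {1..Suc m}" "y i = Max (y ` {1..Suc m})" by force
      then have "\<forall>j\<in>{1..Suc m}. y j \<le> y i" by simp
      note i = i(1) this
      consider "real_of_int (y i) < gap * x m" | "y i \<in> ?B1" | "y i \<in> ?B2" by force
      then show "y \<in> ?E1 \<union> ?E2 \<union> ?E3"
        by cases (use y i in blast)+
    qed
    then have "?P ?T \<le> ?P (?E1 \<union> ?E2 \<union> ?E3)" by (intro measure_pmf.finite_measure_mono) auto
    also have "\<dots> \<le> ?P ?E1 + ?P ?E2 + ?P ?E3"
      by (rule order.trans[OF measure_Un_le add_right_mono[OF measure_Un_le]]) auto
    also have "\<dots> \<le> real (Suc m) * ((1 + \<epsilon> / 3) * ?u) + real (Suc m) * (\<epsilon> / 3 * ?u) + \<epsilon> / 3 * profile m"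
      by (intro add_mono 1 2 3)
    also have "\<dots> = (1 + \<epsilon>) * profile m"
    proof -
      have "N * ((1 + \<epsilon> / 3) * u) + N * (\<epsilon> / 3 * u) + \<epsilon> / 3 * (N * u) = (1 + \<epsilon>) * (N * u)" for N u :: real
        by (simp add: field_simps)
      then show ?thesis unfolding profile_def .
    qed
    finally show ?case by (simp only: k_def)
  qed
qed

text \<open>The exceptional vectors, with a large deviation of the sum or a step above \<eta> x, do
  not depend on S. Removing them costs at most \<epsilon> for every S at once, which gives the
  uniformity required for total variation.\<close>

lemma local_lower:
  assumes "0 < \<epsilon>" "\<epsilon> \<le> 1"
  shows "\<forall>\<^sub>F m in sequentially. \<forall>S.
    (1 - \<epsilon>) * profile m * (iid_prob D m S - \<epsilon>) \<le>
    iid_prob D (Suc m) {y. (\<Sum>j=1..Suc m. y j) = X m + \<lfloor>B m\<rfloor> \<and> delete_max (Suc m) y \<in> S}"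
proof -
  obtain \<eta> where eta: "0 < \<eta>" "\<eta> < 1 / 4"
    "\<forall>\<^sub>F t in at_top. \<forall>z::int. \<bar>real_of_int z - t\<bar> \<le> \<eta> * t \<longrightarrow>
       (1 - \<epsilon>) * (\<alpha> * G t / t) \<le> pmf D z \<and> pmf D z \<le> (1 + \<epsilon>) * (\<alpha> * G t / t)"
    using pmf_near[of "\<epsilon>"] assms by auto
  have near: "\<forall>\<^sub>F m in sequentially. \<forall>z::int. \<bar>real_of_int z - x m\<bar> \<le> \<eta> * x m \<longrightarrow>
       (1 - \<epsilon>) * (\<alpha> * G (x m) / x m) \<le> pmf D z \<and> pmf D z \<le> (1 + \<epsilon>) * (\<alpha> * G (x m) / x m)"
    using x_top eta(3) by (rule eventually_compose_filterlim[rotated])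
  have dev: "\<forall>\<^sub>F m in sequentially.
      iid_prob D m {g. \<eta> / 2 * x m < \<bar>real_of_int (\<Sum>j=1..m. g j) - B m\<bar>} < \<epsilon> / 2"
    by (rule order_tendstoD(2)[OF sum_deviation_0]) (use eta assms in auto)
  have mx: "\<forall>\<^sub>F m in sequentially. real (Suc m) * G (\<eta> * x m) < \<epsilon> / 2"
    by (rule order_tendstoD(2)[OF n_tail_0]) (use eta assms in auto)
  have x1: "\<forall>\<^sub>F m in sequentially. 2 / \<eta> \<le> x m" using x_top by (simp add: filterlim_at_top)
  show ?thesis
    using near dev mx x1
  proof eventually_elim
    case (elim m)
    define k where "k = X m + \<lfloor>B m\<rfloor>"
    let ?s = "\<lambda>g::nat \<Rightarrow> int. \<Sum>j=1..m. g j"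
    let ?u = "\<alpha> * G (x m) / x m"
    let ?Q = "iid_prob D m"
    let ?bad1 = "{g. \<eta> / 2 * x m < \<bar>real_of_int (?s g) - B m\<bar>}"
    let ?bad2 = "{g. \<exists>j\<in>{1..m}. g j \<in> {z. \<eta> * x m < real_of_int z}}"
    have "0 < 2 / \<eta>" using eta(1) by simp
    then have xp: "x m > 0" "1 \<le> \<eta> / 2 * x m" using elim(4) eta(1) by (linarith, simp add: field_simps)
    have u: "?u > 0" using xp alpha by (intro divide_pos_pos mult_pos_pos G_pos) auto
    have "?Q ?bad2 \<le> real m * G (\<eta> * x m)" unfolding upper_tail_def by (rule prob_iid_ex_le)
    also have "\<dots> \<le> real (Suc m) * G (\<eta> * x m)" using G_pos[of "\<eta> * x m"] by (intro mult_right_mono) auto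
    finally have bad2: "?Q ?bad2 \<le> \<epsilon> / 2" using elim(3) by linarith
    show ?case
    proof
      fix S :: "(nat \<Rightarrow> int) set"
      have "?Q S \<le> ?Q ((S - (?bad1 \<union> ?bad2)) \<union> ?bad1 \<union> ?bad2)"
        by (intro measure_pmf.finite_measure_mono) auto
      also have "\<dots> \<le> ?Q (S - (?bad1 \<union> ?bad2)) + ?Q ?bad1 + ?Q ?bad2"
        by (rule order.trans[OF measure_Un_le add_right_mono[OF measure_Un_le]]) auto
      finally have good: "?Q S - \<epsilon> \<le> ?Q (S - (?bad1 \<union> ?bad2))" using bad2 elim(2) by linarith
      have sub: "(1 - \<epsilon>) * ?u * indicator (S - (?bad1 \<union> ?bad2)) g \<le>
          pmf D (k - ?s g) * indicator {g. g \<in> S \<and> (\<forall>j\<in>{1..m}. g j < k - ?s g)} g" for g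
      proof (cases "g \<in> S - (?bad1 \<union> ?bad2)")
        case True
        have "\<bar>real_of_int (?s g) - B m\<bar> \<le> \<eta> / 2 * x m" using True by auto
        moreover have "real_of_int (k - ?s g) - x m = real_of_int \<lfloor>B m\<rfloor> - real_of_int (?s g)"
          by (simp add: k_def)
        moreover have "B m - 1 \<le> real_of_int \<lfloor>B m\<rfloor>" "real_of_int \<lfloor>B m\<rfloor> \<le> B m" by linarith+
        moreover have "\<eta> * x m = \<eta> / 2 * x m + \<eta> / 2 * x m" by simp
        ultimately have close: "\<bar>real_of_int (k - ?s g) - x m\<bar> \<le> \<eta> * x m" using xp(2) by linarith
        have "g j < k - ?s g" if "j \<in> {1..m}" for j
        proof -
          have "real_of_int (g j) \<le> \<eta> * x m" using True that by force
          also have "\<dots> < (1 - \<eta>) * x m" using eta xp by (intro mult_strict_right_mono) auto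
          also have "\<dots> \<le> real_of_int (k - ?s g)" using close by (simp add: algebra_simps abs_le_iff)
          finally show ?thesis by (simp only: of_int_less_iff)
        qed
        then show ?thesis using elim(1) close True by simp
      next
        case False
        then show ?thesis by simp
      qed
      have "(1 - \<epsilon>) * profile m * (?Q S - \<epsilon>) \<le> (1 - \<epsilon>) * profile m * ?Q (S - (?bad1 \<union> ?bad2))"
        using assms unfolding profile_def
        by (intro mult_left_mono good mult_nonneg_nonneg less_imp_le[OF u]) auto
      also have "\<dots> = real (Suc m) * measure_pmf.expectation (iid D m) (\<lambda>g. (1 - \<epsilon>) * ?u * indicator (S - (?bad1 \<union> ?bad2)) g)"
        by (simp add: profile_def)
      also have "\<dots> \<le> real (Suc m) * measure_pmf.expectation (iid D m)
          (\<lambda>g. pmf D (k - ?s g) * indicator {g. g \<in> S \<and> (\<forall>j\<in>{1..m}. g j < k - ?s g)} g)"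
      proof (rule mult_left_mono[OF integral_mono[OF _ _ sub]])
        show "integrable (iid D m) (\<lambda>g. (1 - \<epsilon>) * ?u * indicator (S - (?bad1 \<union> ?bad2)) g)"
          by (intro integrable_mult_right measure_pmf.integrable_const_bound[where B = 1])
            (auto split: split_indicator)
        show "integrable (iid D m) (\<lambda>g. pmf D (k - ?s g) * indicator {g. g \<in> S \<and> (\<forall>j\<in>{1..m}. g j < k - ?s g)} g)"
          by (rule measure_pmf.integrable_const_bound[where B = 1])
            (auto simp: pmf_le_1 split: split_indicator)
      qed simp
      also have "\<dots> \<le> iid_prob D (Suc m) {y. (\<Sum>j=1..Suc m. y j) = k \<and> delete_max (Suc m) y \<in> S}"
        by (rule prob_iid_delete_max_ge)
      finally show "(1 - \<epsilon>) * profile m * (?Q S - \<epsilon>) \<le>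
        iid_prob D (Suc m) {y. (\<Sum>j=1..Suc m. y j) = X m + \<lfloor>B m\<rfloor> \<and> delete_max (Suc m) y \<in> S}"
        by (simp only: k_def)
    qed
  qed
qed

lemma conditional_law_close:
  assumes "0 < \<epsilon>"
  shows "\<forall>\<^sub>F m in sequentially. \<forall>S.
    \<bar>iid_prob D (Suc m) {y. (\<Sum>j=1..Suc m. y j) = X m + \<lfloor>B m\<rfloor> \<and> delete_max (Suc m) y \<in> S} /
      iid_prob D (Suc m) {y. (\<Sum>j=1..Suc m. y j) = X m + \<lfloor>B m\<rfloor>} - iid_prob D m S\<bar> \<le> \<epsilon>"
proof -
  define e where "e = min (\<epsilon> / 3) (1 / 2)"
  have e: "0 < e" "e \<le> 1 / 2" "3 * e \<le> \<epsilon>" using assms by (auto simp: e_def)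
  have up: "\<forall>\<^sub>F m in sequentially.
      iid_prob D (Suc m) {y. (\<Sum>j=1..Suc m. y j) = X m + \<lfloor>B m\<rfloor>} \<le> (1 + e) * profile m"
    by (rule local_upper) (use e in auto)
  have low: "\<forall>\<^sub>F m in sequentially. \<forall>S.
    (1 - e) * profile m * (iid_prob D m S - e) \<le>
    iid_prob D (Suc m) {y. (\<Sum>j=1..Suc m. y j) = X m + \<lfloor>B m\<rfloor> \<and> delete_max (Suc m) y \<in> S}"
    by (rule local_lower) (use e in auto)
  show ?thesis
    using up low profile_pos
  proof eventually_elim
    case (elim m)
    let ?T = "{y. (\<Sum>j=1..Suc m. y j) = X m + \<lfloor>B m\<rfloor>}"
    let ?E = "\<lambda>S. {y. (\<Sum>j=1..Suc m. y j) = X m + \<lfloor>B m\<rfloor> \<and> delete_max (Suc m) y \<in> S}"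
    let ?P = "iid_prob D (Suc m)"
    let ?Q = "iid_prob D m"
    have low: "(1 - e) * profile m * (?Q S - e) \<le> ?P (?E S)" for S using elim(2) by blast
    \<comment> \<open>The lower bound for the full set shows that the conditioning event has
      positive probability, so dividing by it is legitimate.\<close>
    have "?E UNIV = ?T" by auto
    then have "(1 - e) * profile m * (1 - e) \<le> ?P ?T" using low[of UNIV] by simp
    moreover have "0 < (1 - e) * profile m * (1 - e)" using e elim(3) by simp
    ultimately have T: "?P ?T > 0" by linarith
    \<comment> \<open>The case split is for the second case: replacing \<open>?P ?T\<close> by its
      upper bound preserves the inequality only if \<open>?Q S - 3 * e\<close> is
      nonnegative.\<close>
    have half: "?Q S - 3 * e \<le> ?P (?E S) / ?P ?T" for S
    proof (cases "?Q S \<le> 3 * e")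
      case True
      then show ?thesis by (smt (verit) divide_nonneg_nonneg measure_nonneg)
    next
      case False
      have "(?Q S - 3 * e) * (1 + e) \<le> (1 - e) * (?Q S - e)"
      proof -
        have "0 \<le> 2 * e * (1 - ?Q S) + 4 * (e * e)" using e by simp
        also have "\<dots> = (1 - e) * (?Q S - e) - (?Q S - 3 * e) * (1 + e)" by (simp add: algebra_simps)
        finally show ?thesis by (simp only: diff_ge_0_iff_ge)
      qed
      then have "(?Q S - 3 * e) * (1 + e) * profile m \<le> (1 - e) * (?Q S - e) * profile m"
        using elim(3) by (intro mult_right_mono) auto
      also have "\<dots> \<le> ?P (?E S)" using low[of S] by (simp add: ac_simps)
      finally have 1: "(?Q S - 3 * e) * ((1 + e) * profile m) \<le> ?P (?E S)" by (simp add: ac_simps)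
      have "(?Q S - 3 * e) * ?P ?T \<le> (?Q S - 3 * e) * ((1 + e) * profile m)"
        using False elim(1) e by (intro mult_left_mono) auto
      then have "(?Q S - 3 * e) * ?P ?T \<le> ?P (?E S)" using 1 by linarith
      then show ?thesis using T by (simp add: pos_le_divide_eq)
    qed
    show ?case
    proof
      fix S
      have "?P ?T = ?P (?E S \<union> ?E (- S))" by (intro arg_cong[where f = ?P]) auto
      also have "\<dots> = ?P (?E S) + ?P (?E (- S))"
        by (intro measure_pmf.finite_measure_Union) auto
      finally have "?P (?E S) / ?P ?T + ?P (?E (- S)) / ?P ?T = 1"
        using T by (simp add: add_divide_distrib[symmetric])
      moreover have "?Q (- S) = 1 - ?Q S"
        using measure_pmf.prob_compl[of S "iid D m"] by (simp add: Compl_eq_Diff_UNIV)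
      ultimately show "\<bar>?P (?E S) / ?P ?T - ?Q S\<bar> \<le> \<epsilon>"
        using half[of S] half[of "- S"] e by (simp only: abs_le_iff) linarith
    qed
  qed
qed

end

section \<open>Necessity of large deviations, weak limits\<close>

lemma first_argmax_properties:
  fixes y :: "nat \<Rightarrow> 'a::linorder"
  assumes "n \<ge> 1"
  shows "first_argmax n y \<in> {1..n}" "y (first_argmax n y) = Max (y ` {1..n})"
proof -
  have "Max (y ` {1..n}) \<in> y ` {1..n}" using assms by (intro Max_in) auto
  then obtain i where "i \<in> {1..n} \<and> y i = Max (y ` {1..n})" by force
  from LeastI[of "\<lambda>i. i \<in> {1..n} \<and> y i = Max (y ` {1..n})", OF this]
  show "first_argmax n y \<in> {1..n}" "y (first_argmax n y) = Max (y ` {1..n})"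
    by (simp_all add: first_argmax_def)
qed

text \<open>With \<open>sum_delete_max\<close> this says that each remaining step plus the sum of
  the remaining steps is at most the total sum, the constraint behind necessity.\<close>

lemma delete_max_le_Max:
  fixes y :: "nat \<Rightarrow> 'a::linorder"
  assumes "j \<in> {1..m}"
  shows "delete_max (Suc m) y j \<le> Max (y ` {1..Suc m})"
  using assms by (auto simp: delete_max_def intro!: Max_ge)

lemma sum_delete_max:
  fixes y :: "nat \<Rightarrow> int"
  shows "(\<Sum>j=1..m. delete_max (Suc m) y j) = (\<Sum>j=1..Suc m. y j) - Max (y ` {1..Suc m})"
proof -
  define i where "i = first_argmax (Suc m) y"
  have i: "i \<in> {1..Suc m}" "y i = Max (y ` {1..Suc m})"
    using first_argmax_properties[of "Suc m" y] by (auto simp: i_def)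
  define h where "h = (\<lambda>j. if j < i then j else Suc j)"
  have h: "bij_betw h {1..m} ({1..Suc m} - {i})"
    using i(1) unfolding h_def
    by (intro bij_betwI[where g = "skip i"]) (auto simp: skip_def split: if_splits)
  have "(\<Sum>j=1..m. delete_max (Suc m) y j) = (\<Sum>j=1..m. y (h j))"
    by (intro sum.cong) (auto simp: delete_max_def h_def i_def)
  also have "\<dots> = (\<Sum>j\<in>{1..Suc m} - {i}. y j)"
    by (rule sum.reindex_bij_betw[OF h])
  also have "\<dots> = (\<Sum>j=1..Suc m. y j) - y i"
    using i(1) by (subst sum_diff1) auto
  finally show ?thesis by (simp add: i(2))
qed

lemma prob_pair_pmf_Times:
  "measure_pmf.prob (pair_pmf P Q) (U \<times> V) = measure_pmf.prob P U * measure_pmf.prob Q V"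
proof -
  have "emeasure (pair_pmf P Q) (U \<times> V) = (\<integral>\<^sup>+ x. indicator (U \<times> V) x \<partial>pair_pmf P Q)" by simp
  also have "\<dots> = (\<integral>\<^sup>+ u. \<integral>\<^sup>+ v. indicator U u * indicator V v \<partial>Q \<partial>P)"
    by (simp add: nn_integral_pair_pmf' indicator_times)
  also have "\<dots> = emeasure P U * emeasure Q V"
    by (simp add: nn_integral_cmult nn_integral_multc)
  finally show ?thesis
    by (simp add: measure_pmf.emeasure_eq_measure ennreal_mult[symmetric])
qed

text \<open>Requiring that no other step lies in U makes the events for different positions
  disjoint, so the probability is an exact product rather than a union bound.\<close>

lemma prob_iid_unique_jump:
  "iid_prob D (Suc l) {y. \<exists>i\<in>{1..Suc l}. y i \<in> U \<and> (\<forall>j\<in>{1..Suc l} - {i}. y j \<notin> U) \<and>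
      (\<Sum>j=1..Suc l. y j) - y i \<in> R} =
    real (Suc l) * (measure_pmf.prob D U * iid_prob D l {g. (\<forall>j\<in>{1..l}. g j \<notin> U) \<and> (\<Sum>j=1..l. g j) \<in> R})"
proof -
  let ?E = "\<lambda>i. {y. y i \<in> U \<and> (\<forall>j\<in>{1..Suc l} - {i}. y j \<notin> U) \<and> (\<Sum>j=1..Suc l. y j) - y i \<in> R}"
  let ?W = "{g. (\<forall>j\<in>{1..l}. g j \<notin> U) \<and> (\<Sum>j=1..l. g j) \<in> R}"
  let ?P = "iid_prob D (Suc l)"
  have e: "?P (?E i) = measure_pmf.prob D U * iid_prob D l ?W" if i: "i \<in> {1..Suc l}" for i
  proof -
    have "(\<lambda>(z, g). insert_at i z g) -` ?E i = U \<times> ?W"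
    proof -
      have "(\<forall>j\<in>{1..Suc l} - {i}. insert_at i z g j \<notin> U) \<longleftrightarrow> (\<forall>j\<in>{1..l}. g j \<notin> U)" for z g
        by (rule ball_insert_at[OF i])
      then show ?thesis
        unfolding vimage_def case_prod_unfold mem_Collect_eq insert_at_same sum_insert_at[OF i] by auto
    qed
    then show ?thesis unfolding iid_Suc[OF i] measure_map_pmf by (simp add: prob_pair_pmf_Times)
  qed
  have "{y. \<exists>i\<in>{1..Suc l}. y i \<in> U \<and> (\<forall>j\<in>{1..Suc l} - {i}. y j \<notin> U) \<and>
      (\<Sum>j=1..Suc l. y j) - y i \<in> R} = (\<Union>i\<in>{1..Suc l}. ?E i)" by blast
  moreover have "?P (\<Union>i\<in>{1..Suc l}. ?E i) = (\<Sum>i\<in>{1..Suc l}. ?P (?E i))"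
  proof (rule measure_pmf.finite_measure_finite_Union)
    show "disjoint_family_on ?E {1..Suc l}"
      unfolding disjoint_family_on_def by blast
  qed auto
  moreover have "\<dots> = real (Suc l) * (measure_pmf.prob D U * iid_prob D l ?W)"
    using e by simp
  ultimately show ?thesis by simp
qed

context stable_domain
begin

text \<open>Let exactly one step exceed t = T \<open>A m\<close>, with the others summing to at
  least \<open>B m - t\<close>. That step occurs twice in the expression, once alone and once in the
  sum; two copies exceed 2 t and outweigh the deficit t, leaving more than t, which is at least K
  \<open>A m\<close>.\<close>

lemma exceeds_scale:
  obtains c where "c > 0" "\<forall>\<^sub>F m in sequentially. c \<le> iid_prob D m
    {g. \<exists>j\<in>{1..m}. K * A m < real_of_int (g j) + real_of_int (\<Sum>j=1..m. g j) - real_of_int \<lfloor>B m\<rfloor>}"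
proof -
  obtain T0 where T0: "T0 > 0" "\<forall>\<^sub>F m in sequentially.
      iid_prob D m {y. T0 * A (Suc m) < \<bar>real_of_int (\<Sum>j=1..m. y j) - B (Suc m)\<bar>} \<le> 1 / 4"
    using tight_A_Suc[of "1 / 4"] by auto
  have "((\<lambda>T. p * T powr (-\<alpha>)) \<longlongrightarrow> p * 0) at_top"
    using alpha by (intro tendsto_mult tendsto_const tendsto_neg_powr filterlim_ident) auto
  then have "\<forall>\<^sub>F T in at_top. p * T powr (-\<alpha>) < 1 / 4" by (rule order_tendstoD) simp
  moreover have "\<forall>\<^sub>F T in at_top. max T0 (max K 1) \<le> T" by (rule eventually_ge_at_top)
  ultimately have "\<forall>\<^sub>F T in at_top. p * T powr (-\<alpha>) < 1 / 4 \<and> max T0 (max K 1) \<le> T"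
    by eventually_elim auto
  \<comment> \<open>T is large enough that a second jump above the level has probability at most 1 /
    4 in the limit, that the tightness bound at \<open>T0\<close> covers the deficit t, and that t
    dominates K times the scale.\<close>
  then obtain T where T: "p * T powr (-\<alpha>) < 1 / 4" "T0 \<le> T" "K \<le> T" "1 \<le> T"
    using eventually_happens'[OF trivial_limit_at_top_linorder] by fastforce
  define \<kappa> where "\<kappa> = p * T powr (-\<alpha>)"
  have kap: "\<kappa> > 0" "\<kappa> < 1 / 4" using T p_pos by (auto simp: \<kappa>_def)
  have A2: "filterlim (\<lambda>l. A (Suc l)) at_top sequentially"
    using filterlim_compose[OF A_top filterlim_Suc] by simp
  have "(\<lambda>l. real (Suc (Suc l)) * G (A (Suc l)) * (G (T * A (Suc l)) / G (A (Suc l)))) \<longlonglongrightarrow> p * T powr (-\<alpha>)"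
  proof (intro tendsto_mult)
    show "(\<lambda>l. real (Suc (Suc l)) * G (A (Suc l))) \<longlonglongrightarrow> p"
      using LIMSEQ_Suc[OF A_tail] by simp
    show "(\<lambda>l. G (T * A (Suc l)) / G (A (Suc l))) \<longlonglongrightarrow> T powr (-\<alpha>)"
      using T by (intro filterlim_compose[OF tail_scale A2]) auto
  qed
  moreover have "N * G u * (G v / G u) = N * G v" for N u v
    using G_pos[of u] by simp
  ultimately have lim: "(\<lambda>l. real (Suc (Suc l)) * G (T * A (Suc l))) \<longlonglongrightarrow> \<kappa>"
    unfolding \<kappa>_def by (simp only:)
  have 1: "\<forall>\<^sub>F l in sequentially. real (Suc (Suc l)) * G (T * A (Suc l)) < 1 / 4"
    by (rule order_tendstoD[OF lim]) (use kap in auto)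
  have 2: "\<forall>\<^sub>F l in sequentially. \<kappa> / 2 < real (Suc (Suc l)) * G (T * A (Suc l))"
    by (rule order_tendstoD[OF lim]) (use kap in auto)
  have 3: "\<forall>\<^sub>F l in sequentially. 1 \<le> A (Suc l)" using A2 unfolding filterlim_at_top by blast
  have "\<forall>\<^sub>F l in sequentially. \<kappa> / 8 \<le> iid_prob D (Suc l)
    {g. \<exists>j\<in>{1..Suc l}. K * A (Suc l) < real_of_int (g j) + real_of_int (\<Sum>j=1..Suc l. g j) - real_of_int \<lfloor>B (Suc l)\<rfloor>}"
    using 1 2 3 T0(2)
  proof eventually_elim
    case (elim l)
    define t where "t = T * A (Suc l)"
    define \<beta> where "\<beta> = B (Suc l)"
    let ?U = "{z::int. t < real_of_int z}"
    let ?R = "{s::int. \<beta> - t \<le> real_of_int s}"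
    let ?Q = "iid_prob D l"
    let ?W = "{g. (\<forall>j\<in>{1..l}. g j \<notin> ?U) \<and> (\<Sum>j=1..l. g j) \<in> ?R}"
    let ?bad1 = "{g. \<exists>j\<in>{1..l}. g j \<in> ?U}"
    let ?bad2 = "{g. T0 * A (Suc l) < \<bar>real_of_int (\<Sum>j=1..l. g j) - B (Suc l)\<bar>}"
    have t: "T0 * A (Suc l) \<le> t" "K * A (Suc l) \<le> t" using T elim(3) by (auto simp: t_def intro!: mult_right_mono)
    have "?Q ?bad1 \<le> real l * G t" unfolding upper_tail_def by (rule prob_iid_ex_le)
    also have "\<dots> \<le> real (Suc (Suc l)) * G t" using G_pos[of t] by (intro mult_right_mono) auto
    finally have b1: "?Q ?bad1 \<le> 1 / 4" using elim(1) by (simp add: t_def)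
    have "1 = ?Q UNIV" by simp
    also have "\<dots> \<le> ?Q (?W \<union> ?bad1 \<union> ?bad2)"
    proof (intro measure_pmf.finite_measure_mono subsetI)
      fix g
      have "(\<Sum>j=1..l. g j) \<in> ?R" if "g \<notin> ?bad2" using that t(1) by (simp add: \<beta>_def abs_le_iff not_less)
      then show "g \<in> ?W \<union> ?bad1 \<union> ?bad2" by blast
    qed auto
    also have "\<dots> \<le> ?Q ?W + ?Q ?bad1 + ?Q ?bad2"
      by (rule order.trans[OF measure_Un_le add_right_mono[OF measure_Un_le]]) auto
    finally have W: "1 / 2 \<le> ?Q ?W" using b1 elim(4) by linarith
    have half: "real (Suc (Suc l)) * G t \<le> 2 * (real (Suc l) * G t)"
      using G_pos[of t] by (simp add: algebra_simps)
    have "\<kappa> / 4 \<le> real (Suc l) * G t"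
      using elim(2) half unfolding t_def by linarith
    then have "\<kappa> / 4 * (1 / 2) \<le> real (Suc l) * G t * ?Q ?W"
      using W kap G_pos[of t] by (intro mult_mono) simp_all
    then have "\<kappa> / 8 \<le> real (Suc l) * (measure_pmf.prob D ?U * ?Q ?W)"
      by (simp add: upper_tail_def mult.assoc)
    also have "\<dots> = iid_prob D (Suc l) {y. \<exists>i\<in>{1..Suc l}. y i \<in> ?U \<and> (\<forall>j\<in>{1..Suc l} - {i}. y j \<notin> ?U) \<and>
      (\<Sum>j=1..Suc l. y j) - y i \<in> ?R}"
      by (rule prob_iid_unique_jump[symmetric])
    also have "\<dots> \<le> iid_prob D (Suc l)
      {g. \<exists>j\<in>{1..Suc l}. K * A (Suc l) < real_of_int (g j) + real_of_int (\<Sum>j=1..Suc l. g j) - real_of_int \<lfloor>B (Suc l)\<rfloor>}"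
    proof (intro measure_pmf.finite_measure_mono subsetI CollectI)
      fix y assume "y \<in> {y. \<exists>i\<in>{1..Suc l}. y i \<in> ?U \<and> (\<forall>j\<in>{1..Suc l} - {i}. y j \<notin> ?U) \<and>
        (\<Sum>j=1..Suc l. y j) - y i \<in> ?R}"
      then obtain i where i: "i \<in> {1..Suc l}" "y i \<in> ?U" "(\<Sum>j=1..Suc l. y j) - y i \<in> ?R" by blast
      have "\<beta> - t \<le> real_of_int ((\<Sum>j=1..Suc l. y j) - y i)" using i(3) by blast
      then have "\<beta> - t \<le> real_of_int (\<Sum>j=1..Suc l. y j) - real_of_int (y i)"
        by (simp only: of_int_diff)
      moreover have "t < real_of_int (y i)" using i(2) by blast
      moreover have "real_of_int \<lfloor>B (Suc l)\<rfloor> \<le> \<beta>" by (simp add: \<beta>_def)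
      ultimately have "K * A (Suc l) < real_of_int (y i) + real_of_int (\<Sum>j=1..Suc l. y j) - real_of_int \<lfloor>B (Suc l)\<rfloor>"
        using t(2) by linarith
      then show "\<exists>j\<in>{1..Suc l}. K * A (Suc l) < real_of_int (y j) + real_of_int (\<Sum>j=1..Suc l. y j) - real_of_int \<lfloor>B (Suc l)\<rfloor>"
        using i(1) by blast
    qed auto
    finally show ?case .
  qed
  then have "\<forall>\<^sub>F m in sequentially. \<kappa> / 8 \<le> iid_prob D m
    {g. \<exists>j\<in>{1..m}. K * A m < real_of_int (g j) + real_of_int (\<Sum>j=1..m. g j) - real_of_int \<lfloor>B m\<rfloor>}"
    by (subst eventually_sequentially_Suc[symmetric])
  then show ?thesis using that[of "\<kappa> / 8"] kap by simp
qed

end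

section \<open>Weak limits through distribution functions\<close>

lemma continuity_point_between:
  fixes F :: "real \<Rightarrow> real"
  assumes "mono F" "u < v"
  obtains t where "u < t" "t < v" "isCont F t"
proof -
  have "countable {t. \<not> isCont F t}" using mono_ctble_discont[OF assms(1)] by simp
  then have "\<exists>t. t \<in> {u<..<v} - {t. \<not> isCont F t}"
    using open_minus_countable[of "{t. \<not> isCont F t}" "{u<..<v}"] assms(2) by auto
  then show ?thesis using that by auto
qed

text \<open>Convergence is available only at continuity points, so the two cut-offs are moved
  outward to such points; monotonicity then passes to a symmetric interval.\<close>

lemma tight_of_weak_limit:
  fixes P :: "nat \<Rightarrow> real \<Rightarrow> real"
  assumes "real_distribution \<sigma>"
    and lim: "\<And>t. isCont (cdf \<sigma>) t \<Longrightarrow> (\<lambda>n. P n t) \<longlonglongrightarrow> cdf \<sigma> t"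
    and mono_P: "\<And>n s t. s \<le> t \<Longrightarrow> P n s \<le> P n t"
    and "\<epsilon> > 0"
  obtains T where "T > 0" "\<forall>\<^sub>F n in sequentially. P n (- T) + (1 - P n T) \<le> \<epsilon>"
proof -
  interpret real_distribution \<sigma> by fact
  have mono: "mono (cdf \<sigma>)" by (intro monoI cdf_nondecreasing)
  have "\<forall>\<^sub>F t in at_top. 1 - \<epsilon> / 4 < cdf \<sigma> t"
    using \<open>\<epsilon> > 0\<close> by (intro order_tendstoD[OF cdf_lim_at_top_prob]) auto
  then obtain u where u: "\<And>t. t \<ge> u \<Longrightarrow> 1 - \<epsilon> / 4 < cdf \<sigma> t" by (auto simp: eventually_at_top_linorder)
  have "\<forall>\<^sub>F t in at_bot. cdf \<sigma> t < \<epsilon> / 4"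
    using \<open>\<epsilon> > 0\<close> by (intro order_tendstoD[OF cdf_lim_at_bot]) auto
  then obtain v where v: "\<And>t. t \<le> v \<Longrightarrow> cdf \<sigma> t < \<epsilon> / 4" by (auto simp: eventually_at_bot_linorder)
  obtain s where s: "max u 0 < s" "isCont (cdf \<sigma>) s"
    using continuity_point_between[OF mono, of "max u 0" "max u 0 + 1"] by auto
  have "min v 0 - 1 < min v 0" by linarith
  from continuity_point_between[OF mono this] obtain r where r: "r < min v 0" "isCont (cdf \<sigma>) r"
    by metis
  have 1: "\<forall>\<^sub>F n in sequentially. 1 - \<epsilon> / 4 < P n s"
    using u[of s] s by (intro order_tendstoD[OF lim]) auto
  have 2: "\<forall>\<^sub>F n in sequentially. P n r < \<epsilon> / 4"
    using v[of r] r by (intro order_tendstoD[OF lim]) auto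
  show ?thesis
  proof (rule that[of "max s (- r)"])
    show "max s (- r) > 0" using s by (simp add: less_max_iff_disj)
    show "\<forall>\<^sub>F n in sequentially. P n (- max s (- r)) + (1 - P n (max s (- r))) \<le> \<epsilon>"
      using 1 2
    proof eventually_elim
      case (elim n)
      have "P n (- max s (- r)) \<le> P n r" "P n s \<le> P n (max s (- r))" by (intro mono_P; simp)+
      then show ?case using elim \<open>\<epsilon> > 0\<close> by linarith
    qed
  qed
qed

text \<open>A Slutsky argument: dropping one step and rounding the centering change the sum by o(a
  n) in probability, so the distribution function is squeezed between its values at neighbouring
  continuity points r < t < s.\<close>

lemma (in stable_domain) weak_limit_pred:
  assumes "real_distribution \<sigma>"
    and lim: "\<And>t. isCont (cdf \<sigma>) t \<Longrightarrow>
      (\<lambda>n. iid_prob D n {y. (real_of_int (\<Sum>j=1..n. y j) - b n) / a n \<le> t}) \<longlonglongrightarrow> cdf \<sigma> t"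
    and cont: "isCont (cdf \<sigma>) t"
  shows "(\<lambda>m. iid_prob D m {g. (real_of_int (\<Sum>j=1..m. g j) - real_of_int \<lfloor>B m\<rfloor>) / A m \<le> t}) \<longlonglongrightarrow> cdf \<sigma> t"
proof -
  interpret real_distribution \<sigma> by fact
  have mono: "mono (cdf \<sigma>)" by (intro monoI cdf_nondecreasing)
  let ?F = "\<lambda>m t. iid_prob D (Suc m) {y. (real_of_int (\<Sum>j=1..Suc m. y j) - B m) / A m \<le> t}"
  let ?H = "\<lambda>m. iid_prob D m {g. (real_of_int (\<Sum>j=1..m. g j) - real_of_int \<lfloor>B m\<rfloor>) / A m \<le> t}"
  have F: "(\<lambda>m. ?F m s) \<longlonglongrightarrow> cdf \<sigma> s" if "isCont (cdf \<sigma>) s" for s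
    using LIMSEQ_Suc[OF lim[OF that]] .
  \<comment> \<open>The subtracted 1 is reserved for the rounding of the centering.\<close>
  have R: "\<forall>\<^sub>F m in sequentially. measure_pmf.prob D {z. \<eta> * A m - 1 < \<bar>real_of_int z\<bar>} < e" if "\<eta> > 0" "e > 0" for \<eta> e
  proof -
    have "filterlim (\<lambda>m. - 1 + \<eta> * A m) at_top sequentially"
      by (rule filterlim_tendsto_add_at_top[OF tendsto_const
            filterlim_tendsto_pos_mult_at_top[OF tendsto_const that(1) A_top]])
    then have "filterlim (\<lambda>m. \<eta> * A m - 1) at_top sequentially" by simp
    from filterlim_compose[OF abs_prob_0 this] show ?thesis using that(2) by (intro order_tendstoD) auto
  qed
  have upper: "?H m \<le> ?F m (t + \<eta>) + measure_pmf.prob D {z. \<eta> * A m - 1 < \<bar>real_of_int z\<bar>}" if "1 \<le> A m" for m \<eta>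
  proof (rule prob_iid_Suc_sum)
    fix s z :: int assume "(real_of_int s - real_of_int \<lfloor>B m\<rfloor>) / A m \<le> t"
    then have s: "real_of_int s - real_of_int \<lfloor>B m\<rfloor> \<le> t * A m" using that by (simp add: pos_divide_le_eq)
    show "(real_of_int (z + s) - B m) / A m \<le> t + \<eta> \<or> \<eta> * A m - 1 < \<bar>real_of_int z\<bar>"
    proof (cases "\<eta> * A m - 1 < \<bar>real_of_int z\<bar>")
      case False
      have "real_of_int \<lfloor>B m\<rfloor> \<le> B m" by simp
      then have "real_of_int (z + s) - B m \<le> t * A m + \<eta> * A m"
        unfolding of_int_add using s False by linarith
      then show ?thesis using that by (simp add: pos_divide_le_eq algebra_simps)
    qed simp
  qed
  \<comment> \<open>Written with complements so that the same transfer lemma, which gives upper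
    bounds only, applies again.\<close>
  have lower: "1 - ?H m \<le> 1 - ?F m (t - \<eta>) + measure_pmf.prob D {z. \<eta> * A m - 1 < \<bar>real_of_int z\<bar>}" if A1: "1 \<le> A m" for m \<eta>
  proof -
    have compl: "measure_pmf.prob N {g. \<not> Z g} = 1 - measure_pmf.prob N {g. Z g}" for N :: "(nat \<Rightarrow> int) pmf" and Z
      using measure_pmf.prob_compl[of "{g. Z g}" N] by (simp add: Collect_neg_eq Compl_eq_Diff_UNIV)
    show ?thesis
      unfolding compl[symmetric]
    proof (rule prob_iid_Suc_sum)
      fix s z :: int assume "\<not> (real_of_int s - real_of_int \<lfloor>B m\<rfloor>) / A m \<le> t"
      then have s: "t * A m < real_of_int s - real_of_int \<lfloor>B m\<rfloor>" using A1 by (simp add: pos_divide_le_eq)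
      show "\<not> (real_of_int (z + s) - B m) / A m \<le> t - \<eta> \<or> \<eta> * A m - 1 < \<bar>real_of_int z\<bar>"
      proof (cases "\<eta> * A m - 1 < \<bar>real_of_int z\<bar>")
        case False
        have "B m - 1 \<le> real_of_int \<lfloor>B m\<rfloor>" by linarith
        then have "t * A m - \<eta> * A m < real_of_int (z + s) - B m"
          unfolding of_int_add using s False by linarith
        then have "t - \<eta> < (real_of_int (z + s) - B m) / A m"
          using A1 by (subst pos_less_divide_eq) (simp_all add: left_diff_distrib)
        then show ?thesis by linarith
      qed simp
    qed
  qed
  show ?thesis
  proof (rule tendstoI)
    fix \<epsilon> :: real assume eps: "\<epsilon> > 0"
    obtain d where d: "d > 0" "\<And>s. \<bar>s - t\<bar> < d \<Longrightarrow> \<bar>cdf \<sigma> s - cdf \<sigma> t\<bar> < \<epsilon> / 4"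
      using cont eps unfolding continuous_at_eps_delta
      by (metis dist_real_def zero_less_divide_iff zero_less_numeral)
    obtain s where s: "t < s" "s < t + d" "isCont (cdf \<sigma>) s"
      using continuity_point_between[OF mono, of t "t + d"] d(1) by auto
    obtain r where r: "t - d < r" "r < t" "isCont (cdf \<sigma>) r"
      using continuity_point_between[OF mono, of "t - d" t] d(1) by auto
    have Fs: "\<forall>\<^sub>F m in sequentially. ?F m s < cdf \<sigma> s + \<epsilon> / 4"
      using eps by (intro order_tendstoD[OF F[OF s(3)]]) auto
    have Fr: "\<forall>\<^sub>F m in sequentially. cdf \<sigma> r - \<epsilon> / 4 < ?F m r"
      using eps by (intro order_tendstoD[OF F[OF r(3)]]) auto
    have "\<bar>s - t\<bar> < d" "\<bar>r - t\<bar> < d" using s r by linarith+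
    from this[THEN d(2)]
    have ds: "cdf \<sigma> s < cdf \<sigma> t + \<epsilon> / 4" and dr: "cdf \<sigma> t - \<epsilon> / 4 < cdf \<sigma> r"
      by linarith+
    have Rs: "\<forall>\<^sub>F m in sequentially. measure_pmf.prob D {z. (s - t) * A m - 1 < \<bar>real_of_int z\<bar>} < \<epsilon> / 4"
      using s eps by (intro R) auto
    have Rr: "\<forall>\<^sub>F m in sequentially. measure_pmf.prob D {z. (t - r) * A m - 1 < \<bar>real_of_int z\<bar>} < \<epsilon> / 4"
      using r eps by (intro R) auto
    show "\<forall>\<^sub>F m in sequentially. dist (?H m) (cdf \<sigma> t) < \<epsilon>"
      using Fs Fr Rs Rr A_ge[of 1]
    proof eventually_elim
      case (elim m)
      have "?H m \<le> ?F m s + measure_pmf.prob D {z. (s - t) * A m - 1 < \<bar>real_of_int z\<bar>}"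
        using upper[OF elim(5), of "s - t"] by simp
      moreover have "1 - ?H m \<le> 1 - ?F m r + measure_pmf.prob D {z. (t - r) * A m - 1 < \<bar>real_of_int z\<bar>}"
        using lower[OF elim(5), of "t - r"] by simp
      ultimately show ?case using elim ds dr unfolding dist_real_def by linarith
    qed
  qed
qed

section \<open>From distribution functions and random variables to mass functions\<close>

text \<open>\<open>L\<close> is eliminated by comparing everything with the common function
  \<open>?h\<close>, whose ratio to the right tail tends to 1. Asymptotic equivalence by itself
  tolerates common zeros; eventual positivity of \<open>L\<close> turns it into a limit of
  quotients.\<close>

lemma tail_law_of_asymptotics:
  fixes D :: "int pmf" and L :: "real \<Rightarrow> real" and \<alpha> p q :: real
  assumes alpha: "0 < \<alpha>" "\<alpha> < 2" and L: "slowly_varying L" and pq: "p > 0" "q \<ge> 0"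
    and right: "upper_tail D \<sim>[at_top] (\<lambda>t. p * L t * t powr (-\<alpha>))"
    and left: "if q = 0
        then (\<lambda>t. measure_pmf.prob D {z. real_of_int z \<le> - t}) \<in> o[at_top](\<lambda>t. L t * t powr (-\<alpha>))
        else (\<lambda>t. measure_pmf.prob D {z. real_of_int z \<le> - t}) \<sim>[at_top] (\<lambda>t. q * L t * t powr (-\<alpha>))"
    and loc: "(\<lambda>k::nat. pmf D (int k)) \<sim>[at_top] (\<lambda>k. p * \<alpha> * L (real k) * real k powr (-(1 + \<alpha>)))"
  shows "tail_law D \<alpha>"
    and "((\<lambda>t. upper_tail D t / (p * L t * t powr (-\<alpha>))) \<longlongrightarrow> 1) at_top"
proof -
  let ?h = "\<lambda>t. p * L t * t powr (-\<alpha>)"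
  obtain X0 where "X0 > 0" and L0: "\<And>t. t \<ge> X0 \<Longrightarrow> L t > 0"
    and Lscale: "\<And>c. c > 0 \<Longrightarrow> ((\<lambda>t. L (c * t) / L t) \<longlongrightarrow> 1) at_top"
    using L unfolding slowly_varying_def by blast
  have Lpos: "\<forall>\<^sub>F t in at_top. L t > 0" using L0 eventually_ge_at_top[of X0] by (rule eventually_mono[rotated])
  have hpos: "\<forall>\<^sub>F t in at_top. ?h t > 0"
    using Lpos eventually_gt_at_top[of 0] by eventually_elim (use pq in simp)
  have "\<forall>\<^sub>F t in at_top. upper_tail D t \<noteq> 0 \<or> ?h t \<noteq> 0" using hpos by eventually_elim auto
  with right show ratio: "((\<lambda>t. upper_tail D t / ?h t) \<longlongrightarrow> 1) at_top" by (rule asymp_equivD_strong)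
  have anti: "upper_tail D t \<le> upper_tail D s" if "s \<le> t" for s t
    unfolding upper_tail_def using that by (intro measure_pmf.finite_measure_mono) auto
  have "\<forall>\<^sub>F t in at_top. upper_tail D t / ?h t > 0" by (rule order_tendstoD[OF ratio]) simp
  then have Gev: "\<forall>\<^sub>F t in at_top. upper_tail D t > 0"
    using hpos by eventually_elim (simp only: zero_less_divide_iff, linarith)
  have pos: "0 < upper_tail D t" for t
  proof -
    obtain s where "upper_tail D s > 0" "s \<ge> t"
      using eventually_happens'[OF trivial_limit_at_top_linorder eventually_conj[OF Gev eventually_ge_at_top[of t]]]
      by blast
    then show ?thesis using anti[of t s] by linarith
  qed
  have inv: "((\<lambda>t. ?h t / upper_tail D t) \<longlongrightarrow> 1) at_top"
    using tendsto_inverse[OF ratio] by (simp add: inverse_divide)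
  show "tail_law D \<alpha>"
  proof
    show "0 < \<alpha>" "\<alpha> < 2" by (fact alpha)+
    show "0 < upper_tail D t" for t by (rule pos)
    show "((\<lambda>t. upper_tail D (c * t) / upper_tail D t) \<longlongrightarrow> c powr (-\<alpha>)) at_top" if c: "c > 0" for c
    proof -
      have ct: "filterlim (\<lambda>t. c * t) at_top at_top"
        by (rule filterlim_tendsto_pos_mult_at_top[OF tendsto_const c filterlim_ident])
      have lim: "((\<lambda>t. upper_tail D (c * t) / ?h (c * t) * (c powr (-\<alpha>) * (L (c * t) / L t)) * (?h t / upper_tail D t))
          \<longlongrightarrow> 1 * (c powr (-\<alpha>) * 1) * 1) at_top"
        by (intro tendsto_mult tendsto_const inv Lscale c filterlim_compose[OF ratio ct])
      have ev: "\<forall>\<^sub>F t in at_top. upper_tail D (c * t) / ?h (c * t) * (c powr (-\<alpha>) * (L (c * t) / L t)) * (?h t / upper_tail D t)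
          = upper_tail D (c * t) / upper_tail D t"
        using Lpos eventually_gt_at_top[of 0] eventually_compose_filterlim[OF Lpos ct]
      proof eventually_elim
        case (elim t)
        have "p * L (c * t) * (c * t) powr (-\<alpha>) \<noteq> 0" using elim c pq by simp
        moreover have "(c * t) powr (-\<alpha>) = c powr (-\<alpha>) * t powr (-\<alpha>)" using elim c by (simp add: powr_mult)
        ultimately show ?case using elim c pq by simp
      qed
      from Lim_transform_eventually[OF lim ev] show ?thesis by (simp only: mult_1_right mult_1_left)
    qed
    show "\<exists>C. \<forall>t\<ge>0. measure_pmf.prob D {z. t < \<bar>real_of_int z\<bar>} \<le> C * upper_tail D t"
    proof -
      \<comment> \<open>Both readings of the left tail hypothesis reduce to a bound by a multiple of
        \<open>?h\<close>: the little-o case gives 1 / p and the other 2 q / p.\<close>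
      have "\<exists>c>0. \<forall>\<^sub>F t in at_top. measure_pmf.prob D {z. real_of_int z \<le> - t} \<le> c * ?h t"
      proof (cases "q = 0")
        case True
        then have "(\<lambda>t. measure_pmf.prob D {z. real_of_int z \<le> - t}) \<in> o[at_top](\<lambda>t. L t * t powr (-\<alpha>))" using left by simp
        from landau_o.smallD[OF this zero_less_one]
        have "\<forall>\<^sub>F t in at_top. measure_pmf.prob D {z. real_of_int z \<le> - t} \<le> 1 / p * ?h t"
          using Lpos by eventually_elim (use pq in \<open>simp add: abs_mult\<close>)
        then show ?thesis using pq by (intro exI[of _ "1 / p"]) simp
      next
        case False
        let ?k = "\<lambda>t. q * L t * t powr (-\<alpha>)"
        have kpos: "\<forall>\<^sub>F t in at_top. ?k t > 0"
          using Lpos eventually_gt_at_top[of 0] by eventually_elim (use pq False in simp)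
        have eq: "(\<lambda>t. measure_pmf.prob D {z. real_of_int z \<le> - t}) \<sim>[at_top] ?k" using left False by simp
        have "\<forall>\<^sub>F t in at_top. measure_pmf.prob D {z. real_of_int z \<le> - t} \<noteq> 0 \<or> ?k t \<noteq> 0" using kpos by eventually_elim auto
        with eq have "((\<lambda>t. measure_pmf.prob D {z. real_of_int z \<le> - t} / ?k t) \<longlongrightarrow> 1) at_top" by (rule asymp_equivD_strong)
        then have "\<forall>\<^sub>F t in at_top. measure_pmf.prob D {z. real_of_int z \<le> - t} / ?k t < 2" by (rule order_tendstoD) simp
        then have "\<forall>\<^sub>F t in at_top. measure_pmf.prob D {z. real_of_int z \<le> - t} \<le> 2 * q / p * ?h t"
          using kpos
        proof eventually_elim
          case (elim t)
          then have "measure_pmf.prob D {z. real_of_int z \<le> - t} < 2 * ?k t" by (simp only: pos_divide_less_eq)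
          then show ?case using pq by simp
        qed
        then show ?thesis using pq False by (intro exI[of _ "2 * q / p"]) simp
      qed
      then obtain c where c: "c > 0" "\<forall>\<^sub>F t in at_top. measure_pmf.prob D {z. real_of_int z \<le> - t} \<le> c * ?h t" by blast
      have "\<forall>\<^sub>F t in at_top. ?h t / upper_tail D t < 2" by (rule order_tendstoD[OF inv]) simp
      then have "\<forall>\<^sub>F t in at_top. measure_pmf.prob D {z. t < \<bar>real_of_int z\<bar>} \<le> (1 + 2 * c) * upper_tail D t"
        using c(2)
      proof eventually_elim
        case (elim t)
        have "measure_pmf.prob D {z. t < \<bar>real_of_int z\<bar>} \<le>
            measure_pmf.prob D ({z. t < real_of_int z} \<union> {z. real_of_int z \<le> - t})"
          by (intro measure_pmf.finite_measure_mono) auto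
        also have "\<dots> \<le> upper_tail D t + measure_pmf.prob D {z. real_of_int z \<le> - t}"
          unfolding upper_tail_def by (rule measure_Un_le) auto
        finally have 1: "measure_pmf.prob D {z. t < \<bar>real_of_int z\<bar>} \<le> upper_tail D t + c * ?h t"
          using elim(2) by linarith
        have "?h t \<le> 2 * upper_tail D t" using elim(1) pos[of t] by (simp add: pos_divide_less_eq)
        then have "c * ?h t \<le> c * (2 * upper_tail D t)" using c(1) by (intro mult_left_mono) auto
        then show ?case using 1 by (simp add: algebra_simps)
      qed
      then obtain X1 where X1: "\<And>t. t \<ge> X1 \<Longrightarrow> measure_pmf.prob D {z. t < \<bar>real_of_int z\<bar>} \<le> (1 + 2 * c) * upper_tail D t"
        by (auto simp: eventually_at_top_linorder)
      \<comment> \<open>The second entry of the maximum handles t below \<open>X1\<close>, where the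
        probability is at most 1 and the right tail is at least its value at
        \<open>X1\<close>.\<close>
      show ?thesis
      proof (intro exI[of _ "max (1 + 2 * c) (1 / upper_tail D X1)"] allI impI)
        fix t :: real
        show "measure_pmf.prob D {z. t < \<bar>real_of_int z\<bar>} \<le> max (1 + 2 * c) (1 / upper_tail D X1) * upper_tail D t"
        proof (cases "t \<ge> X1")
          case True
          have "(1 + 2 * c) * upper_tail D t \<le> max (1 + 2 * c) (1 / upper_tail D X1) * upper_tail D t"
            using pos[of t] by (intro mult_right_mono) auto
          then show ?thesis using X1[OF True] by linarith
        next
          case False
          have "measure_pmf.prob D {z. t < \<bar>real_of_int z\<bar>} \<le> 1" by simp
          also have "\<dots> \<le> 1 / upper_tail D X1 * upper_tail D t"
            using anti[of t X1] False pos[of X1] by simp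
          also have "\<dots> \<le> max (1 + 2 * c) (1 / upper_tail D X1) * upper_tail D t"
            using pos[of t] by (intro mult_right_mono) auto
          finally show ?thesis .
        qed
      qed
    qed
    show "(\<lambda>k::nat. real k * pmf D (int k) / upper_tail D (real k)) \<longlonglongrightarrow> \<alpha>"
    proof -
      let ?m = "\<lambda>k::nat. p * \<alpha> * L (real k) * real k powr (-(1 + \<alpha>))"
      have Lk: "\<forall>\<^sub>F k in sequentially. L (real k) > 0"
        by (rule eventually_compose_filterlim[OF Lpos filterlim_real_sequentially])
      have mpos: "\<forall>\<^sub>F k in sequentially. ?m k > 0"
        using Lk eventually_gt_at_top[of 0] by eventually_elim (use pq alpha in simp)
      have "\<forall>\<^sub>F k in sequentially. pmf D (int k) \<noteq> 0 \<or> ?m k \<noteq> 0"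
        using mpos by eventually_elim (metis less_irrefl)
      with loc have 1: "(\<lambda>k. pmf D (int k) / ?m k) \<longlonglongrightarrow> 1" by (rule asymp_equivD_strong)
      have 2: "(\<lambda>k. ?h (real k) / upper_tail D (real k)) \<longlonglongrightarrow> 1"
        by (rule filterlim_compose[OF inv filterlim_real_sequentially])
      have lim: "(\<lambda>k. \<alpha> * (pmf D (int k) / ?m k) * (?h (real k) / upper_tail D (real k))) \<longlonglongrightarrow> \<alpha> * 1 * 1"
        by (intro tendsto_mult tendsto_const 1 2)
      have ev: "\<forall>\<^sub>F k in sequentially. \<alpha> * (pmf D (int k) / ?m k) * (?h (real k) / upper_tail D (real k)) =
          real k * pmf D (int k) / upper_tail D (real k)"
        using Lk eventually_gt_at_top[of 0]
      proof eventually_elim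
        case (elim k)
        have e: "-(1 + \<alpha>) = -\<alpha> - 1" by simp
        have "real k powr (-(1 + \<alpha>)) = real k powr (-\<alpha>) / real k"
          unfolding e using elim by (subst powr_diff) simp
        then show ?case unfolding \<open>real k powr (-(1 + \<alpha>)) = _\<close> using elim pq alpha by simp
      qed
      from Lim_transform_eventually[OF lim ev] show ?thesis by (simp only: mult_1_right mult_1_left)
    qed
  qed
qed

text \<open>The test set \<open>?Z m\<close> separates the laws: whenever \<open>X m\<close> is
  below K \<open>A m\<close> it is impossible under the conditioning, while the product law gives it
  probability at least c.\<close>

lemma (in stable_domain) total_variation_necessary:
  fixes X :: "nat \<Rightarrow> int"
  assumes close: "\<And>\<epsilon>. 0 < \<epsilon> \<Longrightarrow> \<forall>\<^sub>F m in sequentially. \<forall>S.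
    \<bar>iid_prob D (Suc m) {y. (\<Sum>j=1..Suc m. y j) = X m + \<lfloor>B m\<rfloor> \<and> delete_max (Suc m) y \<in> S} /
      iid_prob D (Suc m) {y. (\<Sum>j=1..Suc m. y j) = X m + \<lfloor>B m\<rfloor>} - iid_prob D m S\<bar> \<le> \<epsilon>"
  shows "filterlim (\<lambda>m. real_of_int (X m) / A m) at_top sequentially"
  unfolding filterlim_at_top
proof
  fix K :: real
  let ?Z = "\<lambda>m. {g. \<exists>j\<in>{1..m}. K * A m < real_of_int (g j) + real_of_int (\<Sum>j=1..m. g j) - real_of_int \<lfloor>B m\<rfloor>}"
  obtain c where c: "c > 0" "\<forall>\<^sub>F m in sequentially. c \<le> iid_prob D m (?Z m)"
    using exceeds_scale[of K] by blast
  have "\<forall>\<^sub>F m in sequentially. \<forall>S.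
    \<bar>iid_prob D (Suc m) {y. (\<Sum>j=1..Suc m. y j) = X m + \<lfloor>B m\<rfloor> \<and> delete_max (Suc m) y \<in> S} /
      iid_prob D (Suc m) {y. (\<Sum>j=1..Suc m. y j) = X m + \<lfloor>B m\<rfloor>} - iid_prob D m S\<bar> \<le> c / 2"
    by (rule close) (use c in simp)
  then show "\<forall>\<^sub>F m in sequentially. K \<le> real_of_int (X m) / A m"
    using c(2) A_ge[of 1]
  proof eventually_elim
    case (elim m)
    show ?case
    proof (rule ccontr)
      assume "\<not> K \<le> real_of_int (X m) / A m"
      then have XK: "real_of_int (X m) < K * A m" using elim(3) by (simp add: not_le pos_divide_less_eq)
      have "{y. (\<Sum>j=1..Suc m. y j) = X m + \<lfloor>B m\<rfloor> \<and> delete_max (Suc m) y \<in> ?Z m} = {}"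
      proof (intro equals0I, elim CollectE conjE bexE)
        fix y j assume y: "(\<Sum>j=1..Suc m. y j) = X m + \<lfloor>B m\<rfloor>" and j: "j \<in> {1..m}"
          and *: "K * A m < real_of_int (delete_max (Suc m) y j) +
              real_of_int (\<Sum>j=1..m. delete_max (Suc m) y j) - real_of_int \<lfloor>B m\<rfloor>"
        have "real_of_int (\<Sum>j=1..m. delete_max (Suc m) y j) =
            real_of_int (X m) + real_of_int \<lfloor>B m\<rfloor> - real_of_int (Max (y ` {1..Suc m}))"
          unfolding sum_delete_max y by simp
        moreover have "real_of_int (delete_max (Suc m) y j) \<le> real_of_int (Max (y ` {1..Suc m}))"
          using delete_max_le_Max[OF j, of y] by (simp only: of_int_le_iff)
        ultimately show False using * XK by linarith
      qed
      \<comment> \<open>The numerator is zero, so the quotient is zero whether or not its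
        denominator vanishes.\<close>
      then have "iid_prob D m (?Z m) \<le> c / 2"
        using elim(1)[rule_format, of "?Z m"] by (simp only: measure_empty)
      then show False using elim(2) c(1) by linarith
    qed
  qed
qed

section \<open>Discrete product measures\<close>

lemma first_argmax_restrict: "first_argmax n (restrict y {1..n}) = first_argmax n y"
proof -
  have "restrict y {1..n} ` {1..n} = y ` {1..n}" by (intro image_cong) auto
  then show ?thesis unfolding first_argmax_def by (intro arg_cong[where f = Least] ext) auto
qed

lemma delete_max_restrict: "delete_max n (restrict y {1..n}) = delete_max n y"
  unfolding delete_max_def first_argmax_restrict by (intro restrict_ext) auto

text \<open>The space is countable and its singletons are measurable. Consequently every function of
  a sample is measurable as soon as it maps into the target space.\<close>

lemma sets_PiM_count_space:
  assumes "finite I"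
  shows "sets (Pi\<^sub>M I (\<lambda>_. count_space (UNIV :: 'b::countable set))) = Pow (PiE I (\<lambda>_. UNIV))"
proof
  show "sets (Pi\<^sub>M I (\<lambda>_. count_space (UNIV :: 'b set))) \<subseteq> Pow (PiE I (\<lambda>_. UNIV))"
    using sets.sets_into_space[of _ "Pi\<^sub>M I (\<lambda>_. count_space (UNIV :: 'b set))"] by (auto simp: space_PiM)
  show "Pow (PiE I (\<lambda>_. UNIV)) \<subseteq> sets (Pi\<^sub>M I (\<lambda>_. count_space (UNIV :: 'b set)))"
  proof
    fix S :: "('a \<Rightarrow> 'b) set" assume S: "S \<in> Pow (PiE I (\<lambda>_. UNIV))"
    have "countable (PiE I (\<lambda>_. UNIV :: 'b set))" using assms by (intro countable_PiE) auto
    then have cS: "countable S" using S countable_subset by blast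
    have "{f} \<in> sets (Pi\<^sub>M I (\<lambda>_. count_space (UNIV :: 'b set)))" if "f \<in> S" for f
    proof -
      have "f \<in> extensional I" using that S by (auto simp: PiE_def)
      then have "{f} = PiE I (\<lambda>i. {f i})" by (rule PiE_singleton[symmetric])
      also have "\<dots> \<in> sets (Pi\<^sub>M I (\<lambda>_. count_space UNIV))"
        using assms by (intro sets_PiM_I_finite) auto
      finally show ?thesis .
    qed
    then have "(\<Union>f\<in>S. {f}) \<in> sets (Pi\<^sub>M I (\<lambda>_. count_space UNIV))"
      using cS by (intro sets.countable_UN') auto
    then show "S \<in> sets (Pi\<^sub>M I (\<lambda>_. count_space UNIV))" by simp
  qed
qed

text \<open>The points of measure zero form a countable union of null sets, hence almost every point
  has mass. This lets the law of \<xi> be handled as a \<open>pmf\<close>.\<close>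

lemma ex_pmf_of_countable:
  fixes N :: "'b::countable measure"
  assumes "prob_space N" "sets N = UNIV"
  shows "\<exists>D. measure_pmf D = N"
proof -
  interpret prob_space N by fact
  have "AE z in N. measure N {z} \<noteq> 0"
  proof (rule AE_I')
    show "(\<Union>z\<in>{z. measure N {z} = 0}. {z}) \<in> null_sets N"
    proof (rule null_sets_UN')
      fix z assume "z \<in> {z. measure N {z} = 0}"
      then show "{z} \<in> null_sets N" using assms(2) by (simp add: null_sets_def emeasure_eq_measure)
    qed (rule countableI_type)
  qed auto
  then have "N \<in> {M. prob_space M \<and> sets M = UNIV \<and> (AE x in M. measure M {x} \<noteq> 0)}"
    using assms by blast
  then have "measure_pmf (Abs_pmf N) = N" by (rule Abs_pmf_inverse)
  then show ?thesis by blast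
qed

text \<open>\<open>restrict\<close> acts as the identity on the support; it is there to land in the
  extensional functions that carry the product measure.\<close>

lemma PiM_eq_iid:
  assumes "n \<ge> 1"
  shows "Pi\<^sub>M {1..n} (\<lambda>_. measure_pmf D) =
    distr (iid D n) (Pi\<^sub>M {1..n} (\<lambda>_. count_space UNIV)) (\<lambda>y. restrict y {1..n})"
proof -
  have "prob_space.indep_vars (iid D n) (\<lambda>_. count_space UNIV) (\<lambda>i y. y i) {1..n}"
    unfolding iid_def by (rule indep_vars_Pi_pmf) simp
  then have "distr (iid D n) (Pi\<^sub>M {1..n} (\<lambda>_. count_space UNIV)) (\<lambda>y. restrict y {1..n}) =
      Pi\<^sub>M {1..n} (\<lambda>i. distr (iid D n) (count_space UNIV) (\<lambda>y. y i))"
    using assms by (subst (asm) prob_space.indep_vars_iff_distr_eq_PiM'[OF measure_pmf.prob_space_axioms]) auto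
  also have "\<dots> = Pi\<^sub>M {1..n} (\<lambda>_. measure_pmf D)"
  proof (intro PiM_cong refl)
    fix i assume "i \<in> {1..n}"
    then show "distr (iid D n) (count_space UNIV) (\<lambda>y. y i) = measure_pmf D"
      using map_iid_component[of i n D] by (metis map_pmf_rep_eq)
  qed
  finally show ?thesis ..
qed

lemma prob_iid_restrict:
  "iid_prob D n {y. P (restrict y {1..n})} = iid_prob D n {y. P y}"
proof (rule measure_pmf.finite_measure_eq_AE)
  show "AE y in iid D n. y \<in> {y. P (restrict y {1..n})} \<longleftrightarrow> y \<in> {y. P y}"
    by (intro AE_pmfI) (simp only: mem_Collect_eq set_pmf_iid)
qed auto

lemma measure_PiM_iid:
  assumes "n \<ge> 1" "S \<subseteq> PiE {1..n} (\<lambda>_. UNIV)"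
  shows "measure (Pi\<^sub>M {1..n} (\<lambda>_. measure_pmf D)) S = iid_prob D n S"
proof -
  have "S \<in> sets (Pi\<^sub>M {1..n} (\<lambda>_. count_space UNIV))"
    using assms(2) by (simp add: sets_PiM_count_space)
  then have "measure (Pi\<^sub>M {1..n} (\<lambda>_. measure_pmf D)) S = iid_prob D n {y. restrict y {1..n} \<in> S}"
    unfolding PiM_eq_iid[OF assms(1)]
    by (subst measure_distr) (auto simp: vimage_def space_PiM intro!: measurable_restrict)
  then show ?thesis using prob_iid_restrict[of D n "\<lambda>y. y \<in> S"] by simp
qed

section \<open>Samples of independent copies\<close>

locale iid_sample = prob_space M for M :: "'a measure" +
  fixes X :: "nat \<Rightarrow> 'a \<Rightarrow> int" and D :: "int pmf"
  assumes indep: "indep_vars (\<lambda>_. count_space UNIV) X {1..}"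
    and ident: "\<And>i. i \<ge> 1 \<Longrightarrow> distr M (count_space UNIV) (X i) = measure_pmf D"
begin

abbreviation sample :: "nat \<Rightarrow> 'a \<Rightarrow> nat \<Rightarrow> int" where
  "sample n \<omega> \<equiv> (\<lambda>i\<in>{1..n}. X i \<omega>)"

lemma measurable_X: "i \<ge> 1 \<Longrightarrow> X i \<in> M \<rightarrow>\<^sub>M count_space UNIV"
  using indep by (simp add: indep_vars_def)

lemma measurable_sample: "sample n \<in> M \<rightarrow>\<^sub>M Pi\<^sub>M {1..n} (\<lambda>_. count_space UNIV)"
  by (rule measurable_restrict) (simp add: measurable_X)

lemma measurable_of_sample:
  assumes "\<And>y. f y \<in> space N"
  shows "(\<lambda>\<omega>. f (sample n \<omega>)) \<in> M \<rightarrow>\<^sub>M N"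
proof (rule measurable_compose[OF measurable_sample])
  show "f \<in> Pi\<^sub>M {1..n} (\<lambda>_. count_space UNIV) \<rightarrow>\<^sub>M N"
    using assms by (intro measurableI) (auto simp: sets_PiM_count_space space_PiM)
qed

text \<open>The bridge from the given random variables to \<open>iid\<close>: independence
  identifies the law of the sample with the product measure, and all later probabilities are
  computed on the discrete side.\<close>

lemma prob_sample:
  assumes "n \<ge> 1"
  shows "prob {\<omega> \<in> space M. P (sample n \<omega>)} = iid_prob D n {y. P y}"
proof -
  let ?N = "Pi\<^sub>M {1..n} (\<lambda>_. count_space (UNIV :: int set))"
  let ?S = "{y \<in> PiE {1..n} (\<lambda>_. UNIV). P y}"
  have "indep_vars (\<lambda>_. count_space UNIV) X {1..n}" by (rule indep_vars_subset[OF indep]) auto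
  then have "distr M ?N (sample n) = Pi\<^sub>M {1..n} (\<lambda>i. distr M (count_space UNIV) (X i))"
    using assms by (subst (asm) indep_vars_iff_distr_eq_PiM') (auto simp: measurable_X)
  also have "\<dots> = Pi\<^sub>M {1..n} (\<lambda>_. measure_pmf D)"
    using ident by (intro PiM_cong) auto
  finally have law: "distr M ?N (sample n) = Pi\<^sub>M {1..n} (\<lambda>_. measure_pmf D)" .
  have "{\<omega> \<in> space M. P (sample n \<omega>)} = sample n -` ?S \<inter> space M" by auto
  also have "prob \<dots> = measure (distr M ?N (sample n)) ?S"
    by (rule measure_distr[symmetric, OF measurable_sample]) (auto simp: sets_PiM_count_space)
  also have "\<dots> = iid_prob D n ?S"
    unfolding law by (rule measure_PiM_iid[OF assms]) auto
  also have "\<dots> = iid_prob D n {y. P y}"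
    using prob_iid_restrict[of D n P] prob_iid_restrict[of D n "\<lambda>y. y \<in> ?S"] by simp
  finally show ?thesis .
qed

lemma measure_cond_law:
  assumes n: "n \<ge> 1" and E: "E = {\<omega> \<in> space M. P (sample n \<omega>)}" "prob E > 0"
    and f: "\<And>y. f y \<in> space N" and S: "S \<in> sets N"
  shows "measure (cond_law M N (\<lambda>\<omega>. f (sample n \<omega>)) E) S =
    iid_prob D n {y. P y \<and> f y \<in> S} / iid_prob D n {y. P y}"
proof -
  have m: "(\<lambda>\<omega>. f (sample n \<omega>)) \<in> M \<rightarrow>\<^sub>M N" by (rule measurable_of_sample[OF f])
  have E0: "emeasure M E \<noteq> 0" "emeasure M E \<noteq> \<infinity>" using E(2) by (auto simp: emeasure_eq_measure)
  have "measure (cond_law M N (\<lambda>\<omega>. f (sample n \<omega>)) E) S =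
      measure (uniform_measure M E) ((\<lambda>\<omega>. f (sample n \<omega>)) -` S \<inter> space M)"
    unfolding cond_law_def using m S by (subst measure_distr) auto
  also have "\<dots> = prob (E \<inter> ((\<lambda>\<omega>. f (sample n \<omega>)) -` S \<inter> space M)) / prob E"
    by (rule measure_uniform_measure[OF E0 measurable_sets[OF m S]])
  also have "E \<inter> ((\<lambda>\<omega>. f (sample n \<omega>)) -` S \<inter> space M) = {\<omega> \<in> space M. P (sample n \<omega>) \<and> f (sample n \<omega>) \<in> S}"
    using E(1) by auto
  also have "prob {\<omega> \<in> space M. P (sample n \<omega>) \<and> f (sample n \<omega>) \<in> S} =
      iid_prob D n {y. P y \<and> f y \<in> S}"
    by (rule prob_sample[OF n])
  also have "prob E = iid_prob D n {y. P y}"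
    unfolding E(1) by (rule prob_sample[OF n])
  finally show ?thesis .
qed

lemma prob_space_cond_law:
  assumes "prob E > 0" "f \<in> M \<rightarrow>\<^sub>M N"
  shows "prob_space (cond_law M N f E)"
proof -
  have "prob_space (uniform_measure M E)"
    using assms(1) by (intro prob_space_uniform_measure) (auto simp: emeasure_eq_measure)
  then show ?thesis unfolding cond_law_def using assms(2) by (intro prob_space.prob_space_distr) auto
qed

end

text \<open>For probability measures the differences are bounded by 1, which makes the real supremum
  in \<open>tv_dist\<close> a genuine one.\<close>

lemma tv_dist_le_iff:
  assumes "prob_space P" "prob_space Q"
  shows "tv_dist P Q \<le> \<epsilon> \<longleftrightarrow> (\<forall>S\<in>sets P. \<bar>measure P S - measure Q S\<bar> \<le> \<epsilon>)"
proof -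
  have "\<bar>measure P S - measure Q S\<bar> \<le> 1" for S
    using prob_space.prob_le_1[OF assms(1), of S] prob_space.prob_le_1[OF assms(2), of S]
      measure_nonneg[of P S] measure_nonneg[of Q S] by linarith
  then have "bdd_above ((\<lambda>S. \<bar>measure P S - measure Q S\<bar>) ` sets P)" by (intro bdd_aboveI2[of _ _ 1])
  moreover have "sets P \<noteq> {}" using sets.empty_sets by blast
  ultimately show ?thesis unfolding tv_dist_def by (subst cSUP_le_iff) auto
qed

lemma tv_dist_nonneg:
  assumes "prob_space P" "prob_space Q"
  shows "0 \<le> tv_dist P Q"
proof -
  have "\<forall>S\<in>sets P. \<bar>measure P S - measure Q S\<bar> \<le> tv_dist P Q"
    by (rule iffD1[OF tv_dist_le_iff[OF assms] order_refl])
  from bspec[OF this sets.empty_sets] show ?thesis by simp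
qed

theorem corollary3p5:
  fixes M :: "'a measure" and \<xi> :: "'a \<Rightarrow> int" and X :: "nat \<Rightarrow> 'a \<Rightarrow> int"
    and S :: "nat \<Rightarrow> 'a \<Rightarrow> int"
    and L :: "real \<Rightarrow> real" and \<alpha> p q :: real and a b :: "nat \<Rightarrow> real"
    and \<sigma> :: "real measure" and x :: "nat \<Rightarrow> int" and E :: "nat \<Rightarrow> 'a set"
  assumes prob: "prob_space M"
    and xi: "\<xi> \<in> measurable M (count_space UNIV)"
    and indep: "prob_space.indep_vars M (\<lambda>_. count_space UNIV) X {1..}"
    and ident: "\<And>i. i \<ge> 1 \<Longrightarrow> distr M (count_space UNIV) (X i) = distr M (count_space UNIV) \<xi>"
    and S_def: "\<And>n \<omega>. S n \<omega> = (\<Sum>i=1..n. X i \<omega>)"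
    and alpha: "0 < \<alpha>" "\<alpha> < 2"
    and L: "slowly_varying L"
    and pq: "p > 0" "q \<ge> 0" "p + q = 1"
    and right_tail: "(\<lambda>t. 1 - dist_fun M \<xi> t) \<sim>[at_top] (\<lambda>t. p * L t * t powr (-\<alpha>))"
    and left_tail: "if q = 0
        then (\<lambda>t. dist_fun M \<xi> (- t)) \<in> o[at_top](\<lambda>t. L t * t powr (-\<alpha>))
        else (\<lambda>t. dist_fun M \<xi> (- t)) \<sim>[at_top] (\<lambda>t. q * L t * t powr (-\<alpha>))"
    and local_tail: "(\<lambda>k::nat. measure M {\<omega> \<in> space M. \<xi> \<omega> = int k})
        \<sim>[at_top] (\<lambda>k. p * \<alpha> * L (real k) * real k powr (-(1 + \<alpha>)))"
    and a_pos: "\<And>n. n \<ge> 1 \<Longrightarrow> a n > 0"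
    and a_top: "filterlim a at_top sequentially"
    and a_norm: "(\<lambda>n. L (a n) * a n powr (-\<alpha>)) \<sim>[sequentially] (\<lambda>n. 1 / real n)"
    and b_def: "\<And>n. n \<ge> 1 \<Longrightarrow> b n =
        (if \<alpha> < 1 then 0
         else if \<alpha> = 1 then
           real n * (LINT \<omega>|M. real_of_int (\<xi> \<omega>) * indicator {\<omega>. \<bar>real_of_int (\<xi> \<omega>)\<bar> \<le> a n} \<omega>)
         else real n * (LINT \<omega>|M. real_of_int (\<xi> \<omega>)))"
    and stable: "stable_law \<alpha> \<sigma>"
    and stable_lim: "weak_conv_m
        (\<lambda>n. distr M borel (\<lambda>\<omega>. (real_of_int (S n \<omega>) - b n) / a n)) \<sigma>"
    and E_def: "\<And>n. E n = {\<omega> \<in> space M. S n \<omega> - \<lfloor>b n\<rfloor> = x n}"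
    and E_pos: "eventually (\<lambda>n. measure M (E n) > 0) sequentially"
  shows "(filterlim (\<lambda>n. real_of_int (x n) / a n) at_top sequentially \<longleftrightarrow>
      (\<lambda>n. tv_dist
         (cond_law M (Pi\<^sub>M {1..n - 1} (\<lambda>_. count_space UNIV)) (\<lambda>\<omega>. delete_max n (\<lambda>i. X i \<omega>)) (E n))
         (Pi\<^sub>M {1..n - 1} (\<lambda>_. distr M (count_space UNIV) \<xi>))) \<longlonglongrightarrow> 0) \<and>
    (filterlim (\<lambda>n. real_of_int (x n) / a n) at_top sequentially \<longrightarrow>
      weak_conv_m
        (\<lambda>n. cond_law M borel
           (\<lambda>\<omega>. (real_of_int (x n) - real_of_int (Max ((\<lambda>i. X i \<omega>) ` {1..n}))) / a n) (E n)) \<sigma>)"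
proof -
  interpret prob_space M by (rule prob)
  have "\<exists>D. measure_pmf D = distr M (count_space UNIV) \<xi>"
    using xi by (intro ex_pmf_of_countable prob_space_distr) auto
  then obtain D where D: "distr M (count_space UNIV) \<xi> = measure_pmf D" by metis
  interpret iid_sample M X D
    by unfold_locales (use indep ident D in auto)
  have probD: "measure_pmf.prob D U = measure M {\<omega> \<in> space M. \<xi> \<omega> \<in> U}" for U
    unfolding D[symmetric] using xi by (subst measure_distr) (auto intro!: arg_cong[where f = "measure M"])
  have expD: "measure_pmf.expectation D f = (LINT \<omega>|M. f (\<xi> \<omega>))" for f :: "int \<Rightarrow> real"
    unfolding D[symmetric] using xi by (intro integral_distr) auto
  have xiR: "(\<lambda>\<omega>. real_of_int (\<xi> \<omega>)) \<in> borel_measurable M" using xi by measurable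
  have F: "dist_fun M \<xi> t = measure_pmf.prob D {z. real_of_int z \<le> t}" for t
    unfolding dist_fun_def cdf_def probD using xiR
    by (subst measure_distr) (auto intro!: arg_cong[where f = "measure M"])
  have G: "upper_tail D = (\<lambda>t. 1 - dist_fun M \<xi> t)"
  proof
    fix t
    have "{z. t < real_of_int z} = UNIV - {z. real_of_int z \<le> t}" by auto
    then show "upper_tail D t = 1 - dist_fun M \<xi> t"
      unfolding F upper_tail_def using measure_pmf.prob_compl[of "{z. real_of_int z \<le> t}" D] by simp
  qed
  have loc: "pmf D (int k) = measure M {\<omega> \<in> space M. \<xi> \<omega> = int k}" for k
    using probD[of "{int k}"] by (simp add: measure_pmf_single)
  note tl = tail_law_of_asymptotics[OF alpha L pq(1,2), of D, unfolded loc, folded F,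
      OF right_tail[folded G] left_tail local_tail]
  interpret tail_law D \<alpha> by (rule tl(1))
  have Lpos: "\<forall>\<^sub>F t in at_top. L t > 0"
    using L unfolding slowly_varying_def eventually_at_top_linorder by blast
  have weak: "(\<lambda>n. iid_prob D n {y. (real_of_int (\<Sum>j=1..n. y j) - b n) / a n \<le> t}) \<longlonglongrightarrow> cdf \<sigma> t"
    if "isCont (cdf \<sigma>) t" for t
  proof -
    let ?c = "\<lambda>n. cdf (distr M borel (\<lambda>\<omega>. (real_of_int (S n \<omega>) - b n) / a n)) t"
    have "?c \<longlonglongrightarrow> cdf \<sigma> t" using stable_lim that unfolding weak_conv_m_def weak_conv_def by blast
    moreover have "\<forall>\<^sub>F n in sequentially. ?c n =
        iid_prob D n {y. (real_of_int (\<Sum>j=1..n. y j) - b n) / a n \<le> t}"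
      using eventually_ge_at_top[of 1]
    proof eventually_elim
      case (elim n)
      let ?f = "\<lambda>y::nat \<Rightarrow> int. (real_of_int (\<Sum>j=1..n. y j) - b n) / a n"
      have eq: "(real_of_int (S n \<omega>) - b n) / a n = ?f (sample n \<omega>)" for \<omega>
        by (simp add: S_def)
      have "?c n = measure M ((\<lambda>\<omega>. ?f (sample n \<omega>)) -` {..t} \<inter> space M)"
        unfolding cdf_def eq by (rule measure_distr[OF measurable_of_sample]) auto
      also have "\<dots> = measure M {\<omega> \<in> space M. ?f (sample n \<omega>) \<le> t}"
        by (intro arg_cong[where f = "measure M"]) auto
      also have "\<dots> = iid_prob D n {y. ?f y \<le> t}" by (rule prob_sample[OF elim])
      finally show ?case .
    qed
    ultimately show ?thesis by (rule Lim_transform_eventually)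
  qed
  have sig: "real_distribution \<sigma>" using stable by (simp add: stable_law_def)
  interpret stable_domain D \<alpha> a b p
  proof
    show "p > 0" by (rule pq)
    show "filterlim a at_top sequentially" by (rule a_top)
    show "(\<lambda>n. real n * G (a n)) \<longlonglongrightarrow> p"
    proof -
      have "\<forall>\<^sub>F n in sequentially. L (a n) * a n powr (-\<alpha>) \<noteq> 0 \<or> 1 / real n \<noteq> 0"
        using eventually_gt_at_top[of 0] by eventually_elim simp
      with a_norm have "(\<lambda>n. L (a n) * a n powr (-\<alpha>) / (1 / real n)) \<longlonglongrightarrow> 1" by (rule asymp_equivD_strong)
      from tendsto_mult[OF tendsto_mult[OF tendsto_const this] filterlim_compose[OF tl(2) a_top]]
      have lim: "(\<lambda>n. p * (L (a n) * a n powr (-\<alpha>) / (1 / real n)) * (G (a n) / (p * L (a n) * a n powr (-\<alpha>)))) \<longlonglongrightarrow> p * 1 * 1" .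
      have ev: "\<forall>\<^sub>F n in sequentially. p * (L (a n) * a n powr (-\<alpha>) / (1 / real n)) * (G (a n) / (p * L (a n) * a n powr (-\<alpha>)))
          = real n * G (a n)"
        using eventually_compose_filterlim[OF Lpos a_top] eventually_ge_at_top[of 1]
      proof eventually_elim
        case (elim n)
        have "a n powr (-\<alpha>) > 0" using a_pos[OF elim(2)] by simp
        then show ?case using elim(1) pq(1) by simp
      qed
      from Lim_transform_eventually[OF lim ev] show ?thesis by simp
    qed
    show "b n = real n * center (a n)" if "n \<ge> 1" for n
      unfolding b_def[OF that] center_def trunc_mean_def expD
      by (auto simp: indicator_def intro!: Bochner_Integration.integral_cong)
    show "\<exists>T>0. \<forall>\<^sub>F n in sequentially.
      iid_prob D n {y. T * a n < \<bar>real_of_int (\<Sum>j=1..n. y j) - b n\<bar>} \<le> \<epsilon>" if eps: "\<epsilon> > 0" for \<epsilon>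
    proof -
      let ?P = "\<lambda>n t. iid_prob D n {y. (real_of_int (\<Sum>j=1..n. y j) - b n) / a n \<le> t}"
      have "?P n s \<le> ?P n t" if "s \<le> t" for n s t
        using that by (intro measure_pmf.finite_measure_mono) auto
      from tight_of_weak_limit[of \<sigma> ?P, OF sig weak this eps]
      obtain T where T: "T > 0" "\<forall>\<^sub>F n in sequentially. ?P n (- T) + (1 - ?P n T) \<le> \<epsilon>" by blast
      have "\<forall>\<^sub>F n in sequentially.
        iid_prob D n {y. T * a n < \<bar>real_of_int (\<Sum>j=1..n. y j) - b n\<bar>} \<le> \<epsilon>"
        using T(2) eventually_ge_at_top[of 1]
      proof eventually_elim
        case (elim n)
        let ?f = "\<lambda>y::nat \<Rightarrow> int. (real_of_int (\<Sum>j=1..n. y j) - b n) / a n"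
        have "iid_prob D n {y. T * a n < \<bar>real_of_int (\<Sum>j=1..n. y j) - b n\<bar>} \<le>
          iid_prob D n ({y. ?f y \<le> - T} \<union> (UNIV - {y. ?f y \<le> T}))"
        proof (intro measure_pmf.finite_measure_mono subsetI)
          fix y assume "y \<in> {y. T * a n < \<bar>real_of_int (\<Sum>j=1..n. y j) - b n\<bar>}"
          then have "T < \<bar>real_of_int (\<Sum>j=1..n. y j) - b n\<bar> / a n"
            using a_pos[OF elim(2)] by (simp add: pos_less_divide_eq)
          also have "\<dots> = \<bar>?f y\<bar>" using a_pos[OF elim(2)] by simp
          finally have "?f y \<le> - T \<or> \<not> ?f y \<le> T" by linarith
          then show "y \<in> {y. ?f y \<le> - T} \<union> (UNIV - {y. ?f y \<le> T})" by blast
        qed auto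
        also have "\<dots> \<le> ?P n (- T) + iid_prob D n (UNIV - {y. ?f y \<le> T})"
          by (rule measure_Un_le) auto
        also have "iid_prob D n (UNIV - {y. ?f y \<le> T}) = 1 - ?P n T"
          using measure_pmf.prob_compl[of "{y. ?f y \<le> T}" "iid D n"] by simp
        finally show ?case using elim(1) by linarith
      qed
      with T(1) show ?thesis by blast
    qed
  qed
  \<comment> \<open>From here n = \<open>Suc m\<close>, which removes the subtraction in the index
    range; limits along n and along \<open>Suc m\<close> agree.\<close>
  let ?k = "\<lambda>m. x (Suc m) + \<lfloor>b (Suc m)\<rfloor>"
  let ?Q = "\<lambda>m. iid_prob D m"
  let ?cond = "\<lambda>m U. iid_prob D (Suc m) {y. (\<Sum>j=1..Suc m. y j) = ?k m \<and> delete_max (Suc m) y \<in> U} /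
      iid_prob D (Suc m) {y. (\<Sum>j=1..Suc m. y j) = ?k m}"
  let ?N = "\<lambda>m. Pi\<^sub>M {1..m} (\<lambda>_. count_space (UNIV :: int set))"
  let ?law = "\<lambda>n. cond_law M (Pi\<^sub>M {1..n - 1} (\<lambda>_. count_space UNIV)) (\<lambda>\<omega>. delete_max n (\<lambda>i. X i \<omega>)) (E n)"
  let ?prod = "\<lambda>n. Pi\<^sub>M {1..n - 1} (\<lambda>_. distr M (count_space UNIV) \<xi>)"
  let ?top = "filterlim (\<lambda>n. real_of_int (x n) / a n) at_top sequentially"
  let ?close = "\<forall>\<epsilon>>0. \<forall>\<^sub>F m in sequentially. \<forall>U. \<bar>?cond m U - ?Q m U\<bar> \<le> \<epsilon>"
  have E: "E (Suc m) = {\<omega> \<in> space M. (\<Sum>j=1..Suc m. sample (Suc m) \<omega> j) = ?k m}" for m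
    unfolding E_def S_def by (intro Collect_cong conj_cong refl) (auto simp: algebra_simps)
  have top_Suc: "?top \<longleftrightarrow> filterlim (\<lambda>m. real_of_int (x (Suc m)) / a (Suc m)) at_top sequentially"
    by (rule filterlim_sequentially_Suc[symmetric])
  have E_pos': "\<forall>\<^sub>F m in sequentially. measure M (E (Suc m)) > 0"
    using E_pos by (subst eventually_sequentially_Suc)
  have law: "measure (?law (Suc m)) U = ?cond m U" if "measure M (E (Suc m)) > 0" "U \<in> sets (?N m)" for m U
  proof -
    have fun_eq: "(\<lambda>\<omega>. delete_max (Suc m) (\<lambda>i. X i \<omega>)) = (\<lambda>\<omega>. delete_max (Suc m) (sample (Suc m) \<omega>))"
      by (simp only: delete_max_restrict)
    show ?thesis
      unfolding diff_Suc_1 fun_eq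
      by (rule measure_cond_law[OF _ E that(1) _ that(2)]) (auto simp: space_PiM delete_max_def)
  qed
  have prod: "measure (?prod (Suc m)) U = ?Q m U" if "m \<ge> 1" "U \<in> sets (?N m)" for m U
    unfolding diff_Suc_1 D using that by (intro measure_PiM_iid) (auto simp: sets_PiM_count_space)
  have ps: "prob_space (?law (Suc m))" "prob_space (?prod (Suc m))" if "measure M (E (Suc m)) > 0" for m
  proof -
    have "(\<lambda>\<omega>. delete_max (Suc m) (sample (Suc m) \<omega>)) \<in> M \<rightarrow>\<^sub>M ?N m"
      by (rule measurable_of_sample) (auto simp: space_PiM delete_max_def)
    then show "prob_space (?law (Suc m))"
      unfolding diff_Suc_1 delete_max_restrict by (rule prob_space_cond_law[OF that])
    show "prob_space (?prod (Suc m))"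
      unfolding D by (intro prob_space_PiM measure_pmf.prob_space_axioms)
  qed
  have tv_iff: "tv_dist (?law (Suc m)) (?prod (Suc m)) \<le> \<epsilon> \<longleftrightarrow> (\<forall>U. \<bar>?cond m U - ?Q m U\<bar> \<le> \<epsilon>)"
    if pos: "measure M (E (Suc m)) > 0" and m: "m \<ge> 1" for m \<epsilon>
  proof -
    have sets: "sets (?law (Suc m)) = Pow (PiE {1..m} (\<lambda>_. UNIV))"
      by (simp add: cond_law_def sets_PiM_count_space)
    have "tv_dist (?law (Suc m)) (?prod (Suc m)) \<le> \<epsilon> \<longleftrightarrow>
        (\<forall>U\<in>Pow (PiE {1..m} (\<lambda>_. UNIV)). \<bar>?cond m U - ?Q m U\<bar> \<le> \<epsilon>)"
      unfolding tv_dist_le_iff[OF ps[OF pos]] sets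
      using law[OF pos] prod[OF m] by (intro ball_cong refl) (simp add: sets_PiM_count_space)
    also have "\<dots> \<longleftrightarrow> (\<forall>U. \<bar>?cond m U - ?Q m U\<bar> \<le> \<epsilon>)"
    proof (intro iffI allI ballI)
      fix U :: "(nat \<Rightarrow> int) set"
      \<comment> \<open>The \<sigma>-algebra contains only sets of extensional functions, whereas
        the estimates run over all sets. Both laws are concentrated on extensional functions, so
        intersecting with them changes neither probability.\<close>
      let ?U = "U \<inter> PiE {1..m} (\<lambda>_. UNIV)"
      assume "\<forall>U\<in>Pow (PiE {1..m} (\<lambda>_. UNIV)). \<bar>?cond m U - ?Q m U\<bar> \<le> \<epsilon>"
      then have "\<bar>?cond m ?U - ?Q m ?U\<bar> \<le> \<epsilon>" by blast
      moreover have "delete_max (Suc m) y \<in> ?U \<longleftrightarrow> delete_max (Suc m) y \<in> U" for y :: "nat \<Rightarrow> int"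
        by (auto simp: delete_max_def)
      moreover have "?Q m ?U = ?Q m U"
        using prob_iid_restrict[of D m "\<lambda>y. y \<in> U"] prob_iid_restrict[of D m "\<lambda>y. y \<in> ?U"] by (simp add: Int_def)
      ultimately show "\<bar>?cond m U - ?Q m U\<bar> \<le> \<epsilon>" by simp
    qed blast
    finally show ?thesis .
  qed
  have tv_close: "(\<lambda>n. tv_dist (?law n) (?prod n)) \<longlonglongrightarrow> 0 \<longleftrightarrow> ?close"
  proof -
    have "(\<lambda>n. tv_dist (?law n) (?prod n)) \<longlonglongrightarrow> 0 \<longleftrightarrow> (\<lambda>m. tv_dist (?law (Suc m)) (?prod (Suc m))) \<longlonglongrightarrow> 0"
      by (rule filterlim_sequentially_Suc[symmetric])
    also have "\<dots> \<longleftrightarrow> ?close"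
    proof
      assume *: "(\<lambda>m. tv_dist (?law (Suc m)) (?prod (Suc m))) \<longlonglongrightarrow> 0"
      show ?close
      proof (intro allI impI)
        fix \<epsilon> :: real assume "\<epsilon> > 0"
        then have "\<forall>\<^sub>F m in sequentially. tv_dist (?law (Suc m)) (?prod (Suc m)) < \<epsilon>"
          by (intro order_tendstoD[OF *])
        then show "\<forall>\<^sub>F m in sequentially. \<forall>U. \<bar>?cond m U - ?Q m U\<bar> \<le> \<epsilon>"
          using E_pos' eventually_ge_at_top[of 1]
        proof eventually_elim
          case (elim m)
          show ?case using tv_iff[OF elim(2,3), of \<epsilon>] elim(1) by simp
        qed
      qed
    next
      assume close: ?close
      show "(\<lambda>m. tv_dist (?law (Suc m)) (?prod (Suc m))) \<longlonglongrightarrow> 0"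
      proof (rule tendstoI)
        fix e :: real assume e: "e > 0"
        have "\<forall>\<^sub>F m in sequentially. \<forall>U. \<bar>?cond m U - ?Q m U\<bar> \<le> e / 2"
          by (rule close[rule_format, OF half_gt_zero[OF e]])
        then show "\<forall>\<^sub>F m in sequentially. dist (tv_dist (?law (Suc m)) (?prod (Suc m))) 0 < e"
          using E_pos' eventually_ge_at_top[of 1]
        proof eventually_elim
          case (elim m)
          have "tv_dist (?law (Suc m)) (?prod (Suc m)) \<le> e / 2"
            using tv_iff[OF elim(2,3), of "e / 2"] elim(1) by blast
          then show ?case using tv_dist_nonneg[OF ps[OF elim(2)]] e unfolding dist_real_def by linarith
        qed
      qed
    qed
    finally show ?thesis .
  qed
  have top_imp_close: ?close if ?top
  proof -
    interpret large_deviation D \<alpha> a b p "\<lambda>m. x (Suc m)"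
      using that unfolding top_Suc by unfold_locales
    show ?close using conditional_law_close by blast
  qed
  have close_imp_top: ?top if ?close
    unfolding top_Suc using that by (intro total_variation_necessary) blast
  have "weak_conv_m (\<lambda>n. cond_law M borel
      (\<lambda>\<omega>. (real_of_int (x n) - real_of_int (Max ((\<lambda>i. X i \<omega>) ` {1..n}))) / a n) (E n)) \<sigma>"
    if ?top
    unfolding weak_conv_m_def weak_conv_def
  proof (intro allI impI)
    fix t assume t: "isCont (cdf \<sigma>) t"
    let ?Z = "\<lambda>n (y :: nat \<Rightarrow> int). (real_of_int (x n) - real_of_int (Max (y ` {1..n}))) / a n"
    let ?c = "\<lambda>n. cdf (cond_law M borel (\<lambda>\<omega>. ?Z n (\<lambda>i. X i \<omega>)) (E n)) t"
    let ?U = "\<lambda>m. {g. (real_of_int (\<Sum>j=1..m. g j) - real_of_int \<lfloor>B m\<rfloor>) / A m \<le> t}"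
    have c: "?c (Suc m) = ?cond m (?U m)" if "measure M (E (Suc m)) > 0" for m
    proof -
      have img: "sample (Suc m) \<omega> ` {1..Suc m} = (\<lambda>i. X i \<omega>) ` {1..Suc m}" for \<omega>
        by (intro image_cong) auto
      have fun_eq: "(\<lambda>\<omega>. ?Z (Suc m) (\<lambda>i. X i \<omega>)) = (\<lambda>\<omega>. ?Z (Suc m) (sample (Suc m) \<omega>))"
        by (simp only: img)
      have "?c (Suc m) = iid_prob D (Suc m) {y. (\<Sum>j=1..Suc m. y j) = ?k m \<and> ?Z (Suc m) y \<in> {..t}} /
          iid_prob D (Suc m) {y. (\<Sum>j=1..Suc m. y j) = ?k m}"
        unfolding cdf_def fun_eq by (rule measure_cond_law[OF _ E that]) auto
      also have "{y. (\<Sum>j=1..Suc m. y j) = ?k m \<and> ?Z (Suc m) y \<in> {..t}} =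
          {y. (\<Sum>j=1..Suc m. y j) = ?k m \<and> delete_max (Suc m) y \<in> ?U m}"
      proof (intro Collect_cong conj_cong refl)
        fix y :: "nat \<Rightarrow> int" assume y: "(\<Sum>j=1..Suc m. y j) = ?k m"
        have "real_of_int (\<Sum>j=1..m. delete_max (Suc m) y j) - real_of_int \<lfloor>B m\<rfloor> =
            real_of_int (x (Suc m)) - real_of_int (Max (y ` {1..Suc m}))"
          unfolding sum_delete_max y by simp
        then show "?Z (Suc m) y \<in> {..t} \<longleftrightarrow> delete_max (Suc m) y \<in> ?U m"
          by (simp only: mem_Collect_eq atMost_iff)
      qed
      finally show ?thesis .
    qed
    have "(\<lambda>m. ?c (Suc m)) \<longlonglongrightarrow> cdf \<sigma> t"
    proof (rule tendstoI)
      fix e :: real assume e: "e > 0"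
      have "(\<lambda>m. ?Q m (?U m)) \<longlonglongrightarrow> cdf \<sigma> t" by (rule weak_limit_pred[OF sig weak t])
      then have "\<forall>\<^sub>F m in sequentially. dist (?Q m (?U m)) (cdf \<sigma> t) < e / 2"
        by (rule tendstoD) (use e in simp)
      \<comment> \<open>Uniformity in the set matters here: the half-space \<open>?U m\<close>
        changes with m.\<close>
      moreover have "\<forall>\<^sub>F m in sequentially. \<forall>U. \<bar>?cond m U - ?Q m U\<bar> \<le> e / 2"
        by (rule top_imp_close[OF \<open>?top\<close>, rule_format, OF half_gt_zero[OF e]])
      ultimately show "\<forall>\<^sub>F m in sequentially. dist (?c (Suc m)) (cdf \<sigma> t) < e"
        using E_pos'
      proof eventually_elim
        case (elim m)
        have "\<bar>?cond m (?U m) - ?Q m (?U m)\<bar> \<le> e / 2" using elim(2) by blast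
        then show ?case using elim(1) unfolding c[OF elim(3)] dist_real_def by linarith
      qed
    qed
    then show "?c \<longlonglongrightarrow> cdf \<sigma> t" by (rule LIMSEQ_imp_Suc)
  qed
  then show ?thesis using tv_close top_imp_close close_imp_top by blast
qed

end
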